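(* For every positive integer $n$, the DSASM partition function satisfies $$Z_n(u_1,\ldots,u_n)=\prod_{1\le i<j\le n}\frac{\widehat\sigma(q^2u_iu_j)\,\widehat\sigma(q^2\bar u_i\bar u_j)}{\widehat\sigma(u_i\bar u_j)}\;\operatorname*{Pf}_{\chi_{\mathrm{even}}(n)\le i<j\le n}\left(\begin{cases}Z_1(u_j),&i=0\\[1.5mm] \displaystyle\frac{\widehat\sigma(u_i\bar u_j)\,Z_2(u_i,u_j)}{\widehat\sigma(q^2u_iu_j)\,\widehat\sigma(q^2\bar u_i\bar u_j)},&i\ge1\end{cases}\right).$$ More explicitly, $$Z_n(u_1,\ldots,u_n)=\prod_{i=1}^n\phi(u_i)\prod_{1\le i<j\le n}\frac{\widehat\sigma(q^2u_iu_j)\,\widehat\sigma(q^2\bar u_i\bar u_j)}{\widehat\sigma(u_i\bar u_j)}\;\operatorname*{Pf}_{\chi_{\mathrm{even}}(n)\le i<j\le n}(B_{ij}),$$ where $B_{0j}=\alpha qu_j+\beta\bar q\bar u_j$ and, for $i\ge1$, $$B_{ij}=\frac{\widehat\sigma(u_i\bar u_j)\bigl((\alpha qu_i+\beta\bar q\bar u_i)(\alpha qu_j+\beta\bar q\bar u_j)\,\widehat\sigma(q^2\bar u_i\bar u_j)+\gamma\,\delta\,\sigma(q^2u_i^2)\,\sigma(q^2u_j^2)\bigr)}{\widehat\sigma(q^2u_iu_j)\,\widehat\sigma(q^2\bar u_i\bar u_j)}.$$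
   Context: Notation: $\bar x=x^{-1}$, $\sigma(x)=x-\bar x$, and $\widehat\sigma(x)=\sigma(x)/\sigma(q^4)$, where $q$ is a fixed indeterminate. $\alpha,\beta,\gamma,\delta$ are arbitrary constants and $\phi$ is an arbitrary function of one variable, not identically zero. $u_1,\ldots,u_n$ are indeterminates. $\chi_{\mathrm{even}}(n)$ is $1$ if $n$ is even and $0$ if $n$ is odd. $\operatorname{Pf}_{a\le i<j\le b}(B_{ij})$ is the Pfaffian of the skew-symmetric matrix with rows and columns indexed by $a,\ldots,b$ whose strictly upper triangular part is $(B_{ij})_{a\le i<j\le b}$. Graph $\mathcal T_n$ (rows numbered downwards, columns rightwards): its vertices are top vertices $(0,j)$, $1\le j\le n$; left boundary vertices $(i,i)$, $1\le i\le n$; bulk vertices $(i,j)$, $1\le i<j\le n$; right boundary vertices $(i,n+1)$, $1\le i\le n$. Its edges are the vertical edges between $(i-1,j)$ and $(i,j)$ and the horizontal edges between $(i,j)$ and $(i,j+1)$, for $1\le i\le j\le n$. So each left boundary vertex has one edge above it and one edge to its right, and each bulk vertex has four edges. A six-vertex model configuration on $\mathcal T_n$ is an orientation of the edges such that each bulk vertex has two incoming and two outgoing edges, each edge incident with a top vertex is directed upward, and each edge incident with a right boundary vertex is directed leftward. $\mathrm{6V}(n)$ denotes the set of these. For $C\in\mathrm{6V}(n)$, $C_{ij}$ is the local configuration (orientations of the incident edges) at $(i,j)$. Bulk weights $W(c,u)$: if both vertical edges are directed out of the vertex and both horizontal edges into it, or both vertical edges into it and both horizontal edges out of it, $W(c,u)=1$;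 if both vertical edges point up and both horizontal edges point right, or both vertical edges point down and both horizontal edges point left, $W(c,u)=\widehat\sigma(q^2u)$; if both vertical edges point up and both horizontal edges point left, or both vertical edges point down and both horizontal edges point right, $W(c,u)=\widehat\sigma(q^2\bar u)$. Left boundary weights $W(c,u)$: if the upper edge points up and the right edge points left, $(\alpha qu+\beta\bar q\bar u)\phi(u)$; if the upper edge points down and the right edge points right, $(\alpha\bar q\bar u+\beta qu)\phi(u)$; if both edges are directed out of the vertex, $\gamma\,\sigma(q^2u^2)\phi(u)$; if both are directed into the vertex, $\delta\,\sigma(q^2u^2)\phi(u)$. The DSASM partition function is $$Z_n(u_1,\ldots,u_n)=\sum_{C\in\mathrm{6V}(n)}\prod_{i=1}^nW(C_{ii},u_i)\prod_{1\le i<j\le n}W(C_{ij},u_iu_j).$$ *)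

theory Defs
  imports Complex_Main "HOL-Combinatorics.Permutations"
begin

definition sigma :: "'a::field \<Rightarrow> 'a" where
  "sigma x = x - inverse x"

definition sigma_hat :: "'a::field \<Rightarrow> 'a \<Rightarrow> 'a" where
  "sigma_hat q x = sigma x / sigma (q ^ 4)"

definition chi_even :: "nat \<Rightarrow> nat" where
  "chi_even n = (if even n then 1 else 0)"


subsection \<open>Pfaffians\<close>

definition skew_completion :: "(nat \<Rightarrow> nat \<Rightarrow> 'a::ring_1) \<Rightarrow> nat \<Rightarrow> nat \<Rightarrow> 'a" where
  "skew_completion B i j = (if i < j then B i j else if j < i then - B j i else 0)"

text \<open>The Pfaffian of a skew-symmetric matrix \<open>A\<close> with rows and columns indexed by
  \<open>{a..b}\<close>, as the usual normalised sum over all permutations of the index set.\<close>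

definition pfaffian :: "nat \<Rightarrow> nat \<Rightarrow> (nat \<Rightarrow> nat \<Rightarrow> 'a::field_char_0) \<Rightarrow> 'a" where
  "pfaffian a b A =
     (if odd (card {a..b}) then 0
      else let m = card {a..b} div 2 in
        (\<Sum>p | p permutes {a..b}.
           of_int (sign p) * (\<Prod>k<m. A (p (a + 2 * k)) (p (a + 2 * k + 1))))
        / (2 ^ m * fact m))"

text \<open>\<open>Pf\<^bsub>a \<le> i < j \<le> b\<^esub>(B\<^sub>i\<^sub>j)\<close>: only the strictly upper triangular entries of \<open>B\<close> matter.\<close>

definition Pf :: "nat \<Rightarrow> nat \<Rightarrow> (nat \<Rightarrow> nat \<Rightarrow> 'a::field_char_0) \<Rightarrow> 'a" where
  "Pf a b B = pfaffian a b (skew_completion B)"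


subsection \<open>The graph and the six-vertex model configurations\<close>

text \<open>Vertices are pairs (row, column), with rows numbered downwards.\<close>

type_synonym vertex = "nat \<times> nat"

definition bulk :: "nat \<Rightarrow> vertex set" where
  "bulk n = {(i, j). 1 \<le> i \<and> i < j \<and> j \<le> n}"

definition edges :: "nat \<Rightarrow> vertex set set" where
  "edges n =
     {{(i - 1, j), (i, j)} | i j. 1 \<le> i \<and> i \<le> j \<and> j \<le> n} \<union>
     {{(i, j), (i, j + 1)} | i j. 1 \<le> i \<and> i \<le> j \<and> j \<le> n}"

text \<open>An orientation is given by its set of arcs; \<open>(x, y)\<close> is the edge \<open>{x, y}\<close> directed
  from \<open>x\<close> to \<open>y\<close>.\<close>

definition orientation :: "nat \<Rightarrow> (vertex \<times> vertex) set \<Rightarrow> bool" where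
  "orientation n C \<longleftrightarrow>
     (\<forall>x y. (x, y) \<in> C \<longrightarrow> {x, y} \<in> edges n) \<and>
     (\<forall>x y. {x, y} \<in> edges n \<longrightarrow> ((x, y) \<in> C \<longleftrightarrow> (y, x) \<notin> C))"

definition six_vertex :: "nat \<Rightarrow> (vertex \<times> vertex) set set" where
  "six_vertex n = {C. orientation n C \<and>
     (\<forall>v\<in>bulk n. card {w. (w, v) \<in> C} = 2 \<and> card {w. (v, w) \<in> C} = 2) \<and>
     (\<forall>j\<in>{1..n}. ((1, j), (0, j)) \<in> C) \<and>
     (\<forall>i\<in>{1..n}. ((i, n + 1), (i, n)) \<in> C)}"

datatype vdir = Upward | Downward
datatype hdir = Leftward | Rightward

text \<open>The directions of the vertical edge between \<open>(i - 1, j)\<close> and \<open>(i, j)\<close>, and of the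
  horizontal edge between \<open>(i, j)\<close> and \<open>(i, j + 1)\<close>.\<close>

definition vert :: "(vertex \<times> vertex) set \<Rightarrow> nat \<Rightarrow> nat \<Rightarrow> vdir" where
  "vert C i j = (if ((i, j), (i - 1, j)) \<in> C then Upward else Downward)"

definition horiz :: "(vertex \<times> vertex) set \<Rightarrow> nat \<Rightarrow> nat \<Rightarrow> hdir" where
  "horiz C i j = (if ((i, j), (i, j + 1)) \<in> C then Rightward else Leftward)"

text \<open>Local configurations list the edges above, below, left and right of a bulk vertex,
  and above and right of a left boundary vertex.\<close>

definition bulk_config :: "(vertex \<times> vertex) set \<Rightarrow> nat \<Rightarrow> nat \<Rightarrow> vdir \<times> vdir \<times> hdir \<times> hdir" where
  "bulk_config C i j = (vert C i j, vert C (i + 1) j, horiz C i (j - 1), horiz C i j)"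

definition left_config :: "(vertex \<times> vertex) set \<Rightarrow> nat \<Rightarrow> vdir \<times> hdir" where
  "left_config C i = (vert C i i, horiz C i i)"


subsection \<open>Weights and the partition function\<close>

text \<open>The final equation is for configurations that violate the two-in two-out
  condition, which never occur.\<close>

fun bulk_weight :: "'a::field \<Rightarrow> vdir \<times> vdir \<times> hdir \<times> hdir \<Rightarrow> 'a \<Rightarrow> 'a" where
  "bulk_weight q (Upward, Downward, Rightward, Leftward) u = 1"
| "bulk_weight q (Downward, Upward, Leftward, Rightward) u = 1"
| "bulk_weight q (Upward, Upward, Rightward, Rightward) u = sigma_hat q (q\<^sup>2 * u)"
| "bulk_weight q (Downward, Downward, Leftward, Leftward) u = sigma_hat q (q\<^sup>2 * u)"
| "bulk_weight q (Upward, Upward, Leftward, Leftward) u = sigma_hat q (q\<^sup>2 * inverse u)"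
| "bulk_weight q (Downward, Downward, Rightward, Rightward) u = sigma_hat q (q\<^sup>2 * inverse u)"
| "bulk_weight q _ u = 0"

fun left_weight ::
  "'a::field \<Rightarrow> 'a \<Rightarrow> 'a \<Rightarrow> 'a \<Rightarrow> 'a \<Rightarrow> ('a \<Rightarrow> 'a) \<Rightarrow> vdir \<times> hdir \<Rightarrow> 'a \<Rightarrow> 'a" where
  "left_weight q \<alpha> \<beta> \<gamma> \<delta> \<phi> (Upward, Leftward) u =
     (\<alpha> * q * u + \<beta> * inverse q * inverse u) * \<phi> u"
| "left_weight q \<alpha> \<beta> \<gamma> \<delta> \<phi> (Downward, Rightward) u =
     (\<alpha> * inverse q * inverse u + \<beta> * q * u) * \<phi> u"
| "left_weight q \<alpha> \<beta> \<gamma> \<delta> \<phi> (Upward, Rightward) u = \<gamma> * sigma (q\<^sup>2 * u\<^sup>2) * \<phi> u"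
| "left_weight q \<alpha> \<beta> \<gamma> \<delta> \<phi> (Downward, Leftward) u = \<delta> * sigma (q\<^sup>2 * u\<^sup>2) * \<phi> u"

text \<open>The variables are \<open>u 1, \<dots>, u n\<close>; other values of \<open>u\<close> are irrelevant.\<close>

definition dsasm_Z ::
  "'a::field \<Rightarrow> 'a \<Rightarrow> 'a \<Rightarrow> 'a \<Rightarrow> 'a \<Rightarrow> ('a \<Rightarrow> 'a) \<Rightarrow> nat \<Rightarrow> (nat \<Rightarrow> 'a) \<Rightarrow> 'a" where
  "dsasm_Z q \<alpha> \<beta> \<gamma> \<delta> \<phi> n u =
     (\<Sum>C\<in>six_vertex n.
        (\<Prod>i=1..n. left_weight q \<alpha> \<beta> \<gamma> \<delta> \<phi> (left_config C i) (u i)) *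
        (\<Prod>(i, j)\<in>bulk n. bulk_weight q (bulk_config C i j) (u i * u j)))"

end

theory Submission
  imports Defs "HOL-Computational_Algebra.Polynomial" "HOL-Library.Multiset"
begin

text \<open>
  The proof is of Izergin-Korepin type. Multiplied by \<open>\<Prod> sigma_hat (u\<^sub>i / u\<^sub>j)\<close>, both sides are
  Laurent polynomials in the last variable \<open>x\<close>, of a fixed parity, and they are compared at more
  points than their degree allows.

  Read the lattice line by line: line \<open>i\<close> comes down column \<open>i\<close>, is reflected at the left boundary
  vertex \<open>(i, i)\<close> and leaves along row \<open>i\<close>. Every vertex then acts as a local operator on functions of
  the arrows on the current frontier (\<open>cross_op\<close>, \<open>reflect_op\<close>), and the partition function is a
  component of a product of such operators, built up by \<open>state_vec\<close>. That this is the given sum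
  over orientations is a bookkeeping induction over the vertices (\<open>dsasm_Z_eq\<close>).
  The operators satisfy the Yang-Baxter and reflection equations, so an exchange operator can be
  carried through the whole lattice; hence the partition function is symmetric (\<open>Zl_swap\<close>, \<open>Zl_perm\<close>).

  When \<open>u x = q\<^sup>-\<^sup>2\<close>, the vertex where the last two lines \<open>u\<close> and \<open>x\<close> cross becomes the identity
  and the two reflections collapse to a scalar. When \<open>u x = q\<^sup>2\<close>, with \<open>u\<close> the first line and \<open>x\<close> the
  last, their crossing fixes the first row and the last column. In both cases the partition
  function is \<open>Z2 u x\<close> times explicit vertex weights times the partition function without these
  two lines (\<open>Zl_freeze_minus\<close>, \<open>Zl_freeze_plus\<close>). By symmetry this holds for \<open>u\<close> any of the other
  variables.

  The Pfaffian obeys the same reduction. Expanded along its last column (\<open>pf_block_expand\<close>), with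
  the denominators cleared, all terms but one vanish when \<open>u\<^sub>k x = q\<^sup>\<plusminus>\<^sup>2\<close>, and the surviving cofactor is
  the Pfaffian of the remaining variables. At \<open>x = u\<^sub>k\<close> both sides vanish, since two rows of the
  Pfaffian coincide. For \<open>n\<close> variables this gives \<open>3 (n - 1)\<close> distinct values of \<open>x\<^sup>2\<close>, while \<open>2 n\<close>
  suffice, so an induction in steps of two proves the identity for all \<open>n\<close> (\<open>pfaffian_generic\<close>).

  The interpolation needs the other variables in general position. The general case follows along
  the curve \<open>u\<^sub>i s\<^sup>i\<close>, which is in general position for all but finitely many \<open>s\<close> and passes through
  the given point at \<open>s = 1\<close>, where both sides are regular rational functions of \<open>s\<close>
  (\<open>pfaffian_formula\<close>).
\<close>

section \<open>Vertex operators, Yang-Baxter and reflection equations\<close>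

locale dsasm_weights =
  fixes q \<alpha> \<beta> \<gamma> \<delta> :: "'a::field_char_0"
  assumes q_nz: "q \<noteq> 0" and sigma_q4_nz: "sigma (q ^ 4) \<noteq> 0"
begin

abbreviation sh :: "'a \<Rightarrow> 'a" where "sh \<equiv> sigma_hat q"
text \<open>The weights of a bulk vertex with two straight arrows: \<open>wa\<close> when the two lines carry different
states, \<open>wb\<close> when they carry the same state. The third weight is \<open>1\<close>.\<close>

definition wa :: "'a \<Rightarrow> 'a" where "wa w = sh (q\<^sup>2 * w)"
definition wb :: "'a \<Rightarrow> 'a" where "wb w = sh (q\<^sup>2 * inverse w)"

text \<open>A state \<open>s\<close> records the arrows on the frontier, numbered from the most recent line at position \<open>0\<close>;
\<open>True\<close> stands for an arrow against the direction of travel of its line (up or left), which is the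
prescribed direction at both ends of every line. A vertex at position \<open>k\<close> joins the horizontal arrow at \<open>k\<close> and the
vertical arrow at \<open>Suc k\<close> on the way in, and leaves the vertical arrow at \<open>k\<close> and the horizontal one
at \<open>Suc k\<close>. In this numbering equal arrows pass unchanged, and different arrows either stay
in place (weight \<open>1\<close>) or change places.\<close>

definition cross_op :: "nat \<Rightarrow> 'a \<Rightarrow> ((nat \<Rightarrow> bool) \<Rightarrow> 'a) \<Rightarrow> (nat \<Rightarrow> bool) \<Rightarrow> 'a" where
  "cross_op k w F s =
     (if s k = s (Suc k) then wb w * F s
      else F s + wa w * F (s(k := s (Suc k), Suc k := s k)))"

text \<open>The R-matrix of the spectral parameter \<open>x\<close>. It has the shape of a crossing operator, but with the
parameter of two lines that run in the same direction.\<close>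

definition exch_op :: "nat \<Rightarrow> 'a \<Rightarrow> ((nat \<Rightarrow> bool) \<Rightarrow> 'a) \<Rightarrow> (nat \<Rightarrow> bool) \<Rightarrow> 'a" where
  "exch_op k x F s =
     (if s k = s (Suc k) then sh (q ^ 4 * x) * F s
      else F s - sh x * F (s(k := s (Suc k), Suc k := s k)))"

fun corner :: "'a \<Rightarrow> bool \<Rightarrow> bool \<Rightarrow> 'a" where
  "corner u True True = \<alpha> * q * u + \<beta> * inverse q * inverse u"
| "corner u False False = \<alpha> * inverse q * inverse u + \<beta> * q * u"
| "corner u True False = \<gamma> * sigma (q\<^sup>2 * u\<^sup>2)"
| "corner u False True = \<delta> * sigma (q\<^sup>2 * u\<^sup>2)"

definition reflect_op :: "'a \<Rightarrow> ((nat \<Rightarrow> bool) \<Rightarrow> 'a) \<Rightarrow> (nat \<Rightarrow> bool) \<Rightarrow> 'a" where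
  "reflect_op u F s =
     corner u True (s 0) * F (s(0 := True)) + corner u False (s 0) * F (s(0 := False))"

text \<open>Evaluating operators at states written in this form turns the Yang-Baxter equation into eight
scalar identities and avoids comparing nested function updates.\<close>

definition upd3 :: "(nat \<Rightarrow> bool) \<Rightarrow> nat \<Rightarrow> bool \<Rightarrow> bool \<Rightarrow> bool \<Rightarrow> nat \<Rightarrow> bool" where
  "upd3 s k x y z = s(k := x, Suc k := y, Suc (Suc k) := z)"

lemma ops_upd3:
  "cross_op k w F (upd3 s k x y z) =
     (if x = y then wb w * F (upd3 s k x y z)
      else F (upd3 s k x y z) + wa w * F (upd3 s k y x z))"
  "cross_op (Suc k) w F (upd3 s k x y z) =
     (if y = z then wb w * F (upd3 s k x y z)
      else F (upd3 s k x y z) + wa w * F (upd3 s k x z y))"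
  "exch_op k w F (upd3 s k x y z) =
     (if x = y then sh (q^4 * w) * F (upd3 s k x y z)
      else F (upd3 s k x y z) - sh w * F (upd3 s k y x z))"
  "exch_op (Suc k) w F (upd3 s k x y z) =
     (if y = z then sh (q^4 * w) * F (upd3 s k x y z)
      else F (upd3 s k x y z) - sh w * F (upd3 s k x z y))"
  by (auto simp: cross_op_def exch_op_def upd3_def fun_upd_def intro!: arg_cong[where f=F])

lemma upd3_self: "upd3 s k (s k) (s (Suc k)) (s (Suc (Suc k))) = s"
  by (auto simp: upd3_def)

lemma ext_upd3:
  assumes "\<And>x y z. G (upd3 s k x y z) = H (upd3 s k x y z)"
  shows "G s = H s"
  using assms by (metis upd3_self)

lemma sh_identity:
  assumes "sigma (q ^ 4) * sigma a = sigma b * sigma c + sigma d * sigma e"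
  shows "sh a = sh b * sh c + sh d * sh e"
  using assms sigma_q4_nz by (simp add: sigma_hat_def field_simps)

lemma sh_one: "sh (q ^ 4) = 1" using sigma_q4_nz by (simp add: sigma_hat_def)

text \<open>The relations to which the Yang-Baxter equation reduces on three frontier arrows that are not all
equal. After clearing denominators each is a three-term relation for products of two values of \<open>sigma\<close>.\<close>

lemma exch_identities:
  assumes "u \<noteq> 0" "v \<noteq> 0" "w \<noteq> 0"
  shows "wa (u * w) = sh (u / v) * wb (v * w) + wa (v * w) * sh (q ^ 4 * u / v)"
    and "wa (u * w) * wb (v * w) = sh (u / v) + wa (v * w) * wb (u * w)"
    and "wb (v * w) = sh (u / v) * wa (u * w) + wb (u * w) * sh (q ^ 4 * u / v)"
proof -
  note nz = assms q_nz
  show "wa (u * w) = sh (u / v) * wb (v * w) + wa (v * w) * sh (q ^ 4 * u / v)"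
    unfolding wa_def wb_def
    by (rule sh_identity) (use nz in \<open>simp add: sigma_def field_simps power2_eq_square power4_eq_xxxx\<close>)
  show "wb (v * w) = sh (u / v) * wa (u * w) + wb (u * w) * sh (q ^ 4 * u / v)"
    unfolding wa_def wb_def
    by (rule sh_identity) (use nz in \<open>simp add: sigma_def field_simps power2_eq_square power4_eq_xxxx\<close>)
  have "sh (u / v) = wa (u * w) * wb (v * w) + sh (inverse (q\<^sup>2 * (v * w))) * wb (u * w)"
    unfolding wa_def wb_def
    by (rule sh_identity) (use nz in \<open>simp add: sigma_def field_simps power2_eq_square power4_eq_xxxx\<close>)
  moreover have "sh (inverse (q\<^sup>2 * (v * w))) = - wa (v * w)"
    by (simp add: wa_def sigma_hat_def sigma_def minus_divide_left)
  ultimately show "wa (u * w) * wb (v * w) = sh (u / v) + wa (v * w) * wb (u * w)" by simp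
qed

text \<open>Carries the exchange operator of the lines \<open>u\<close> and \<open>v\<close>, when they are rows, past a later line \<open>w\<close>.\<close>

lemma yang_baxter_horizontal:
  assumes "u \<noteq> 0" "v \<noteq> 0" "w \<noteq> 0"
  shows "exch_op (Suc k) (u / v) (cross_op k (v * w) (cross_op (Suc k) (u * w) F)) =
         cross_op k (u * w) (cross_op (Suc k) (v * w) (exch_op k (u / v) F))" (is "?L = ?R")
proof
  note id = exch_identities[OF assms]
  show "?L s = ?R s" for s
  proof (rule ext_upd3)
    show "?L (upd3 s k x y z) = ?R (upd3 s k x y z)" for x y z
      by (cases x; cases y; cases z; simp add: ops_upd3; use id in algebra)
  qed
qed

text \<open>Carries the exchange operator of the lines \<open>u\<close> and \<open>v\<close>, when they are columns, past an earlier row \<open>w\<close>.\<close>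

lemma yang_baxter_vertical:
  assumes "u \<noteq> 0" "v \<noteq> 0" "w \<noteq> 0"
  shows "exch_op k (u / v) (cross_op (Suc k) (w * v) (cross_op k (w * u) F)) =
         cross_op (Suc k) (w * u) (cross_op k (w * v) (exch_op (Suc k) (u / v) F))" (is "?L = ?R")
proof
  note id = exch_identities[OF assms, unfolded mult.commute[of _ w]]
  show "?L s = ?R s" for s
  proof (rule ext_upd3)
    show "?L (upd3 s k x y z) = ?R (upd3 s k x y z)" for x y z
      by (cases x; cases y; cases z; simp add: ops_upd3; use id in algebra)
  qed
qed

definition upd2 :: "(nat \<Rightarrow> bool) \<Rightarrow> bool \<Rightarrow> bool \<Rightarrow> nat \<Rightarrow> bool" where
  "upd2 s x y = s(0 := x, Suc 0 := y)"

lemma ops_upd2: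
  "cross_op 0 w F (upd2 s x y) =
     (if x = y then wb w * F (upd2 s x y) else F (upd2 s x y) + wa w * F (upd2 s y x))"
  "exch_op 0 w F (upd2 s x y) =
     (if x = y then sh (q^4 * w) * F (upd2 s x y) else F (upd2 s x y) - sh w * F (upd2 s y x))"
  "reflect_op u F (upd2 s x y) =
     corner u True x * F (upd2 s True y) + corner u False x * F (upd2 s False y)"
proof -
  have [simp]: "s(0 := z, Suc 0 := y, 0 := x) = s(0 := x, Suc 0 := y)" for x y z
    by (simp add: fun_eq_iff)
  have [simp]: "s(0 := z, Suc 0 := z', 0 := x, Suc 0 := y) = s(0 := x, Suc 0 := y)" for x y z z'
    by (simp add: fun_eq_iff)
  show "cross_op 0 w F (upd2 s x y) =
     (if x = y then wb w * F (upd2 s x y) else F (upd2 s x y) + wa w * F (upd2 s y x))"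
    by (simp add: cross_op_def upd2_def)
  show "exch_op 0 w F (upd2 s x y) =
     (if x = y then sh (q^4 * w) * F (upd2 s x y) else F (upd2 s x y) - sh w * F (upd2 s y x))"
    by (simp add: exch_op_def upd2_def)
  show "reflect_op u F (upd2 s x y) =
     corner u True x * F (upd2 s True y) + corner u False x * F (upd2 s False y)"
    by (simp add: reflect_op_def upd2_def)
qed

lemma ext_upd2:
  assumes "\<And>x y. G (upd2 s x y) = H (upd2 s x y)"
  shows "G s = H s"
proof -
  have "upd2 s (s 0) (s (Suc 0)) = s" by (auto simp: upd2_def)
  then show ?thesis using assms by metis
qed

text \<open>This and the next three lemmas are the scalar identities behind the matrix elements of the reflection
equation. The boundary coefficients in them are free, because interchanging \<open>\<alpha>\<close> and \<open>\<beta>\<close>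
interchanges the two diagonal corner weights; so each identity serves for two matrix elements.\<close>

lemma corner_identity1:
  assumes "u \<noteq> 0" "v \<noteq> 0"
  shows "sh (q ^ 4 * u / v) * wa (u * v) + sh (u / v) * wb (u * v) = sh (q\<^sup>2 * u\<^sup>2)"
  unfolding wa_def wb_def
  by (rule sh_identity[where b = "q^4*u/v" and c = "q\<^sup>2*(u*v)" and d="u/v" and a = "q\<^sup>2*u\<^sup>2", symmetric])
     (use assms q_nz in \<open>simp add: sigma_def field_simps power2_eq_square power4_eq_xxxx\<close>)

lemma corner_identity2:
  fixes a b :: 'a
  assumes "u \<noteq> 0" "v \<noteq> 0"
  shows "(a * q * v + b * inverse q * inverse v) * wa (u * v)
       - (a * inverse q * inverse v + b * q * v) * sh (u / v)
       = sh (q\<^sup>2 * v\<^sup>2) * (a * q * u + b * inverse q * inverse u)"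
proof -
  have "(a * q * v + b * inverse q * inverse v) * sigma (q\<^sup>2 * (u * v))
       - (a * inverse q * inverse v + b * q * v) * sigma (u / v)
       = sigma (q\<^sup>2 * v\<^sup>2) * (a * q * u + b * inverse q * inverse u)"
    using assms q_nz by (simp add: sigma_def field_simps power2_eq_square)
  then show ?thesis using sigma_q4_nz by (simp add: sigma_hat_def wa_def field_simps)
qed

lemma corner_identity3:
  fixes a b :: 'a
  assumes nz: "u \<noteq> 0" "v \<noteq> 0"
  shows "(a * inverse q * inverse u + b * q * u) * (wa (u * v)) * (a * q * v + b * inverse q * inverse v)
       - (a * inverse q * inverse v + b * q * v) * (wa (u * v)) * (a * q * u + b * inverse q * inverse u)
       = sh (u / v) * ((a * inverse q * inverse v + b * q * v) * (a * inverse q * inverse u + b * q * u)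
          - (a * q * v + b * inverse q * inverse v) * (a * q * u + b * inverse q * inverse u))"
proof -
  have "(a * inverse q * inverse u + b * q * u) * (sigma (q\<^sup>2 * (u * v))) * (a * q * v + b * inverse q * inverse v)
       - (a * inverse q * inverse v + b * q * v) * (sigma (q\<^sup>2 * (u * v))) * (a * q * u + b * inverse q * inverse u)
       = sigma (u / v) * ((a * inverse q * inverse v + b * q * v) * (a * inverse q * inverse u + b * q * u)
          - (a * q * v + b * inverse q * inverse v) * (a * q * u + b * inverse q * inverse u))"
    using nz q_nz by (simp add: sigma_def field_simps power2_eq_square)
  then show ?thesis using sigma_q4_nz by (simp add: wa_def sigma_hat_def diff_divide_distrib[symmetric])
qed

lemma corner_identity4:
  fixes a b :: 'a
  assumes nz: "u \<noteq> 0" "v \<noteq> 0"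
  defines "c \<equiv> \<lambda>x. a * q * x + b * inverse q * inverse x"
    and "c' \<equiv> \<lambda>x. a * inverse q * inverse x + b * q * x"
  shows "sh (q ^ 4 * u / v) * (c v * wb (u * v) * sigma (q\<^sup>2 * u\<^sup>2) + sigma (q\<^sup>2 * v\<^sup>2) * c' u)
         + c v * sh (u / v) * wa (u * v) * sigma (q\<^sup>2 * u\<^sup>2)
       = sigma (q\<^sup>2 * v\<^sup>2) * wb (u * v) * c u + c' v * sigma (q\<^sup>2 * u\<^sup>2)"
proof -
  have "sigma (q ^ 4 * u / v) * (c v * sigma (q\<^sup>2 * inverse (u * v)) * sigma (q\<^sup>2 * u\<^sup>2)
           + sigma (q ^ 4) * (sigma (q\<^sup>2 * v\<^sup>2) * c' u))
         + c v * sigma (u / v) * sigma (q\<^sup>2 * (u * v)) * sigma (q\<^sup>2 * u\<^sup>2)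
       = sigma (q ^ 4) * (sigma (q\<^sup>2 * v\<^sup>2) * sigma (q\<^sup>2 * inverse (u * v)) * c u) + sigma (q ^ 4) * (sigma (q ^ 4) * (c' v * sigma (q\<^sup>2 * u\<^sup>2)))"
    using nz q_nz unfolding c_def c'_def
    by (simp add: sigma_def field_simps power2_eq_square power4_eq_xxxx)
  then show ?thesis using sigma_q4_nz 
    by (simp add: wa_def wb_def sigma_hat_def field_simps)
qed

text \<open>Exchanges two adjacent lines at the left boundary. The off-diagonal corner weights are
\<open>\<gamma>\<close> and \<open>\<delta>\<close> times the same function of the variable; so where both sides of a matrix element contain
them, they can be cancelled, and the corner identities apply.\<close>

lemma reflection:
  assumes "u \<noteq> 0" "v \<noteq> 0"
  shows "exch_op 0 (u / v) (reflect_op v (cross_op 0 (u * v) (reflect_op u F))) =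
         reflect_op u (cross_op 0 (u * v) (reflect_op v (exch_op 0 (u / v) F)))" (is "?L = ?R")
proof
  define S E s1 s2 where "S = sh (u / v)" "E = sh (q ^ 4 * u / v)" 
    "s1 = sigma (q\<^sup>2 * u\<^sup>2)" "s2 = sigma (q\<^sup>2 * v\<^sup>2)"
  define p r P R where "p = corner u True True" "r = corner u False False"
    "P = corner v True True" "R = corner v False False"
  note defs = S_E_s1_s2_def p_r_P_R_def
  have off: "corner u True False = \<gamma> * s1" "corner u False True = \<delta> * s1"
     "corner v True False = \<gamma> * s2" "corner v False True = \<delta> * s2"
    by (auto simp: defs)
  have D: "sh (q\<^sup>2 * u\<^sup>2) = s1 / sigma (q ^ 4)" "sh (q\<^sup>2 * v\<^sup>2) = s2 / sigma (q ^ 4)"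
    by (auto simp: defs sigma_hat_def)
  define a b where "a = wa (u * v)" and "b = wb (u * v)"
  have e1: "E * a + S * b = s1 / sigma (q ^ 4)"
    using corner_identity1[OF assms] by (simp add: defs a_def b_def D)
  have e2: "P * a - R * S = s2 / sigma (q ^ 4) * p"
    using corner_identity2[OF assms, of \<alpha> \<beta>] by (simp add: defs a_def b_def D)
  have e3: "R * a - P * S = s2 / sigma (q ^ 4) * r"
    using corner_identity2[OF assms, of \<beta> \<alpha>] by (simp add: defs a_def b_def D add.commute)
  have r1: "s2 * (E * a * p + S * b * p) = s1 * (P * a - R * S)"
  proof -
    have "s2 * (E * a * p + S * b * p) = s2 * p * (E * a + S * b)" by (simp add: algebra_simps)
    then show ?thesis unfolding e1 e2 by simp
  qed
  have r6: "s2 * (E * a * r + S * b * r) = s1 * (R * a - P * S)"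
  proof -
    have "s2 * (E * a * r + S * b * r) = s2 * r * (E * a + S * b)" by (simp add: algebra_simps)
    then show ?thesis unfolding e1 e3 by simp
  qed
  have r4: "r * a * P - R * a * p = S * (R * r - P * p)"
    using corner_identity3[OF assms, of \<alpha> \<beta>] by (simp add: defs a_def)
  have r2: "E * (P * b * s1 + s2 * r) + P * S * a * s1 = s2 * b * p + R * s1"
    using corner_identity4[OF assms, of \<alpha> \<beta>] by (simp add: defs a_def b_def)
  have r5: "E * (R * b * s1 + s2 * p) + R * S * a * s1 = s2 * b * r + P * s1"
    using corner_identity4[OF assms, of \<beta> \<alpha>] by (simp add: defs a_def b_def add.commute)
  show "?L s = ?R s" for s
  proof (rule ext_upd2)
    have ab: "sh (q ^ 4 * (u / v)) = E" "sh (u / v) = S" "wa (u * v) = a" "wb (u * v) = b"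
      "corner u True True = p" "corner u False False = r"
      "corner v True True = P" "corner v False False = R"
      by (auto simp: defs a_def b_def)
    show "?L (upd2 s x y) = ?R (upd2 s x y)" for x y
      by (cases x; cases y; simp add: ops_upd2 ab off del: corner.simps times_divide_eq_right; use r1 r2 r4 r5 r6 in algebra)
  qed
qed
end

context dsasm_weights begin

section \<open>The partition function and its symmetry\<close>

text \<open>The line \<open>x\<close> crosses the older rows; \<open>ws\<close> lists them with the most recent first, so the crossing
with the oldest row, at the highest position, acts first.\<close>

fun line_op :: "nat \<Rightarrow> 'a list \<Rightarrow> 'a \<Rightarrow> ((nat \<Rightarrow> bool) \<Rightarrow> 'a) \<Rightarrow> (nat \<Rightarrow> bool) \<Rightarrow> 'a" where
  "line_op k [] x F = F"
| "line_op k (w # ws) x F = cross_op k (w * x) (line_op (Suc k) ws x F)"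

text \<open>The components of the vector produced by the lines \<open>x # ws\<close>, the most recent line first. Positions
beyond the existing lines stand for columns that are still to come; their top arrows point up, whence
the initial vector.\<close>

fun state_vec :: "'a list \<Rightarrow> (nat \<Rightarrow> bool) \<Rightarrow> 'a" where
  "state_vec [] = (\<lambda>s. if \<forall>k. s k then 1 else 0)"
| "state_vec (x # ws) = reflect_op x (line_op 0 ws x (state_vec ws))"

definition Zl :: "'a list \<Rightarrow> 'a" where "Zl ws = state_vec ws (\<lambda>_. True)"

lemma upd_commute:
  fixes s :: "nat \<Rightarrow> bool"
  assumes "i \<noteq> k" "i \<noteq> l" "j \<noteq> k" "j \<noteq> l"
  shows "s(i := a, j := b, k := c, l := d) = s(k := c, l := d, i := a, j := b)"
  using assms by (auto simp: fun_eq_iff)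

lemma exch_cross_commute:
  assumes "Suc k < j \<or> Suc j < k"
  shows "exch_op j x (cross_op k w F) = cross_op k w (exch_op j x F)"
proof
  fix s :: "nat \<Rightarrow> bool"
  have c: "s(j := s (Suc j), Suc j := s j, k := s (Suc k), Suc k := s k)
      = s(k := s (Suc k), Suc k := s k, j := s (Suc j), Suc j := s j)"
    by (rule upd_commute) (use assms in auto)
  have d: "j \<noteq> k" "j \<noteq> Suc k" "Suc j \<noteq> k" "k \<noteq> j" "k \<noteq> Suc j" "Suc k \<noteq> j" using assms by auto
  show "exch_op j x (cross_op k w F) s = cross_op k w (exch_op j x F) s"
    using d c
    by (cases "s j"; cases "s (Suc j)"; cases "s k"; cases "s (Suc k)")
       (simp_all add: exch_op_def cross_op_def algebra_simps)
qed

lemma cross_cross_commute: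
  assumes "Suc k < j"
  shows "cross_op j x (cross_op k w F) = cross_op k w (cross_op j x F)"
proof
  fix s :: "nat \<Rightarrow> bool"
  have c: "s(j := s (Suc j), Suc j := s j, k := s (Suc k), Suc k := s k)
      = s(k := s (Suc k), Suc k := s k, j := s (Suc j), Suc j := s j)"
    by (rule upd_commute) (use assms in auto)
  have d: "j \<noteq> k" "j \<noteq> Suc k" "Suc j \<noteq> k" "k \<noteq> j" "k \<noteq> Suc j" "Suc k \<noteq> j" using assms by auto
  show "cross_op j x (cross_op k w F) s = cross_op k w (cross_op j x F) s"
    using d c
    by (cases "s j"; cases "s (Suc j)"; cases "s k"; cases "s (Suc k)")
       (simp_all add: cross_op_def algebra_simps)
qed

lemma reflect_cross_commute:
  "reflect_op u (cross_op (Suc k) w F) = cross_op (Suc k) w (reflect_op u F)"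
proof
  fix s :: "nat \<Rightarrow> bool"
  have c: "s(0 := z, Suc k := a, Suc (Suc k) := b) = s(Suc k := a, Suc (Suc k) := b, 0 := z)" for z a b
    by (auto simp: fun_eq_iff)
  show "reflect_op u (cross_op (Suc k) w F) s = cross_op (Suc k) w (reflect_op u F) s"
    by (simp add: cross_op_def reflect_op_def c algebra_simps)
qed

lemma reflect_exch_commute:
  "reflect_op u (exch_op (Suc k) w F) = exch_op (Suc k) w (reflect_op u F)"
proof
  fix s :: "nat \<Rightarrow> bool"
  have c: "s(0 := z, Suc k := a, Suc (Suc k) := b) = s(Suc k := a, Suc (Suc k) := b, 0 := z)" for z a b
    by (auto simp: fun_eq_iff)
  show "reflect_op u (exch_op (Suc k) w F) s = exch_op (Suc k) w (reflect_op u F) s"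
    by (simp add: exch_op_def reflect_op_def c algebra_simps)
qed

lemma exch_line_commute:
  "j < k \<Longrightarrow> exch_op j x (line_op (Suc k) ws y F) = line_op (Suc k) ws y (exch_op j x F)"
  by (induction ws arbitrary: k) (simp_all add: exch_cross_commute)

lemma cross_line_commute:
  "j < k \<Longrightarrow> cross_op j x (line_op (Suc k) ws y F) = line_op (Suc k) ws y (cross_op j x F)"
proof (induction ws arbitrary: k)
  case (Cons w ws)
  have "cross_op j x (cross_op (Suc k) (w * y) G) = cross_op (Suc k) (w * y) (cross_op j x G)" for G
    by (rule cross_cross_commute[symmetric]) (use Cons.prems in simp)
  then show ?case using Cons by simp
qed simp

lemma reflect_line_commute:
  "reflect_op x (line_op (Suc k) ws y F) = line_op (Suc k) ws y (reflect_op x F)"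
  by (induction ws arbitrary: k) (simp_all add: reflect_cross_commute)

lemma line_op_append:
  "line_op k (ws @ ws') x F = line_op k ws x (line_op (k + length ws) ws' x F)"
  by (induction ws arbitrary: k) simp_all

text \<open>Two lines that come down in adjacent columns are exchanged row by row.\<close>

lemma exch_lines:
  assumes "u \<noteq> 0" "v \<noteq> 0" "0 \<notin> set ws"
  shows "exch_op k (u / v) (line_op (Suc k) ws v (line_op k ws u F)) =
    line_op (Suc k) ws u (line_op k ws v (exch_op (k + length ws) (u / v) F))"
  using assms(3)
proof (induction ws arbitrary: k F)
  case (Cons w ws)
  have nz: "w \<noteq> 0" "0 \<notin> set ws" using Cons.prems by auto
  have "exch_op k (u / v) (line_op (Suc k) (w # ws) v (line_op k (w # ws) u F)) =
      exch_op k (u / v) (cross_op (Suc k) (w * v) (cross_op k (w * u)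
        (line_op (Suc (Suc k)) ws v (line_op (Suc k) ws u F))))"
    by (simp add: cross_line_commute)
  also have "\<dots> = cross_op (Suc k) (w * u) (cross_op k (w * v)
       (exch_op (Suc k) (u / v) (line_op (Suc (Suc k)) ws v (line_op (Suc k) ws u F))))"
    by (rule yang_baxter_vertical[OF assms(1,2) nz(1)])
  also have "\<dots> = cross_op (Suc k) (w * u) (cross_op k (w * v)
       (line_op (Suc (Suc k)) ws u (line_op (Suc k) ws v (exch_op (Suc k + length ws) (u / v) F))))"
    by (simp add: Cons.IH[OF nz(2)])
  also have "\<dots> = line_op (Suc k) (w # ws) u (line_op k (w # ws) v (exch_op (k + length (w # ws)) (u / v) F))"
    by (simp add: cross_line_commute)
  finally show ?case .
qed simp

lemma cross_op_support:
  assumes "\<And>s. \<not> s j \<Longrightarrow> F s = 0" "Suc k < j" "\<not> s j"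
  shows "cross_op k w F s = 0"
  using assms by (simp add: cross_op_def)

lemma line_op_support:
  assumes "\<And>s. \<not> s j \<Longrightarrow> F s = 0" "k + length ws < j" "\<not> s j"
  shows "line_op k ws x F s = 0"
  using assms
proof (induction ws arbitrary: k s)
  case (Cons w ws)
  show ?case unfolding line_op.simps
    by (rule cross_op_support[where j = j]) (use Cons in auto)
qed simp

text \<open>Lines \<open>length ws\<close> and beyond have not interacted yet, so their arrows still have the initial
direction.\<close>

lemma state_vec_support:
  assumes "length ws \<le> j" "\<not> s j"
  shows "state_vec ws s = 0"
  using assms
proof (induction ws arbitrary: s)
  case (Cons x ws)
  have "line_op 0 ws x (state_vec ws) t = 0" if "\<not> t j" for t
    by (rule line_op_support[where j = j]) (use Cons that in auto)
  then show ?case using Cons.prems by (auto simp: reflect_op_def)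
qed auto

lemma exch_state_vec:
  "exch_op (length ws) x (state_vec ws) s = sh (q ^ 4 * x) * state_vec ws s"
proof -
  let ?m = "length ws"
  have z: "state_vec ws t = 0" if "\<not> t ?m \<or> \<not> t (Suc ?m)" for t
    using that state_vec_support[of ws ?m t] state_vec_support[of ws "Suc ?m" t] by auto
  show ?thesis
    by (cases "s ?m"; cases "s (Suc ?m)") (simp_all add: exch_op_def z)
qed

lemma linear_ops:
  "cross_op k w (\<lambda>s. c * F s) = (\<lambda>s. c * cross_op k w F s)"
  "reflect_op x (\<lambda>s. c * F s) = (\<lambda>s. c * reflect_op x F s)"
  by (auto simp: fun_eq_iff cross_op_def reflect_op_def algebra_simps)

lemma linear_line_op: "line_op k ws x (\<lambda>s. c * F s) = (\<lambda>s. c * line_op k ws x F s)"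
  by (induction ws arbitrary: k) (simp_all add: linear_ops)

text \<open>The exchange operator of two successive lines travels backwards through the later lines by the
Yang-Baxter equation, through the boundary by the reflection equation, and up their two columns by
Yang-Baxter again. It then meets the two top arrows, which both point up, and becomes a scalar.\<close>

lemma exchange:
  assumes "u \<noteq> 0" "v \<noteq> 0" "0 \<notin> set zs" "0 \<notin> set ws"
  shows "exch_op (length zs) (u / v) (state_vec (zs @ v # u # ws)) =
    (\<lambda>s. sh (q ^ 4 * (u / v)) * state_vec (zs @ u # v # ws) s)"
  using assms(3)
proof (induction zs)
  case Nil
  let ?F = "state_vec ws" and ?x = "u / v" and ?m = "length ws"
  have "exch_op 0 ?x (state_vec (v # u # ws)) =
      exch_op 0 ?x (reflect_op v (cross_op 0 (u * v) (reflect_op u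
        (line_op (Suc 0) ws v (line_op 0 ws u ?F)))))"
    by (simp add: reflect_line_commute)
  also have "\<dots> = reflect_op u (cross_op 0 (u * v) (reflect_op v
        (exch_op 0 ?x (line_op (Suc 0) ws v (line_op 0 ws u ?F)))))"
    by (rule reflection[OF assms(1,2)])
  also have "\<dots> = reflect_op u (cross_op 0 (u * v) (reflect_op v
        (line_op (Suc 0) ws u (line_op 0 ws v (exch_op ?m ?x ?F)))))"
    by (simp add: exch_lines[OF assms(1,2,4)])
  also have "exch_op ?m ?x ?F = (\<lambda>s. sh (q ^ 4 * ?x) * ?F s)"
    using exch_state_vec by blast
  also have "reflect_op u (cross_op 0 (u * v) (reflect_op v
        (line_op (Suc 0) ws u (line_op 0 ws v (\<lambda>s. sh (q ^ 4 * ?x) * ?F s))))) =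
      (\<lambda>s. sh (q ^ 4 * ?x) * state_vec (u # v # ws) s)"
    by (simp only: linear_line_op linear_ops) (simp add: reflect_line_commute mult.commute[of u v])
  finally show ?case by simp
next
  case (Cons z zs)
  let ?x = "u / v" and ?k = "length zs"
  have nz: "z \<noteq> 0" "0 \<notin> set zs" using Cons.prems by auto
  let ?G = "state_vec (zs @ v # u # ws)"
  have pass: "exch_op (Suc (j + length ys)) ?x (line_op j ys z H) = line_op j ys z (exch_op (Suc (j + length ys)) ?x H)"
    for j ys H
    by (induction ys arbitrary: j) (simp_all add: exch_cross_commute, metis add_Suc add_Suc_right)
  have "exch_op (Suc ?k) ?x (state_vec (z # zs @ v # u # ws)) =
     reflect_op z (line_op 0 zs z (exch_op (Suc ?k) ?x
       (cross_op ?k (v * z) (cross_op (Suc ?k) (u * z) (line_op (Suc (Suc ?k)) ws z ?G)))))"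
    using pass[of 0 zs] by (simp add: reflect_exch_commute[symmetric] line_op_append)
  also have "\<dots> = reflect_op z (line_op 0 zs z (cross_op ?k (u * z) (cross_op (Suc ?k) (v * z)
       (line_op (Suc (Suc ?k)) ws z (exch_op ?k ?x ?G)))))"
    by (simp add: yang_baxter_horizontal[OF assms(1,2) nz(1)] exch_line_commute)
  also have "exch_op ?k ?x ?G = (\<lambda>s. sh (q ^ 4 * ?x) * state_vec (zs @ u # v # ws) s)"
    by (rule Cons.IH[OF nz(2)])
  also have "reflect_op z (line_op 0 zs z (cross_op ?k (u * z) (cross_op (Suc ?k) (v * z)
       (line_op (Suc (Suc ?k)) ws z (\<lambda>s. sh (q ^ 4 * ?x) * state_vec (zs @ u # v # ws) s))))) =
     (\<lambda>s. sh (q ^ 4 * ?x) * state_vec (z # zs @ u # v # ws) s)"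
    by (simp only: linear_line_op linear_ops) (simp add: line_op_append)
  finally show ?case by simp
qed

text \<open>At the right boundary both rows leave with the same arrow, so there too the exchange operator is a
scalar, equal to the one at the top; it cancels when it is nonzero.\<close>

lemma Zl_swap:
  assumes "u \<noteq> 0" "v \<noteq> 0" "0 \<notin> set zs" "0 \<notin> set ws" "sh (q ^ 4 * (u / v)) \<noteq> 0"
  shows "Zl (zs @ v # u # ws) = Zl (zs @ u # v # ws)"
proof -
  have "exch_op (length zs) (u / v) (state_vec (zs @ v # u # ws)) (\<lambda>_. True) =
     sh (q ^ 4 * (u / v)) * Zl (zs @ v # u # ws)"
    by (simp add: exch_op_def Zl_def)
  then show ?thesis using exchange[OF assms(1-4)] assms(5) by (simp add: Zl_def)
qed

definition exchangeable :: "'a set \<Rightarrow> bool" where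
  "exchangeable U \<longleftrightarrow> 0 \<notin> U \<and> (\<forall>u\<in>U. \<forall>v\<in>U. sh (q ^ 4 * (u / v)) \<noteq> 0)"

lemma Zl_to_front:
  assumes "exchangeable (set (ps @ u # qs))" "0 \<notin> set zs"
  shows "Zl (zs @ ps @ u # qs) = Zl (zs @ u # ps @ qs)"
  using assms
proof (induction ps arbitrary: qs rule: rev_induct)
  case (snoc p ps)
  have "Zl (zs @ (ps @ [p]) @ u # qs) = Zl ((zs @ ps) @ p # u # qs)" by simp
  also have "\<dots> = Zl ((zs @ ps) @ u # p # qs)"
    by (rule Zl_swap) (use snoc.prems in \<open>auto simp: exchangeable_def\<close>)
  also have "\<dots> = Zl (zs @ u # ps @ p # qs)"
    using snoc.IH[of "p # qs"] snoc.prems by (auto simp: exchangeable_def)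
  finally show ?case by simp
qed simp

lemma Zl_perm:
  assumes "exchangeable (set ws)" "0 \<notin> set zs" "mset ws = mset ws'"
  shows "Zl (zs @ ws) = Zl (zs @ ws')"
  using assms
proof (induction ws arbitrary: zs ws')
  case (Cons u ws)
  have "u \<in> set ws'" using Cons.prems(3) by (metis list.set_intros(1) set_mset_mset)
  then obtain ps qs where ws': "ws' = ps @ u # qs" by (meson split_list)
  have st: "set ws' = set (u # ws)" using Cons.prems(3) by (metis set_mset_mset)
  have "Zl (zs @ ws') = Zl ((zs @ [u]) @ ps @ qs)"
    using Zl_to_front[of ps u qs zs] Cons.prems(1,2) st by (simp add: ws')
  also have "\<dots> = Zl ((zs @ [u]) @ ws)"
    by (rule Cons.IH[symmetric]) (use Cons.prems ws' in \<open>auto simp: exchangeable_def\<close>)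
  finally show ?case by simp
qed auto

section \<open>Reduction at the frozen points\<close>

definition amp :: "'a \<Rightarrow> 'a" where "amp u = \<alpha> * q * u + \<beta> * inverse q * inverse u"

text \<open>The partition function of two lines, see \<open>Zl_two\<close>.\<close>

definition Z2 :: "'a \<Rightarrow> 'a \<Rightarrow> 'a" where
  "Z2 u v = amp u * amp v * wb (u * v) + \<gamma> * \<delta> * sigma (q\<^sup>2 * u\<^sup>2) * sigma (q\<^sup>2 * v\<^sup>2)"

lemma cross_op_true: "s k \<Longrightarrow> s (Suc k) \<Longrightarrow> cross_op k w F s = wb w * F s"
  by (simp add: cross_op_def)

lemma line_op_true:
  assumes "\<And>j. k \<le> j \<Longrightarrow> j \<le> k + length ws \<Longrightarrow> s j"
  shows "line_op k ws x F s = (\<Prod>w\<leftarrow>ws. wb (w * x)) * F s"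
  using assms by (induction ws arbitrary: k) (auto simp: cross_op_true)

text \<open>Unitarity of the boundary weights: at \<open>x = q\<^sup>-\<^sup>2 / u\<close> the corner matrix of \<open>x\<close> is the adjugate of that of
\<open>u\<close>, so the product is the determinant, which is \<open>Z2 u x\<close>.\<close>

lemma reflect_reflect:
  assumes "u * x = inverse (q\<^sup>2)"
  shows "reflect_op x (reflect_op u F) = (\<lambda>s. Z2 u x * F s)"
proof
  fix s :: "nat \<Rightarrow> bool"
  have nz: "u \<noteq> 0" using assms q_nz by auto
  have x: "x = inverse (q\<^sup>2) * inverse u"
    using assms[symmetric] nz by simp
  have sx: "sigma (q\<^sup>2 * x\<^sup>2) = - sigma (q\<^sup>2 * u\<^sup>2)"
    using nz q_nz by (simp add: x sigma_def field_simps power2_eq_square)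
  have cx: "corner x True True = corner u False False" "corner x False False = corner u True True"
    using nz q_nz by (simp_all add: x field_simps power2_eq_square)
  have "wb (u * x) = 1"
    using q_nz by (simp add: wb_def assms sh_one flip: power_add)
  define g d p r where "g = corner u True False" "d = corner u False True"
    "p = corner u True True" "r = corner u False False"
  note defs = g_d_p_r_def
  have Zeq: "Z2 u x = p * r - g * d"
    using \<open>wb (u * x) = 1\<close> cx sx by (simp add: Z2_def amp_def defs algebra_simps)
  have cx': "corner x True False = - g" "corner x False True = - d"
    "corner x True True = r" "corner x False False = p"
    using cx sx by (simp_all add: defs)
  show "reflect_op x (reflect_op u F) s = Z2 u x * F s"
    by (cases "s 0") (simp_all add: reflect_op_def fun_upd_idem Zeq cx' defs[symmetric] algebra_simps del: corner.simps)
qed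

text \<open>At this parameter \<open>wa\<close> vanishes and \<open>wb\<close> is \<open>1\<close>.\<close>

lemma cross_op_id:
  assumes "w = inverse (q\<^sup>2)"
  shows "cross_op k w F = F"
proof -
  have "wa w = 0" "wb w = 1"
    using q_nz by (simp_all add: wa_def wb_def assms sigma_hat_def[of _ 1] sigma_def[of 1] sh_one flip: power_add)
  then show ?thesis by (auto simp: cross_op_def fun_eq_iff)
qed

lemma prod_list_times: "(\<Prod>w\<leftarrow>ws. f w * g w) = (\<Prod>w\<leftarrow>ws. f w) * (\<Prod>w\<leftarrow>ws. g w :: 'a)"
  by (induction ws) (simp_all add: mult_ac)

text \<open>The crossing of the last two lines is the identity, so their reflections become adjacent and give a
scalar. What remains of the two columns acts on the state in which all arrows agree, where each
vertex contributes \<open>wb\<close>.\<close>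

lemma Zl_freeze_minus:
  assumes "u * x = inverse (q\<^sup>2)"
  shows "Zl (x # u # ws) = Z2 u x * (\<Prod>w\<leftarrow>ws. wb (w * u) * wb (w * x)) * Zl ws"
proof -
  have "state_vec (x # u # ws) = (\<lambda>s. Z2 u x * line_op (Suc 0) ws x (line_op 0 ws u (state_vec ws)) s)"
    by (simp add: assms cross_op_id reflect_line_commute reflect_reflect linear_line_op)
  then show ?thesis
    by (simp add: Zl_def line_op_true prod_list_times)
qed

text \<open>In the last column the arrow turns at most once, so these states are the only ones, besides the
constant one, that the last line leads to.\<close>

definition single :: "nat \<Rightarrow> nat \<Rightarrow> bool" where "single k j \<longleftrightarrow> j \<noteq> k"

text \<open>A single opposite arrow can only be moved upwards, one position per vertex. If the states on the way
are excluded, it is moved at every vertex.\<close>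

lemma line_op_single_last:
  assumes "\<And>j. k \<le> j \<Longrightarrow> j < k + length ws \<Longrightarrow> G (single j) = 0"
  shows "line_op k ws x G (single k) = (\<Prod>w\<leftarrow>ws. wa (w * x)) * G (single (k + length ws))"
  using assms
proof (induction ws arbitrary: k)
  case (Cons w ws)
  have sw: "(single k)(k := True, Suc k := False) = single (Suc k)"
    by (auto simp: single_def fun_eq_iff)
  have "line_op (Suc k) ws x G (single k) = (\<Prod>w\<leftarrow>ws. wb (w * x)) * G (single k)"
    by (rule line_op_true) (auto simp: single_def)
  then show ?case using Cons.IH[of "Suc k"] Cons.prems
    by (auto simp: cross_op_def sw) (auto simp: single_def)
qed simp

text \<open>If the first row leaves with an arrow to the right, the ice rule fixes all of its vertices, because
the arrows above it point up: the corner has weight \<open>\<gamma> \<sigma>(q\<^sup>2 u\<^sup>2)\<close>, every other vertex has weight \<open>wa\<close>,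
and the arrows below the row again point up. Hence the rest is the lattice without this line.\<close>

lemma state_vec_first_row:
  assumes "\<not> s (length ws)"
  shows "state_vec (ws @ [u]) s =
    \<gamma> * sigma (q\<^sup>2 * u\<^sup>2) * (\<Prod>w\<leftarrow>ws. wa (w * u)) * state_vec ws (s(length ws := True))"
  using assms
proof (induction ws arbitrary: s)
  case Nil
  have "state_vec [] (s(0 := False)) = 0" by (auto intro: exI[of _ 0])
  moreover have "state_vec ([] @ [u]) s = corner u True (s 0) * state_vec [] (s(0 := True))
      + corner u False (s 0) * state_vec [] (s(0 := False))"
    by (simp only: append_Nil state_vec.simps(2) line_op.simps reflect_op_def)
  ultimately show ?case using Nil
    by (simp only: list.size list.map prod_list.Nil mult_1_right mult_zero_right add_0_right corner.simps)
next
  case (Cons x ws)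
  let ?m = "length ws" and ?F = "state_vec (ws @ [u])"
  let ?c = "\<gamma> * sigma (q\<^sup>2 * u\<^sup>2) * (\<Prod>w\<leftarrow>ws. wa (w * u))"
  have base: "cross_op ?m (u * x) ?F s = wa (x * u) * ?c * state_vec ws (s(Suc ?m := True))"
    if "\<not> s (Suc ?m)" for s
  proof (cases "s ?m")
    case True
    have eq: "s(?m := False, Suc ?m := True, ?m := True) = s(Suc ?m := True)"
      using True by (auto simp: fun_eq_iff)
    have "?F s = 0" by (rule state_vec_support[where j = "Suc ?m"]) (use that in auto)
    moreover have "?F (s(?m := False, Suc ?m := True)) = ?c * state_vec ws (s(Suc ?m := True))"
      by (subst Cons.IH) (simp, simp only: eq)
    moreover have "s(?m := s (Suc ?m), Suc ?m := s ?m) = s(?m := False, Suc ?m := True)"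
      using True that by simp
    ultimately show ?thesis using that True
      by (simp only: cross_op_def) (simp add: mult.commute[of x u] mult.assoc)
  next
    case False
    have "?F s = 0" by (rule state_vec_support[where j = "Suc ?m"]) (use that in auto)
    moreover have "state_vec ws (s(Suc ?m := True)) = 0"
      by (rule state_vec_support[where j = "?m"]) (use False in auto)
    ultimately show ?thesis using that False by (simp add: cross_op_def)
  qed
  have pass: "line_op k ys x G s = c * line_op k ys x H (s(J := True))"
    if "\<And>s. \<not> s J \<Longrightarrow> G s = c * H (s(J := True))" "k + length ys < J" "\<not> s J" for k ys G c H s J
    using that(2,3)
  proof (induction ys arbitrary: k s)
    case (Cons y ys)
    define t s' where "t = s(k := s (Suc k), Suc k := s k)" and "s' = s(J := True)"
    have t': "t(J := True) = s'(k := s' (Suc k), Suc k := s' k)" and "\<not> t J"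
      and s': "s' k = s k" "s' (Suc k) = s (Suc k)"
      using Cons.prems by (auto simp: t_def s'_def fun_eq_iff)
    have "line_op (Suc k) ys x G t = c * line_op (Suc k) ys x H (t(J := True))"
      by (rule Cons.IH) (use Cons.prems \<open>\<not> t J\<close> in auto)
    moreover have "line_op (Suc k) ys x G s = c * line_op (Suc k) ys x H s'"
      unfolding s'_def by (rule Cons.IH) (use Cons.prems in auto)
    ultimately show ?case
      by (simp only: line_op.simps cross_op_def t' s' flip: t_def s'_def) (simp add: algebra_simps)
  qed (use that in auto)
  have "line_op 0 (ws @ [u]) x ?F t = line_op 0 ws x (cross_op ?m (u * x) ?F) t" for t
    by (simp add: line_op_append)
  also have "\<dots> t = (wa (x * u) * ?c) * line_op 0 ws x (state_vec ws) (t(Suc ?m := True))" if "\<not> t (Suc ?m)" for t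
    by (rule pass) (use base that in auto)
  finally have L: "line_op 0 (ws @ [u]) x ?F t = (wa (x * u) * ?c) * line_op 0 ws x (state_vec ws) (t(Suc ?m := True))"
    if "\<not> t (Suc ?m)" for t using that .
  define s' where "s' = s(Suc ?m := True)"
  have tw: "s(0 := a, Suc ?m := True) = s'(0 := a)" for a
    by (auto simp: fun_eq_iff s'_def)
  have s': "s' 0 = s 0" "s(length (x # ws) := True) = s'" by (simp_all add: s'_def)
  have "line_op 0 (ws @ [u]) x ?F (s(0 := a)) = (wa (x * u) * ?c) * line_op 0 ws x (state_vec ws) (s'(0 := a))" for a
    using L[of "s(0 := a)"] Cons.prems unfolding tw by simp
  then show ?case
    by (simp only: append_Cons state_vec.simps(2) reflect_op_def s') (simp add: algebra_simps)
qed

text \<open>At \<open>u x = q\<^sup>2\<close> the weight \<open>wb (u x)\<close> vanishes, so the two lines must differ where they cross, at the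
top right of the lattice. This fixes the last column, with corner weight \<open>\<delta> \<sigma>(q\<^sup>2 x\<^sup>2)\<close>, and makes the
first row leave to the right, which fixes it as well.\<close>

lemma Zl_freeze_plus:
  assumes "u * x = q\<^sup>2"
  shows "Zl (x # ws @ [u]) = Z2 u x * (\<Prod>w\<leftarrow>ws. wa (w * u) * wa (w * x)) * Zl ws"
proof -
  let ?m = "length ws" and ?F = "state_vec (ws @ [u])"
  define G where "G = cross_op ?m (u * x) ?F"
  have b0: "wb (u * x) = 0" using q_nz by (simp add: wb_def assms sigma_hat_def sigma_def)
  have "state_vec (x # ws @ [u]) = reflect_op x (line_op 0 ws x G)"
    by (simp add: line_op_append G_def)
  moreover have "line_op 0 ws x G (\<lambda>_. True) = 0"
    by (simp add: line_op_true G_def cross_op_def b0)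
  moreover have "G (single j) = 0" if "j < ?m" for j
    using that by (simp add: G_def cross_op_def b0 single_def)
  then have "line_op 0 ws x G (single 0) = (\<Prod>w\<leftarrow>ws. wa (w * x)) * G (single ?m)"
    by (subst line_op_single_last) auto
  moreover have "G (single ?m) = ?F (single ?m)"
  proof -
    have "?F ((single ?m)(?m := True, Suc ?m := False)) = 0"
      by (rule state_vec_support[where j = "Suc ?m"]) auto
    then show ?thesis by (auto simp: G_def cross_op_def single_def)
  qed
  moreover have "(single ?m)(?m := True) = (\<lambda>_. True)" "(\<lambda>_. True)(0 := False) = single 0"
     by (auto simp: single_def fun_eq_iff)
  moreover have "?F (single ?m) = \<gamma> * sigma (q\<^sup>2 * u\<^sup>2) * (\<Prod>w\<leftarrow>ws. wa (w * u)) * state_vec ws ((single ?m)(?m := True))"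
    by (rule state_vec_first_row) (simp add: single_def)
  ultimately show ?thesis
    by (simp add: Zl_def reflect_op_def Z2_def b0 prod_list_times fun_upd_idem algebra_simps)
qed

lemma Zl_one: "Zl [x] = amp x"
proof -
  have t: "(\<lambda>_. True)(0 := True) = (\<lambda>_. True)" "state_vec [] ((\<lambda>_. True)(0 := False)) = 0"
    by (auto intro: exI[of _ 0])
  have "Zl [x] = corner x True True * state_vec [] (\<lambda>_. True)"
    by (simp only: Zl_def state_vec.simps(2) line_op.simps reflect_op_def t mult_zero_right add_0_right)
  then show ?thesis by (simp add: amp_def)
qed

lemma Zl_two: "Zl [v, u] = Z2 u v"
proof -
  have t: "(\<lambda>_. True)(0 := False) = single 0" "(single 0)(0 := True) = (\<lambda>_. True)"
      "(\<lambda>_. True)(0 := True) = (\<lambda>_. True)" "\<not> single 0 0"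
    by (auto simp: single_def fun_eq_iff)
  have "state_vec [u] ((single 0)(0 := True, Suc 0 := False)) = 0"
    by (rule state_vec_support[where j = "Suc 0"]) auto
  then have "cross_op 0 (u * v) (state_vec [u]) (single 0) = state_vec [u] (single 0)"
    by (simp add: cross_op_def single_def del: state_vec.simps(2))
  moreover have "state_vec [u] (single 0) = \<gamma> * sigma (q\<^sup>2 * u\<^sup>2)"
    using state_vec_first_row[of "single 0" "[]" u] t
    by (simp del: state_vec.simps(2))
  moreover have "cross_op 0 (u * v) (state_vec [u]) (\<lambda>_. True) = wb (u * v) * amp u"
    using Zl_one[of u] by (simp add: Zl_def cross_op_true del: state_vec.simps(2))
  moreover have "Zl [v, u] = corner v True True * cross_op 0 (u * v) (state_vec [u]) (\<lambda>_. True)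
      + corner v False True * cross_op 0 (u * v) (state_vec [u]) (single 0)"
    by (simp only: Zl_def state_vec.simps(2)[of v "[u]"] line_op.simps reflect_op_def t)
  ultimately show ?thesis
    by (simp add: Z2_def amp_def algebra_simps)
qed
end

section \<open>Pfaffians\<close>

text \<open>The Pfaffian on the index set \<open>{a..<a + 2 * m}\<close>. Counting rows by pairs makes the recursion in \<open>m\<close>
available and includes the empty Pfaffian for every \<open>a\<close>.\<close>

definition pf_block :: "nat \<Rightarrow> nat \<Rightarrow> (nat \<Rightarrow> nat \<Rightarrow> 'a::field_char_0) \<Rightarrow> 'a" where
  "pf_block a m A =
     (\<Sum>p | p permutes {a..<a + 2 * m}.
        of_int (sign p) * (\<Prod>k<m. A (p (a + 2 * k)) (p (a + 2 * k + 1))))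
     / (2 ^ m * fact m)"

lemma pf_block_0: "pf_block a 0 A = 1"
  by (simp add: pf_block_def)

lemma pfaffian_eq_pf_block:
  assumes "Suc b = a + 2 * m"
  shows "pfaffian a b A = pf_block a m A"
proof -
  have S: "{a..b} = {a..<a + 2 * m}" using assms by auto
  have "card {a..b} = 2 * m" unfolding S by simp
  then show ?thesis by (simp add: pfaffian_def pf_block_def S)
qed

lemma block_pair_mem:
  "p permutes {a..<a + 2 * m} \<Longrightarrow> k < m \<Longrightarrow>
     p (a + 2 * k) \<in> {a..<a + 2 * m} \<and> p (Suc (a + 2 * k)) \<in> {a..<a + 2 * m}"
  by (simp only: permutes_in_image) auto

lemma pf_block_cong:
  assumes "\<And>i j. i \<in> {a..<a + 2 * m} \<Longrightarrow> j \<in> {a..<a + 2 * m} \<Longrightarrow> A i j = B i j"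
  shows "pf_block a m A = pf_block a m B"
  unfolding pf_block_def
  by (intro arg_cong2[where f = "(/)"] sum.cong arg_cong2[where f = "(*)"] prod.cong refl)
     (use block_pair_mem assms in auto)

lemma prod_pairs: "(\<Prod>k<m. d (a + 2 * k) * d (Suc (a + 2 * k))) = (\<Prod>i\<in>{a..<a + 2 * m}. d i :: 'a::comm_monoid_mult)"
proof (induction m)
  case (Suc m)
  have "{a..<a + 2 * Suc m} = insert (a + 2 * m) (insert (Suc (a + 2 * m)) {a..<a + 2 * m})" by auto
  then show ?case using Suc by (simp add: mult_ac)
qed simp

lemma pf_block_scale:
  "pf_block a m (\<lambda>i j. d i * d j * A i j) = (\<Prod>i\<in>{a..<a + 2 * m}. d i) * pf_block a m A"
proof -
  let ?S = "{a..<a + 2 * m}"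
  have "(\<Prod>k<m. d (p (a + 2 * k)) * d (p (a + 2 * k + 1)) * A (p (a + 2 * k)) (p (a + 2 * k + 1)))
      = (\<Prod>i\<in>?S. d i) * (\<Prod>k<m. A (p (a + 2 * k)) (p (a + 2 * k + 1)))" if "p permutes ?S" for p
  proof -
    have "(\<Prod>k<m. d (p (a + 2 * k)) * d (p (Suc (a + 2 * k)))) = (\<Prod>i\<in>?S. d i)"
      using prod_pairs[of "\<lambda>i. d (p i)" a m] prod.permute[OF that, of d] by (simp add: o_def)
    then show ?thesis by (simp add: prod.distrib)
  qed
  then have "(\<Sum>p | p permutes ?S. of_int (sign p) *
       (\<Prod>k<m. d (p (a + 2 * k)) * d (p (a + 2 * k + 1)) * A (p (a + 2 * k)) (p (a + 2 * k + 1))))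
     = (\<Sum>p | p permutes ?S. (\<Prod>i\<in>?S. d i) * (of_int (sign p) * (\<Prod>k<m. A (p (a + 2 * k)) (p (a + 2 * k + 1)))))"
    by (intro sum.cong) (auto simp: mult_ac)
  then show ?thesis
    unfolding pf_block_def by (simp only: sum_distrib_left[symmetric] times_divide_eq_right)
qed

text \<open>Antisymmetry of the Pfaffian, by the substitution \<open>p \<mapsto> t \<circ> p\<close> in the sum over permutations.\<close>

lemma pf_block_permute:
  assumes "t permutes {a..<a + 2 * m}"
  shows "pf_block a m (\<lambda>i j. A (t i) (t j)) = of_int (sign t) * pf_block a m A"
proof -
  let ?S = "{a..<a + 2 * m}"
  define f where "f p = of_int (sign p) * (\<Prod>k<m. A (p (a + 2 * k)) (p (a + 2 * k + 1)))" for p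
  have pt: "permutation t" using assms permutation_permutes by blast
  have sg: "(of_int (sign t) :: 'a) * of_int (sign t) = 1"
    by (simp flip: of_int_mult add: sign_idempotent)
  have "f (t \<circ> p) = of_int (sign t) * (of_int (sign p) *
      (\<Prod>k<m. A (t (p (a + 2 * k))) (t (p (a + 2 * k + 1)))))" if "p permutes ?S" for p
  proof -
    have "permutation p" using that permutation_permutes by blast
    then show ?thesis by (simp add: f_def sign_compose pt)
  qed
  then have "(\<Sum>p | p permutes ?S. f p) = of_int (sign t) * (\<Sum>p | p permutes ?S. of_int (sign p) *
      (\<Prod>k<m. A (t (p (a + 2 * k))) (t (p (a + 2 * k + 1)))))"
    unfolding sum_distrib_left
    by (subst setum_permutations_compose_left[OF assms]) (intro sum.cong, auto)
  then show ?thesis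
    unfolding pf_block_def f_def[symmetric]
    by (simp add: mult.assoc[symmetric] sg)
qed

text \<open>The transposition of the two rows fixes the matrix but negates the Pfaffian, and the characteristic is \<open>0\<close>.\<close>

lemma pf_block_equal_rows:
  assumes "i \<in> {a..<a + 2 * m}" "j \<in> {a..<a + 2 * m}" "i \<noteq> j"
    and "\<And>x y. A (transpose i j x) (transpose i j y) = A x y"
  shows "pf_block a m A = 0"
proof -
  have "pf_block a m A = - pf_block a m A"
    using pf_block_permute[of "transpose i j" a m A] assms by (simp add: permutes_swap_id sign_swap_id)
  then show ?thesis by simp
qed

text \<open>Expansion along the last column. The summand is invariant under permuting the pairs of positions
and, by skew symmetry, under swapping a pair; so the position of the largest index \<open>b\<close> may be taken
to be the last one, at the cost of the factor \<open>2 * Suc m\<close>. A permutation that fixes \<open>b\<close> is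
\<open>transpose c i \<circ> p\<close>, with \<open>c\<close> the index before \<open>b\<close>, some \<open>i\<close>, and a permutation \<open>p\<close> of
the indices before \<open>c\<close>. Using transpositions rather than deleting index \<open>i\<close> keeps all cofactors on the same index set.\<close>

lemma pf_block_expand:
  fixes A :: "nat \<Rightarrow> nat \<Rightarrow> 'a::field_char_0"
  assumes skew: "\<And>i j. A j i = - A i j"
  shows "pf_block a (Suc m) A =
    (\<Sum>i\<in>{a..a + 2 * m}. of_int (sign (transpose (a + 2 * m) i)) * A i (Suc (a + 2 * m)) *
       pf_block a m (\<lambda>x y. A (transpose (a + 2 * m) i x) (transpose (a + 2 * m) i y)))"
proof -
  define S0 c b S where "S0 = {a..<a + 2 * m}" "c = a + 2 * m" "b = Suc (a + 2 * m)" "S = {a..<a + 2 * Suc m}"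
  note defs = S0_c_b_S_def
  define w where "w p = (\<Prod>k<Suc m. A (p (a + 2 * k)) (p (a + 2 * k + 1)))" for p
  define f where "f p = of_int (sign p) * w p" for p
  define g where "g l = (\<Sum>p | p permutes S \<and> p l = b. f p)" for l
  have fin: "finite {p. p permutes S}" by (simp add: finite_permutations defs)
  have S: "S = insert b (insert c S0)" by (auto simp: defs)
  have g_move: "g (r l) = g l"
    if r: "r permutes S" "r \<circ> r = id" and fr: "\<And>p. p permutes S \<Longrightarrow> f (p \<circ> r) = f p" for r l
    unfolding g_def
  proof (rule sum.reindex_bij_witness[where i = "\<lambda>p. p \<circ> r" and j = "\<lambda>p. p \<circ> r"])
    have rr: "r (r x) = x" for x using r(2) by (metis comp_apply id_apply)
    fix p assume p: "p \<in> {p. p permutes S \<and> p (r l) = b}"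
    then show "p \<circ> r \<circ> r = p" "p \<circ> r \<in> {p. p permutes S \<and> p l = b}" "f (p \<circ> r) = f p"
      using r fr by (auto simp: rr fun_eq_iff permutes_compose)
  next
    have rr: "r (r x) = x" for x using r(2) by (metis comp_apply id_apply)
    fix p assume p: "p \<in> {p. p permutes S \<and> p l = b}"
    then show "p \<circ> r \<circ> r = p" "p \<circ> r \<in> {p. p permutes S \<and> p (r l) = b}"
      using r by (auto simp: rr fun_eq_iff permutes_compose)
  qed
  have pp: "permutation p" if "p permutes S" for p using that permutation_permutes defs by blast
  \<comment> \<open>\<open>g l\<close> is the part of the sum with \<open>b\<close> at position \<open>l\<close>; swapping a pair of positions does not
      change the summand: the sign and the matrix entry both change sign.\<close>
  have swap1: "g (Suc (a + 2 * k)) = g (a + 2 * k)" if k: "k < Suc m" for k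
  proof -
    let ?r = "transpose (a + 2 * k) (Suc (a + 2 * k))"
    have r: "?r permutes S" using k by (intro permutes_swap_id) (auto simp: defs)
    have "w (p \<circ> ?r) = - w p" for p
    proof -
      have ne: "a + 2 * j \<noteq> Suc (a + 2 * k)" "Suc (a + 2 * j) \<noteq> a + 2 * k" for j by presburger+
      have r: "?r (a + 2 * j) = (if j = k then Suc (a + 2 * k) else a + 2 * j)"
        "?r (Suc (a + 2 * j)) = (if j = k then a + 2 * k else Suc (a + 2 * j))" for j
        using ne[of j] by (auto simp: transpose_def)
      have "w p = A (p (a + 2 * k)) (p (Suc (a + 2 * k))) *
          (\<Prod>j\<in>{..<Suc m} - {k}. A (p (a + 2 * j)) (p (a + 2 * j + 1)))"
        unfolding w_def by (subst prod.remove[where x = k]) (use k in auto)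
      moreover have "w (p \<circ> ?r) = A (p (Suc (a + 2 * k))) (p (a + 2 * k)) *
          (\<Prod>j\<in>{..<Suc m} - {k}. A (p (a + 2 * j)) (p (a + 2 * j + 1)))"
        unfolding w_def by (subst prod.remove[where x = k]) (use k in \<open>auto simp: r intro!: prod.cong\<close>)
      ultimately show ?thesis using skew[of "p (Suc (a + 2 * k))" "p (a + 2 * k)"] by simp
    qed
    then have "f (p \<circ> ?r) = f p" if "p permutes S" for p
      using that by (simp add: f_def sign_compose pp permutation_swap_id sign_swap_id)
    from g_move[OF r _ this, of "a + 2 * k"] show ?thesis by simp
  qed
  \<comment> \<open>Exchanging a pair of positions with the last pair is an even permutation.\<close>
  have swap2: "g (Suc (a + 2 * k)) = g b" if k: "k < m" for k
  proof -
    define r where "r = transpose (a + 2 * k) c \<circ> transpose (Suc (a + 2 * k)) b"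
    have r: "r permutes S" unfolding r_def
      using k by (intro permutes_compose permutes_swap_id) (auto simp: defs)
    have ne: "a + 2 * j \<noteq> Suc (a + 2 * i)" "Suc (a + 2 * i) \<noteq> a + 2 * j" for i j by presburger+
    have rv: "r (a + 2 * j) = a + 2 * transpose k m j" "r (Suc (a + 2 * j)) = Suc (a + 2 * transpose k m j)" for j
      using ne by (auto simp: r_def defs transpose_def)
    have "w (p \<circ> r) = w p" for p
    proof -
      have "transpose k m permutes {..<Suc m}" using k by (intro permutes_swap_id) auto
      from prod.permute[OF this, of "\<lambda>j. A (p (a + 2 * j)) (p (a + 2 * j + 1))"]
      show ?thesis by (simp add: w_def rv o_def)
    qed
    moreover have "sign r = 1" unfolding r_def
      using k by (subst sign_compose) (auto simp: permutation_swap_id sign_swap_id defs)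
    ultimately have fr: "f (p \<circ> r) = f p" if "p permutes S" for p
      using that r by (simp add: f_def sign_compose pp)
    have rr: "r \<circ> r = id"
      using ne by (auto simp: r_def defs transpose_def fun_eq_iff)
    have "r b = Suc (a + 2 * k)" using ne k by (auto simp: r_def defs transpose_def)
    with g_move[OF r rr fr, of b] show ?thesis by simp
  qed
  have gl: "g l = g b" if "l \<in> S" for l
  proof -
    have "\<exists>k<Suc m. l = a + 2 * k \<or> l = Suc (a + 2 * k)"
      using that by (intro exI[of _ "(l - a) div 2"]) (auto simp: defs)
    then obtain k where k: "k < Suc m" "l = a + 2 * k \<or> l = Suc (a + 2 * k)" by blast
    have "g l = g (Suc (a + 2 * k))" using k swap1 by auto
    also have "\<dots> = g b"
    proof (cases "k = m")
      case True then show ?thesis by (simp add: defs)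
    next
      case False then show ?thesis using k swap2 by simp
    qed
    finally show ?thesis .
  qed
  have "(\<Sum>p | p permutes S. f p) = (\<Sum>l\<in>S. \<Sum>p \<in> {p \<in> {p. p permutes S}. inv p b = l}. f p)"
  proof -
    have "(\<lambda>p. inv p b) ` {p. p permutes S} \<subseteq> S"
    proof clarify
      fix p assume "p permutes S"
      then have "inv p permutes S" by (rule permutes_inv)
      then show "inv p b \<in> S" using permutes_in_image S by (metis insertI1)
    qed
    moreover have "finite S" by (simp add: defs)
    ultimately show ?thesis
      using sum.group[of "{p. p permutes S}" S "\<lambda>p. inv p b" f] fin by simp
  qed
  also have "\<dots> = (\<Sum>l\<in>S. g l)"
  proof (rule sum.cong[OF refl])
    fix l
    have "{p \<in> {p. p permutes S}. inv p b = l} = {p. p permutes S \<and> p l = b}"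
      using permutes_inv_eq by fastforce
    then show "(\<Sum>p \<in> {p \<in> {p. p permutes S}. inv p b = l}. f p) = g l" by (simp add: g_def)
  qed
  also have "\<dots> = (\<Sum>l\<in>S. g b)" by (rule sum.cong[OF refl gl])
  also have "\<dots> = of_nat (card S) * g b" by (rule sum_constant)
  also have "card S = 2 * Suc m" by (simp add: defs(4))
  also have "g b = (\<Sum>p | p permutes insert c S0. f p)"
  proof -
    have "p permutes insert c S0" if "p permutes S" "p b = b" for p
      by (rule permutes_superset[OF that(1)]) (use that S in auto)
    moreover have "p permutes S \<and> p b = b" if "p permutes insert c S0" for p
      using permutes_subset[OF that, of S] permutes_not_in[OF that, of b] S by (auto simp: defs)
    ultimately show ?thesis unfolding g_def by (intro sum.cong) auto
  qed
  also have "\<dots> = (\<Sum>i\<in>insert c S0. \<Sum>q | q permutes S0. f (transpose c i \<circ> q))"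
    using sum_over_permutations_insert[of S0 c f] by (simp add: defs)
  also have "\<dots> = (\<Sum>i\<in>insert c S0. of_int (sign (transpose c i)) * A i b *
       (2 ^ m * fact m * pf_block a m (\<lambda>x y. A (transpose c i x) (transpose c i y))))"
  proof (rule sum.cong[OF refl])
    fix i assume i: "i \<in> insert c S0"
    let ?T = "transpose c i"
    have "f (?T \<circ> q) = of_int (sign ?T) * A i b *
        (of_int (sign q) * (\<Prod>k<m. A (?T (q (a + 2 * k))) (?T (q (a + 2 * k + 1)))))"
      if q: "q permutes S0" for q
    proof -
      have q': "q c = c" "q b = b" using permutes_not_in[OF q] by (auto simp: defs)
      have T: "?T c = i" "?T b = b" using i by (auto simp: transpose_def defs)
      have "permutation q" using q permutation_permutes[of q] defs by blast
      moreover have "w (?T \<circ> q) = (\<Prod>k<m. A (?T (q (a + 2 * k))) (?T (q (a + 2 * k + 1)))) * A i b"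
        using q' T by (simp add: w_def) (simp add: defs)
      ultimately show ?thesis by (simp add: f_def sign_compose permutation_swap_id)
    qed
    then have "(\<Sum>q | q permutes S0. f (?T \<circ> q)) = of_int (sign ?T) * A i b *
       (\<Sum>q | q permutes S0. of_int (sign q) * (\<Prod>k<m. A (?T (q (a + 2 * k))) (?T (q (a + 2 * k + 1)))))"
      unfolding sum_distrib_left by (intro sum.cong) auto
    then show "(\<Sum>q | q permutes S0. f (?T \<circ> q)) = of_int (sign ?T) * A i b *
       (2 ^ m * fact m * pf_block a m (\<lambda>x y. A (?T x) (?T y)))"
      by (simp add: pf_block_def defs)
  qed
  finally have main: "(\<Sum>p | p permutes S. f p) = of_nat (2 * Suc m) * (2 ^ m * fact m) *
     (\<Sum>i\<in>insert c S0. of_int (sign (transpose c i)) * A i b * pf_block a m (\<lambda>x y. A (transpose c i x) (transpose c i y)))"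
    by (simp add: sum_distrib_left mult_ac)
  define D R where "D = (2 ^ Suc m * fact (Suc m) :: 'a)"
    and "R = (\<Sum>i\<in>insert c S0. of_int (sign (transpose c i)) * A i b *
      pf_block a m (\<lambda>x y. A (transpose c i x) (transpose c i y)))"
  have "D = of_nat (2 * Suc m) * (2 ^ m * fact m)" by (simp add: D_def algebra_simps)
  then have "(\<Sum>p | p permutes S. f p) = D * R" using main by (simp only: R_def)
  moreover have "D \<noteq> 0" unfolding D_def by (simp del: fact_Suc)
  ultimately have "(\<Sum>p | p permutes S. f p) / D = R" by simp
  moreover have "pf_block a (Suc m) A = (\<Sum>p | p permutes S. f p) / D"
    by (simp only: pf_block_def f_def w_def D_def defs(4))
  moreover have "insert c S0 = {a..a + 2 * m}" by (auto simp: defs)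
  ultimately show ?thesis by (simp only: R_def defs(2,3))
qed

section \<open>Interpolation of Laurent polynomials\<close>

text \<open>Laurent polynomials of the form \<open>x\<^sup>-\<^sup>d p (x\<^sup>2)\<close> with \<open>degree p \<le> d\<close>: degree at most \<open>d\<close> in both \<open>x\<close> and
\<open>1 / x\<close>, with exponents of the parity of \<open>d\<close>. The parity halves the number of interpolation points.\<close>

definition laurent_deg :: "nat \<Rightarrow> ('a::field_char_0 \<Rightarrow> 'a) \<Rightarrow> bool" where
  "laurent_deg d f \<longleftrightarrow> (\<exists>p. degree p \<le> d \<and> (\<forall>x. x \<noteq> 0 \<longrightarrow> f x * x ^ d = poly p (x\<^sup>2)))"

lemma laurent_deg_const: "laurent_deg 0 (\<lambda>_. c)"
  unfolding laurent_deg_def by (intro exI[of _ "[:c:]"]) simp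

lemma laurent_deg_mult:
  assumes "laurent_deg d f" "laurent_deg e g"
  shows "laurent_deg (d + e) (\<lambda>x. f x * g x)"
proof -
  obtain p r where "degree p \<le> d" "\<forall>x. x \<noteq> 0 \<longrightarrow> f x * x ^ d = poly p (x\<^sup>2)"
    "degree r \<le> e" "\<forall>x. x \<noteq> 0 \<longrightarrow> g x * x ^ e = poly r (x\<^sup>2)"
    using assms unfolding laurent_deg_def by blast
  then show ?thesis unfolding laurent_deg_def
    by (intro exI[of _ "p * r"])
       (auto simp: power_add algebra_simps intro!: order_trans[OF degree_mult_le])
qed

lemma laurent_deg_cmult: "laurent_deg d f \<Longrightarrow> laurent_deg d (\<lambda>x. c * f x)"
  using laurent_deg_mult[OF laurent_deg_const[of c]] by simp

lemma laurent_deg_add: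
  assumes "laurent_deg d f" "laurent_deg d g"
  shows "laurent_deg d (\<lambda>x. f x + g x)"
proof -
  obtain p r where "degree p \<le> d" "\<forall>x. x \<noteq> 0 \<longrightarrow> f x * x ^ d = poly p (x\<^sup>2)"
    "degree r \<le> d" "\<forall>x. x \<noteq> 0 \<longrightarrow> g x * x ^ d = poly r (x\<^sup>2)"
    using assms unfolding laurent_deg_def by blast
  then show ?thesis unfolding laurent_deg_def
    by (intro exI[of _ "p + r"]) (auto simp: algebra_simps degree_add_le)
qed

lemma laurent_deg_zero: "laurent_deg d (\<lambda>_. 0)"
  unfolding laurent_deg_def by (intro exI[of _ 0]) simp

lemma laurent_deg_sum:
  "(\<And>i. i \<in> S \<Longrightarrow> laurent_deg d (f i)) \<Longrightarrow> laurent_deg d (\<lambda>x. \<Sum>i\<in>S. f i x)"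
  by (induction S rule: infinite_finite_induct) (auto simp: laurent_deg_zero laurent_deg_add)

lemma laurent_deg_prod:
  assumes "finite S" "\<And>i. i \<in> S \<Longrightarrow> laurent_deg e (f i)"
  shows "laurent_deg (card S * e) (\<lambda>x. \<Prod>i\<in>S. f i x)"
  using assms
proof (induction S rule: finite_induct)
  case (insert i S)
  then show ?case using laurent_deg_mult[of e "f i" "card S * e"] by simp
qed (use laurent_deg_const[of 1] in simp)

lemma laurent_deg_prod_list:
  assumes "\<And>w. w \<in> set ws \<Longrightarrow> laurent_deg e (f w)"
  shows "laurent_deg (length ws * e) (\<lambda>x. \<Prod>w\<leftarrow>ws. f w x)"
  using assms
proof (induction ws)
  case (Cons w ws)
  then show ?case using laurent_deg_mult[of e "f w" "length ws * e"] by simp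
qed (use laurent_deg_const[of 1] in simp)

lemma laurent_deg_linear: "laurent_deg 1 (\<lambda>x. a * x + b * inverse x)"
  unfolding laurent_deg_def
  by (intro exI[of _ "[:b, a:]"]) (auto simp: algebra_simps power2_eq_square)

lemma laurent_deg_sigma_sq: "laurent_deg 2 (\<lambda>x. sigma (c * x\<^sup>2))"
  unfolding laurent_deg_def
  by (intro exI[of _ "[:- inverse c, 0, c:]"])
     (auto simp: sigma_def field_simps power2_eq_square)

text \<open>The difference corresponds to a polynomial in \<open>x\<^sup>2\<close> of degree at most \<open>d\<close>, which has more than \<open>d\<close>
zeros.\<close>

lemma laurent_deg_eqI:
  assumes f: "laurent_deg d f" and g: "laurent_deg d g"
    and X: "finite X" "0 \<notin> X" "card ((\<lambda>x. x\<^sup>2) ` X) > d"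
    and eq: "\<And>x. x \<in> X \<Longrightarrow> f x = g x" and "x \<noteq> 0"
  shows "f x = g x"
proof -
  obtain p r where p: "degree p \<le> d" "\<And>x. x \<noteq> 0 \<Longrightarrow> f x * x ^ d = poly p (x\<^sup>2)"
    and r: "degree r \<le> d" "\<And>x. x \<noteq> 0 \<Longrightarrow> g x * x ^ d = poly r (x\<^sup>2)"
    using f g unfolding laurent_deg_def by metis
  have "p = r"
  proof (rule ccontr)
    assume "p \<noteq> r"
    then have ne: "p - r \<noteq> 0" by simp
    have "(\<lambda>x. x\<^sup>2) ` X \<subseteq> {y. poly (p - r) y = 0}"
      
    proof clarify
      fix x assume "x \<in> X"
      then have "x \<noteq> 0" "f x = g x" using eq X(2) by auto
      then show "poly (p - r) (x\<^sup>2) = 0" using p(2)[of x] r(2)[of x] by simp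
    qed
    then have "card ((\<lambda>x. x\<^sup>2) ` X) \<le> card {y. poly (p - r) y = 0}"
      by (intro card_mono poly_roots_finite ne)
    also have "\<dots> \<le> degree (p - r)" by (rule card_poly_roots_bound[OF ne])
    also have "\<dots> \<le> d" using p(1) r(1) by (rule degree_diff_le)
    finally show False using X(3) by simp
  qed
  then have "f x * x ^ d = g x * x ^ d" using p(2) r(2) \<open>x \<noteq> 0\<close> by simp
  then show ?thesis using \<open>x \<noteq> 0\<close> by simp
qed

section \<open>Products over pairs of indices\<close>

lemma finite_bulk [simp]: "finite (bulk n)"
  by (rule finite_subset[of _ "{0..n} \<times> {0..n}"]) (auto simp: bulk_def)

lemma prod_bulk_Suc:
  "(\<Prod>(i, j)\<in>bulk (Suc n). h i j) = (\<Prod>(i, j)\<in>bulk n. h i j) * (\<Prod>i=1..n. h i (Suc n))"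
proof -
  have "bulk (Suc n) = bulk n \<union> (\<lambda>i. (i, Suc n)) ` {1..n}"
    by (auto simp: bulk_def)
  moreover have "bulk n \<inter> (\<lambda>i. (i, Suc n)) ` {1..n} = {}" by (auto simp: bulk_def)
  ultimately show ?thesis
    by (simp add: prod.union_disjoint prod.reindex inj_on_def)
qed

lemma bulk_0 [simp]: "bulk 0 = {}" by (auto simp: bulk_def)
lemma bulk_1 [simp]: "bulk (Suc 0) = {}" by (auto simp: bulk_def)

text \<open>Both \<open>e = -1\<close> and \<open>e = 1\<close> are needed. Swapping \<open>k\<close> with the largest index permutes the pairs; the pairs
\<open>(k, j)\<close> and \<open>(j, Suc n)\<close> with \<open>j\<close> in between are both reversed, which gives an even power of \<open>e\<close>,
and the pair \<open>(k, Suc n)\<close> contributes the remaining \<open>e\<close>. In the proof \<open>P\<close> collects the pairs that avoid both indices.\<close>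

lemma prod_bulk_transpose:
  fixes h :: "nat \<Rightarrow> nat \<Rightarrow> 'a::comm_ring_1"
  assumes h: "\<And>i j. h j i = e * h i j" and k: "1 \<le> k" "k < Suc n"
  shows "(\<Prod>(i, j)\<in>bulk (Suc n). h (transpose (Suc n) k i) (transpose (Suc n) k j))
    = e * (\<Prod>(i, j)\<in>bulk (Suc n). h i j)"
proof -
  let ?T = "transpose (Suc n) k"
  define P where "P = {(i, j) \<in> bulk n. i \<noteq> k \<and> j \<noteq> k}"
  have split: "(\<Prod>(i, j)\<in>bulk n. f i j) =
      (\<Prod>(i, j)\<in>P. f i j) * (\<Prod>i\<in>{1..<k}. f i k) * (\<Prod>j\<in>{k<..n}. f k j)" for f :: "nat \<Rightarrow> nat \<Rightarrow> 'a"
  proof -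
    have "bulk n = P \<union> ((\<lambda>i. (i, k)) ` {1..<k} \<union> (\<lambda>j. (k, j)) ` {k<..n})"
      using k by (auto simp: P_def bulk_def)
    moreover have "P \<inter> ((\<lambda>i. (i, k)) ` {1..<k} \<union> (\<lambda>j. (k, j)) ` {k<..n}) = {}"
      "(\<lambda>i. (i, k)) ` {1..<k} \<inter> (\<lambda>j. (k, j)) ` {k<..n} = {}" "finite P"
      by (auto simp: P_def intro: finite_subset[OF _ finite_bulk[of n]])
    ultimately show ?thesis
      by (simp add: prod.union_disjoint prod.reindex inj_on_def mult.assoc)
  qed
  have T: "?T i = i" if "i \<le> n" "i \<noteq> k" for i using that by (simp add: transpose_def)
  define Q where "Q y = (\<Prod>i\<in>{1..n} - {k}. h i y)" for y
  have cross: "(\<Prod>i\<in>{1..<k}. h i y) * (\<Prod>j\<in>{k<..n}. h y j) = e ^ card {k<..n} * Q y" for y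
  proof -
    have "(\<Prod>j\<in>{k<..n}. h y j) = e ^ card {k<..n} * (\<Prod>j\<in>{k<..n}. h j y)"
      by (simp add: h[where j = y] prod.distrib)
    moreover have "{1..n} - {k} = {1..<k} \<union> {k<..n}" using k by auto
    moreover have "{1..<k} \<inter> {k<..n} = {}" by auto
    ultimately show ?thesis by (simp add: Q_def prod.union_disjoint mult_ac)
  qed
  have last: "(\<Prod>i=1..n. f i) = f k * (\<Prod>i\<in>{1..n} - {k}. f i)" for f :: "nat \<Rightarrow> 'a"
    using k by (subst prod.remove[where x = k]) auto
  have "(\<Prod>(i, j)\<in>P. h (?T i) (?T j)) = (\<Prod>(i, j)\<in>P. h i j)"
    by (rule prod.cong) (auto simp: P_def bulk_def T)
  moreover have "(\<Prod>i\<in>{1..<k}. h (?T i) (?T k)) = (\<Prod>i\<in>{1..<k}. h i (Suc n))"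
    by (rule prod.cong) (use k in \<open>auto simp: T\<close>)
  moreover have "(\<Prod>j\<in>{k<..n}. h (?T k) (?T j)) = (\<Prod>j\<in>{k<..n}. h (Suc n) j)"
    by (rule prod.cong) (use k in \<open>auto simp: T\<close>)
  moreover have "(\<Prod>i=1..n. h (?T i) (?T (Suc n))) = h (Suc n) k * Q k"
    unfolding last Q_def using k by (auto simp: T intro!: prod.cong arg_cong2[where f = "(*)"])
  ultimately have "(\<Prod>(i, j)\<in>bulk (Suc n). h (?T i) (?T j)) =
      (\<Prod>(i, j)\<in>P. h i j) * (e ^ card {k<..n} * Q (Suc n)) * (h (Suc n) k * Q k)"
    unfolding prod_bulk_Suc split[of "\<lambda>i j. h (?T i) (?T j)"] by (simp only: mult.assoc cross[of "Suc n", symmetric])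
  moreover have "(\<Prod>(i, j)\<in>bulk (Suc n). h i j) =
      (\<Prod>(i, j)\<in>P. h i j) * (e ^ card {k<..n} * Q k) * (h k (Suc n) * Q (Suc n))"
    unfolding prod_bulk_Suc split[of h] last Q_def[symmetric] by (simp only: mult.assoc cross[of k, symmetric])
  ultimately show ?thesis by (simp add: h[where i = k and j = "Suc n"] mult_ac)
qed

context dsasm_weights begin

section \<open>The cleared identity and its degree\<close>

text \<open>The denominator of the Pfaffian entry of two variables. It vanishes at the frozen points.\<close>

definition pair_wt :: "'a \<Rightarrow> 'a \<Rightarrow> 'a" where "pair_wt x y = wa (x * y) * wb (x * y)"

definition pf_entry :: "(nat \<Rightarrow> 'a) \<Rightarrow> nat \<Rightarrow> nat \<Rightarrow> 'a" where
  "pf_entry u i j =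
     (if i = 0 then (if j = 0 then 0 else amp (u j))
      else if j = 0 then - amp (u i)
      else sh (u i / u j) * Z2 (u i) (u j) / pair_wt (u i) (u j))"

lemma sh_inverse: "sh (x / y) = - sh (y / x)"
  by (simp add: sigma_hat_def sigma_def minus_divide_left)

lemma sh_zero_iff: "y \<noteq> 0 \<Longrightarrow> sh y = 0 \<longleftrightarrow> y\<^sup>2 = 1"
proof -
  assume "y \<noteq> 0"
  have "sh y = 0 \<longleftrightarrow> sigma y = 0" using sigma_q4_nz by (simp add: sigma_hat_def)
  also have "\<dots> \<longleftrightarrow> y\<^sup>2 = 1" using \<open>y \<noteq> 0\<close> by (auto simp: sigma_def field_simps power2_eq_square)
  finally show ?thesis .
qed

lemma pair_wt_commute: "pair_wt x y = pair_wt y x" by (simp add: pair_wt_def mult.commute)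
lemma Z2_commute: "Z2 x y = Z2 y x" by (simp add: Z2_def mult_ac)

lemma pf_entry_skew: "pf_entry u j i = - pf_entry u i j"
  using sh_inverse[of "u i" "u j"] by (auto simp: pf_entry_def pair_wt_commute[of "u j"] Z2_commute[of "u j"])

definition zfun :: "nat \<Rightarrow> (nat \<Rightarrow> 'a) \<Rightarrow> 'a" where "zfun n u = Zl (rev (map u [1..<Suc n]))"
text \<open>With these two products the Pfaffian formula reads \<open>diff_prod n u * zfun n u = pair_wt_prod n u * Pf\<close>.\<close>

definition diff_prod :: "nat \<Rightarrow> (nat \<Rightarrow> 'a) \<Rightarrow> 'a" where "diff_prod n u = (\<Prod>(i, j)\<in>bulk n. sh (u i / u j))"
definition pair_wt_prod :: "nat \<Rightarrow> (nat \<Rightarrow> 'a) \<Rightarrow> 'a" where "pair_wt_prod n u = (\<Prod>(i, j)\<in>bulk n. pair_wt (u i) (u j))"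

text \<open>These conditions make the interpolation points distinct, the denominators nonzero and the scalars in
\<open>Zl_swap\<close> invertible.\<close>

definition generic :: "nat \<Rightarrow> (nat \<Rightarrow> 'a) \<Rightarrow> bool" where
  "generic n u \<longleftrightarrow> (\<forall>i\<in>{1..n}. u i \<noteq> 0) \<and> (\<forall>i\<in>{1..n}. \<forall>j\<in>{1..n}. pair_wt (u i) (u j) \<noteq> 0 \<and>
     sh (q ^ 4 * (u i / u j)) \<noteq> 0 \<and> (i \<noteq> j \<longrightarrow> (u i)\<^sup>2 \<noteq> (u j)\<^sup>2))"

lemma laurent_wab: "laurent_deg 1 (\<lambda>x. wa (w * x))" "laurent_deg 1 (\<lambda>x. wb (w * x))"
    "laurent_deg 1 (\<lambda>x. sh (w / x))"
proof -
  let ?s = "inverse (sigma (q ^ 4))"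
  have "(\<lambda>x. wa (w * x)) = (\<lambda>x. (q\<^sup>2 * w * ?s) * x + (- inverse (q\<^sup>2 * w) * ?s) * inverse x)"
    by (auto simp: wa_def sigma_hat_def sigma_def divide_inverse algebra_simps)
  then show "laurent_deg 1 (\<lambda>x. wa (w * x))" by (simp only: laurent_deg_linear)
  have "(\<lambda>x. wb (w * x)) = (\<lambda>x. (- inverse (q\<^sup>2) * w * ?s) * x + (q\<^sup>2 * inverse w * ?s) * inverse x)"
    by (auto simp: wb_def sigma_hat_def sigma_def divide_inverse algebra_simps)
  then show "laurent_deg 1 (\<lambda>x. wb (w * x))" by (simp only: laurent_deg_linear)
  have "(\<lambda>x. sh (w / x)) = (\<lambda>x. (- inverse w * ?s) * x + (w * ?s) * inverse x)"
    by (auto simp: sigma_hat_def sigma_def divide_inverse algebra_simps)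
  then show "laurent_deg 1 (\<lambda>x. sh (w / x))" by (simp only: laurent_deg_linear)
qed

lemma laurent_amp: "laurent_deg 1 amp"
proof -
  have "amp = (\<lambda>x. (\<alpha> * q) * x + (\<beta> * inverse q) * inverse x)" by (auto simp: amp_def)
  then show ?thesis by (simp only: laurent_deg_linear)
qed

lemma laurent_pair_wt: "laurent_deg 2 (pair_wt w)"
proof -
  have "pair_wt w = (\<lambda>x. wa (w * x) * wb (w * x))" by (auto simp: pair_wt_def)
  then show ?thesis using laurent_deg_mult[OF laurent_wab(1)[of w] laurent_wab(2)[of w]] by (simp add: numeral_2_eq_2)
qed

lemma laurent_Z2: "laurent_deg 2 (Z2 w)"
proof -
  have eq: "Z2 w = (\<lambda>x. amp w * (amp x * wb (w * x)) + (\<gamma> * \<delta> * sigma (q\<^sup>2 * w\<^sup>2)) * sigma (q\<^sup>2 * x\<^sup>2))"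
    by (auto simp: Z2_def mult_ac)
  have A: "laurent_deg 2 (\<lambda>x. amp x * wb (w * x))"
    using laurent_deg_mult[OF laurent_amp laurent_wab(2)[of w]] by (simp add: numeral_2_eq_2)
  show ?thesis unfolding eq
    by (rule laurent_deg_add[OF laurent_deg_cmult[OF A] laurent_deg_cmult[OF laurent_deg_sigma_sq]])
qed

text \<open>Of the \<open>length ws\<close> vertices that the line passes, at least one has weight \<open>1\<close>: the assumption on
\<open>G\<close> excludes that the opposite arrow is moved all the way to the top of the column.\<close>

lemma laurent_line_op_single:
  assumes "G (single (k + length ws)) = 0" "ws \<noteq> []"
  shows "laurent_deg (length ws - 1) (\<lambda>x. line_op k ws x G (single k))"
  using assms
proof (induction ws arbitrary: k)
  case (Cons w ws)
  have sw: "(single k)(k := True, Suc k := False) = single (Suc k)"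
    by (auto simp: single_def fun_eq_iff)
  have "line_op (Suc k) ws x G (single k) = (\<Prod>w\<leftarrow>ws. wb (w * x)) * G (single k)" for x
    by (rule line_op_true) (auto simp: single_def)
  then have eq: "line_op k (w # ws) x G (single k) =
      G (single k) * (\<Prod>w\<leftarrow>ws. wb (w * x)) + wa (w * x) * line_op (Suc k) ws x G (single (Suc k))" for x
    by (auto simp: cross_op_def sw) (auto simp: single_def)
  have d1: "laurent_deg (length ws) (\<lambda>x. G (single k) * (\<Prod>w\<leftarrow>ws. wb (w * x)))"
    using laurent_deg_cmult[OF laurent_deg_prod_list[of ws 1 "\<lambda>w x. wb (w * x)"]] laurent_wab by simp
  show ?case
  proof (cases "ws = []")
    case True
    then have "line_op k (w # ws) x G (single k) = G (single k) * (\<Prod>w\<leftarrow>ws. wb (w * x))" for x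
      using eq Cons.prems by simp
    then show ?thesis using d1 by simp
  next
    case False
    have "laurent_deg (length ws - 1) (\<lambda>x. line_op (Suc k) ws x G (single (Suc k)))"
      by (rule Cons.IH) (use Cons.prems False in auto)
    from laurent_deg_mult[OF laurent_wab(1)[of w] this]
    have "laurent_deg (length ws) (\<lambda>x. wa (w * x) * line_op (Suc k) ws x G (single (Suc k)))"
      using False by (cases ws) auto
    from laurent_deg_add[OF d1 this] show ?thesis unfolding eq by simp
  qed
qed simp

text \<open>The last column has either no turning arrow, with a corner weight of degree \<open>1\<close> and all vertices of
degree \<open>1\<close>, or one, with a corner weight of degree \<open>2\<close> and one vertex of degree \<open>0\<close>.\<close>

lemma laurent_Zl: "laurent_deg (Suc (length ws)) (\<lambda>x. Zl (x # ws))"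
proof (cases "ws = []")
  case True
  then show ?thesis using laurent_amp by (simp add: Zl_one)
next
  case False
  let ?G = "state_vec ws"
  have t: "(\<lambda>_. True)(0 := True) = (\<lambda>_. True)" "(\<lambda>_. True)(0 := False) = single 0"
    by (auto simp: single_def fun_eq_iff)
  have eq: "Zl (x # ws) = Zl ws * (amp x * (\<Prod>w\<leftarrow>ws. wb (w * x))) +
      \<delta> * (sigma (q\<^sup>2 * x\<^sup>2) * line_op 0 ws x ?G (single 0))" for x
    by (simp add: Zl_def reflect_op_def t line_op_true amp_def algebra_simps)
  have "?G (single (0 + length ws)) = 0"
    by (rule state_vec_support[where j = "length ws"]) (auto simp: single_def)
  then have "laurent_deg (length ws - 1) (\<lambda>x. line_op 0 ws x ?G (single 0))"
    using False by (rule laurent_line_op_single)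
  from laurent_deg_mult[OF laurent_deg_sigma_sq this]
  have "laurent_deg (Suc (length ws)) (\<lambda>x. sigma (q\<^sup>2 * x\<^sup>2) * line_op 0 ws x ?G (single 0))"
    using False by (cases ws) auto
  moreover have "laurent_deg (Suc (length ws)) (\<lambda>x. amp x * (\<Prod>w\<leftarrow>ws. wb (w * x)))"
    using laurent_deg_mult[OF laurent_amp laurent_deg_prod_list[of ws 1 "\<lambda>w x. wb (w * x)"]] laurent_wab by simp
  ultimately show ?thesis unfolding eq by (intro laurent_deg_add laurent_deg_cmult)
qed
end

context dsasm_weights begin

lemma wa_wb_zero_iff:
  assumes "w \<noteq> 0"
  shows "wa w = 0 \<longleftrightarrow> q ^ 4 * w\<^sup>2 = 1" "wb w = 0 \<longleftrightarrow> w\<^sup>2 = q ^ 4"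
proof -
  show "wa w = 0 \<longleftrightarrow> q ^ 4 * w\<^sup>2 = 1"
    unfolding wa_def using assms q_nz by (subst sh_zero_iff) (auto simp: power_mult_distrib simp flip: power_mult)
  have "wb w = 0 \<longleftrightarrow> (q\<^sup>2 * inverse w)\<^sup>2 = 1"
    unfolding wb_def using assms q_nz by (subst sh_zero_iff) auto
  also have "\<dots> \<longleftrightarrow> w\<^sup>2 = q ^ 4"
    using assms by (auto simp: field_simps power2_eq_square power4_eq_xxxx)
  finally show "wb w = 0 \<longleftrightarrow> w\<^sup>2 = q ^ 4" .
qed

lemma zfun_Suc: "zfun (Suc n) u = Zl (u (Suc n) # rev (map u [1..<Suc n]))"
  by (simp add: zfun_def)

lemma prod_list_rev_map: "(\<Prod>w\<leftarrow>rev (map u [1..<Suc n]). g w) = (\<Prod>i=1..n. g (u i) :: 'a)"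
proof -
  have "(\<Prod>w\<leftarrow>rev (map u [1..<Suc n]). g w) = prod_list (map (\<lambda>i. g (u i)) [1..<Suc n])"
    by (simp only: rev_map[symmetric] prod_list.rev) (simp add: o_def)
  also have "\<dots> = (\<Prod>i=1..n. g (u i))"
    by (subst prod.distinct_set_conv_list[symmetric]) (auto intro: prod.cong)
  finally show ?thesis .
qed

lemma generic_permute:
  assumes "generic n u" "t permutes {1..n}"
  shows "generic n (u \<circ> t)"
proof -
  have "t i \<in> {1..n}" if "i \<in> {1..n}" for i using assms(2) that by (meson permutes_in_image)
  moreover have "t i = t j \<longleftrightarrow> i = j" for i j using assms(2) by (meson permutes_inj injD)
  ultimately show ?thesis using assms(1) unfolding generic_def by (metis comp_apply)
qed

lemma generic_mono: "generic n u \<Longrightarrow> m \<le> n \<Longrightarrow> generic m u"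
  unfolding generic_def by auto

lemma generic_exchangeable: "generic n u \<Longrightarrow> exchangeable (set (rev (map u [1..<Suc n])))"
  using sh_one unfolding generic_def exchangeable_def by auto

lemma diff_prod_Suc: "diff_prod (Suc n) u = diff_prod n u * (\<Prod>i=1..n. sh (u i / u (Suc n)))"
  unfolding diff_prod_def by (rule prod_bulk_Suc)

lemma pair_wt_prod_Suc: "pair_wt_prod (Suc n) u = pair_wt_prod n u * (\<Prod>i=1..n. pair_wt (u i) (u (Suc n)))"
  unfolding pair_wt_prod_def by (rule prod_bulk_Suc)

lemma diff_prod_transpose:
  assumes "1 \<le> k" "k \<le> Suc n"
  shows "diff_prod (Suc n) (u \<circ> transpose (Suc n) k) = of_int (sign (transpose (Suc n) k)) * diff_prod (Suc n) u"
proof (cases "k = Suc n")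
  case False
  show ?thesis
    unfolding diff_prod_def o_def
  proof (subst prod_bulk_transpose[where e = "-1"])
    show "sh (u j / u i) = - 1 * sh (u i / u j)" for i j
      by (simp add: sh_inverse[of "u j"])
  qed (use False assms in \<open>auto simp: sign_swap_id\<close>)
qed simp

lemma pair_wt_prod_transpose:
  assumes "1 \<le> k" "k \<le> Suc n"
  shows "pair_wt_prod (Suc n) (u \<circ> transpose (Suc n) k) = pair_wt_prod (Suc n) u"
proof (cases "k = Suc n")
  case False
  show ?thesis
    unfolding pair_wt_prod_def o_def
  proof (subst prod_bulk_transpose[where e = 1])
    show "pair_wt (u j) (u i) = 1 * pair_wt (u i) (u j)" for i j
      by (simp add: pair_wt_commute[of "u j"])
  qed (use False assms in auto)
qed simp

text \<open>The two sides of the cleared identity as functions of the last variable \<open>x\<close>. In \<open>cleared_Pf\<close> the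
Pfaffian is replaced by its expansion along the column of \<open>x\<close>, with the denominator of each
term cancelled, so that it is defined also where the entries of that column have poles.\<close>

definition cleared_Z :: "nat \<Rightarrow> (nat \<Rightarrow> 'a) \<Rightarrow> 'a \<Rightarrow> 'a" where
  "cleared_Z N u x = diff_prod N u * (\<Prod>i=1..N. sh (u i / x)) * Zl (x # rev (map u [1..<Suc N]))"

definition cleared_Pf :: "nat \<Rightarrow> nat \<Rightarrow> (nat \<Rightarrow> 'a) \<Rightarrow> 'a \<Rightarrow> 'a" where
  "cleared_Pf a m u x =
     (let N = a + 2 * m in
      pair_wt_prod N u * (\<Sum>i\<in>{a..N}. of_int (sign (transpose N i)) *
        pf_block a m (\<lambda>j k. pf_entry u (transpose N i j) (transpose N i k)) *
        ((if i = 0 then amp x else sh (u i / x) * Z2 (u i) x) * (\<Prod>j\<in>{1..N} - {i}. pair_wt (u j) x))))"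

lemma cleared_Z_eval: "cleared_Z N u x = diff_prod (Suc N) (u(Suc N := x)) * zfun (Suc N) (u(Suc N := x))"
proof -
  have "diff_prod N (u(Suc N := x)) = diff_prod N u"
    unfolding diff_prod_def by (rule prod.cong) (auto simp: bulk_def)
  moreover have "rev (map (u(Suc N := x)) [1..<Suc N]) = rev (map u [1..<Suc N])" by simp
  ultimately show ?thesis
    by (simp only: cleared_Z_def diff_prod_Suc zfun_Suc fun_upd_same) simp
qed

lemma cleared_Pf_eval:
  assumes a: "a \<le> 1" and nz: "\<And>j. j \<in> {1..a + 2 * m} \<Longrightarrow> pair_wt (u j) x \<noteq> 0"
  shows "cleared_Pf a m u x = pair_wt_prod (Suc (a + 2 * m)) (u(Suc (a + 2 * m) := x)) *
     pf_block a (Suc m) (pf_entry (u(Suc (a + 2 * m) := x)))"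
proof -
  let ?N = "a + 2 * m"
  let ?v = "u(Suc ?N := x)"
  have "pair_wt_prod ?N ?v = pair_wt_prod ?N u"
    unfolding pair_wt_prod_def by (rule prod.cong) (auto simp: bulk_def)
  then have np: "pair_wt_prod (Suc ?N) ?v = pair_wt_prod ?N u * (\<Prod>j\<in>{1..?N}. pair_wt (u j) x)"
    by (simp add: pair_wt_prod_Suc)
  have "pf_block a (Suc m) (pf_entry ?v) = (\<Sum>i\<in>{a..?N}. of_int (sign (transpose ?N i)) * pf_entry ?v i (Suc ?N) *
       pf_block a m (\<lambda>x y. pf_entry ?v (transpose ?N i x) (transpose ?N i y)))"
    by (rule pf_block_expand) (rule pf_entry_skew)
  note ex = this
  have "pair_wt_prod (Suc ?N) ?v * pf_block a (Suc m) (pf_entry ?v) = pair_wt_prod ?N u *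
      (\<Sum>i\<in>{a..?N}. of_int (sign (transpose ?N i)) * (pf_entry ?v i (Suc ?N) * (\<Prod>j\<in>{1..?N}. pair_wt (u j) x)) *
       pf_block a m (\<lambda>x y. pf_entry ?v (transpose ?N i x) (transpose ?N i y)))"
    unfolding ex np sum_distrib_left by (simp only: mult_ac)
  also have "\<dots> = cleared_Pf a m u x"
    unfolding cleared_Pf_def Let_def
  proof (rule arg_cong2[where f = "(*)"], rule refl, rule sum.cong[OF refl])
    fix i assume i: "i \<in> {a..?N}"
    have T: "transpose ?N i j \<noteq> Suc ?N" if "j \<in> {a..<a + 2 * m}" for j
      using that i by (auto simp: transpose_def)
    have "pf_block a m (\<lambda>x y. pf_entry ?v (transpose ?N i x) (transpose ?N i y)) =
        pf_block a m (\<lambda>x y. pf_entry u (transpose ?N i x) (transpose ?N i y))"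
      by (rule pf_block_cong) (simp add: T pf_entry_def)
    moreover have "pf_entry ?v i (Suc ?N) * (\<Prod>j\<in>{1..?N}. pair_wt (u j) x) =
        (if i = 0 then amp x else sh (u i / x) * Z2 (u i) x) * (\<Prod>j\<in>{1..?N} - {i}. pair_wt (u j) x)"
    proof (cases "i = 0")
      case False
      then have "i \<in> {1..?N}" using i by auto
      then have "(\<Prod>j\<in>{1..?N}. pair_wt (u j) x) = pair_wt (u i) x * (\<Prod>j\<in>{1..?N} - {i}. pair_wt (u j) x)"
        by (subst prod.remove[where x = i]) auto
      then show ?thesis using False nz[OF \<open>i \<in> {1..?N}\<close>] i by (simp add: pf_entry_def)
    qed (simp add: pf_entry_def)
    ultimately show "of_int (sign (transpose ?N i)) * (pf_entry ?v i (Suc ?N) * (\<Prod>j\<in>{1..?N}. pair_wt (u j) x)) *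
       pf_block a m (\<lambda>x y. pf_entry ?v (transpose ?N i x) (transpose ?N i y)) =
       of_int (sign (transpose ?N i)) *
        pf_block a m (\<lambda>j k. pf_entry u (transpose ?N i j) (transpose ?N i k)) *
        ((if i = 0 then amp x else sh (u i / x) * Z2 (u i) x) * (\<Prod>j\<in>{1..?N} - {i}. pair_wt (u j) x))"
      by (simp only: mult_ac)
  qed
  finally show ?thesis ..
qed

lemma laurent_cleared_Z: "laurent_deg (2 * N + 1) (cleared_Z N u)"
proof -
  have A: "laurent_deg (card {1..N} * 1) (\<lambda>x. \<Prod>i=1..N. sh (u i / x))"
    by (rule laurent_deg_prod) (auto intro: laurent_wab(3)[unfolded One_nat_def])
  have "laurent_deg (card {1..N} * 1 + Suc (length (rev (map u [1..<Suc N])))) 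
     (\<lambda>x. (\<Prod>i=1..N. sh (u i / x)) * Zl (x # rev (map u [1..<Suc N])))"
    by (rule laurent_deg_mult[OF A laurent_Zl])
  from laurent_deg_cmult[OF this, of "diff_prod N u"] show ?thesis
    unfolding cleared_Z_def by (simp add: mult.assoc mult_2 del: upt_Suc)
qed

lemma laurent_cleared_Pf:
  assumes "a \<le> 1"
  shows "laurent_deg (2 * (a + 2 * m) + 1) (cleared_Pf a m u)"
proof -
  let ?N = "a + 2 * m"
  have P: "laurent_deg (card S * 2) (\<lambda>x. \<Prod>j\<in>S. pair_wt (u j) x)" if "finite S" for S
    by (rule laurent_deg_prod[OF that laurent_pair_wt])
  have D: "laurent_deg (2 * ?N + 1) (\<lambda>x. (if i = 0 then amp x else sh (u i / x) * Z2 (u i) x) * (\<Prod>j\<in>{1..?N} - {i}. pair_wt (u j) x))"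
    if "i \<in> {a..?N}" for i
  proof (cases "i = 0")
    case True
    then show ?thesis using laurent_deg_mult[OF laurent_amp P[of "{1..?N} - {i}"]] by (simp add: mult.commute)
  next
    case False
    then have "card ({1..?N} - {i}) = ?N - 1" "?N \<ge> 1" using that by auto
    then have eq: "1 + 2 + card ({1..?N} - {i}) * 2 = 2 * ?N + 1" by simp
    with False show ?thesis
      using laurent_deg_mult[OF laurent_deg_mult[OF laurent_wab(3)[of "u i"] laurent_Z2[of "u i"]] P[of "{1..?N} - {i}"]]
      by (simp only: eq if_False finite_Diff finite_atLeastAtMost)
  qed
  show ?thesis unfolding cleared_Pf_def Let_def
    by (intro laurent_deg_cmult laurent_deg_sum D)
qed

section \<open>Interpolation\<close>

text \<open>At \<open>x = u k\<close> the first side contains the factor \<open>sigma_hat (u k / x) = 0\<close>, and on the other side two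
rows of the Pfaffian coincide.\<close>

lemma agree_at_equal_variables:
  assumes gen: "generic (a + 2 * m) u" and a: "a \<le> 1" and k: "k \<in> {1..a + 2 * m}"
  shows "cleared_Z (a + 2 * m) u (u k) = cleared_Pf a m u (u k)"
proof -
  let ?N = "a + 2 * m"
  let ?v = "u(Suc ?N := u k)"
  have "(\<Prod>i=1..?N. sh (u i / u k)) = 0"
    using k gen by (intro prod_zero) (auto simp: generic_def sigma_hat_def sigma_def intro!: bexI[of _ k])
  then have "cleared_Z ?N u (u k) = 0" by (simp add: cleared_Z_def)
  moreover have "pf_block a (Suc m) (pf_entry ?v) = 0"
  proof (rule pf_block_equal_rows[where i = k and j = "Suc ?N"])
    fix x y
    have "?v (transpose k (Suc ?N) z) = ?v z" "transpose k (Suc ?N) z = 0 \<longleftrightarrow> z = 0" for z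
      using k by (auto simp: transpose_def)
    then show "pf_entry ?v (transpose k (Suc ?N) x) (transpose k (Suc ?N) y) = pf_entry ?v x y"
      by (simp add: pf_entry_def)
  qed (use a k in auto)
  then have "cleared_Pf a m u (u k) = 0"
    using gen k by (subst cleared_Pf_eval[OF a]) (auto simp: generic_def)
  ultimately show ?thesis by simp
qed

text \<open>Here \<open>pair_wt (u k) x = 0\<close>, so only the term \<open>k\<close> of the expansion survives. Let \<open>v\<close> be \<open>u\<close> with \<open>u k\<close>
moved to the last place; symmetry of \<open>Z\<close> and antisymmetry of \<open>diff_prod\<close> reduce the first side to the frozen
evaluation. The remaining factors agree for each other variable \<open>w\<close> separately (the fact \<open>key\<close>), because the
relation between \<open>u k\<close> and \<open>x\<close> turns \<open>w / x\<close> into \<open>q\<^sup>\<plusminus>\<^sup>2 w u\<^sub>k\<close>.\<close>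

lemma agree_at_frozen_points:
  assumes gen: "generic (Suc N) u" and aN: "Suc N = a + 2 * m" and a: "a \<le> 1" and k: "k \<in> {1..Suc N}"
    and x: "u k * x = q\<^sup>2 \<or> u k * x = inverse (q\<^sup>2)"
    and IH: "\<And>v. generic N v \<Longrightarrow> diff_prod N v * zfun N v = pair_wt_prod N v * pf_block a m (pf_entry v)"
  shows "cleared_Z (Suc N) u x = cleared_Pf a m u x"
proof -
  let ?T = "transpose (Suc N) k" and ?n = "Suc N"
  define v where "v = u \<circ> ?T"
  have Tp: "?T permutes {1..?n}" using k by (intro permutes_swap_id) auto
  have gv: "generic ?n v" unfolding v_def by (rule generic_permute[OF gen Tp])
  have vn: "v ?n = u k" by (simp add: v_def)
  define e :: 'a where "e = of_int (sign ?T)"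
  have e2: "e * e = 1" unfolding e_def by (simp flip: of_int_mult add: sign_idempotent)
  have nz: "u k \<noteq> 0" "x \<noteq> 0" using x q_nz by auto
  have vnz: "v i \<noteq> 0" if "i \<in> {1..N}" for i using gv that by (auto simp: generic_def)
  have numk: "pair_wt (u k) x = 0"
    using x wa_wb_zero_iff[of "u k * x"] nz q_nz
    by (auto simp: pair_wt_def power_inverse simp flip: power_mult)
  let ?ws = "rev (map v [1..<Suc N])"
  \<comment> \<open>The weight that survives freezing at the two kinds of points.\<close>
  define p where "p w = (if u k * x = q\<^sup>2 then wa w else wb w)" for w
  have set_u: "mset (rev (map u [1..<Suc ?n])) = mset (rev (map v [1..<Suc ?n]))"
  proof -
    have m: "mset (rev (map w [1..<Suc ?n])) = image_mset w (mset_set {1..?n})" for w :: "nat \<Rightarrow> 'a"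
      by (simp only: mset_rev mset_map mset_upt atLeastLessThanSuc_atLeastAtMost)
    have "image_mset v (mset_set {1..?n}) = image_mset u (image_mset ?T (mset_set {1..?n}))"
      by (simp add: v_def multiset.map_comp)
    also have "image_mset ?T (mset_set {1..?n}) = mset_set {1..?n}"
      using image_mset_mset_set[OF permutes_inj_on[OF Tp, of "{1..?n}"]] permutes_image[OF Tp] by simp
    finally show ?thesis by (simp only: m)
  qed
  have "Zl (x # rev (map u [1..<Suc ?n])) = Zl ([x] @ rev (map v [1..<Suc ?n]))"
    using Zl_perm[OF generic_exchangeable[OF gen] _ set_u, of "[x]"] nz by simp
  also have "\<dots> = Zl (x # u k # ?ws)" by (simp add: vn)
  also have "\<dots> = Z2 (u k) x * (\<Prod>w\<leftarrow>?ws. p (w * u k) * p (w * x)) * Zl ?ws"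
  proof (cases "u k * x = q\<^sup>2")
    case True
    have "exchangeable (set (u k # ?ws))"
      using generic_exchangeable[OF gv] vn by simp
    from Zl_perm[OF this, of "[x]" "?ws @ [u k]"] nz
    have "Zl (x # u k # ?ws) = Zl (x # ?ws @ [u k])" by simp
    moreover have "p = wa" using True by (simp add: p_def fun_eq_iff)
    ultimately show ?thesis by (simp only: Zl_freeze_plus[OF True])
  next
    case False
    then have "u k * x = inverse (q\<^sup>2)" using x by auto
    moreover have "p = wb" using False by (simp add: p_def fun_eq_iff)
    ultimately show ?thesis by (simp only: Zl_freeze_minus)
  qed
  also have "\<dots> = Z2 (u k) x * (\<Prod>i=1..N. p (v i * u k) * p (v i * x)) * zfun N v"
    by (simp only: prod_list_rev_map zfun_def)
  finally have Z: "Zl (x # rev (map u [1..<Suc ?n])) = \<dots>" .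
  have perm_prod: "(\<Prod>i=1..?n. g (u i)) = g (u k) * (\<Prod>i=1..N. g (v i))" for g :: "'a \<Rightarrow> 'a"
  proof -
    have "(\<Prod>i=1..?n. g (u i)) = (\<Prod>i=1..?n. g (v i))"
      using prod.permute[OF Tp, of "\<lambda>i. g (u i)"] by (simp add: v_def o_def)
    then show ?thesis by (simp add: vn mult.commute)
  qed
  have rest_prod: "(\<Prod>i\<in>{1..?n} - {k}. g (u i)) = (\<Prod>i=1..N. g (v i))" for g :: "'a \<Rightarrow> 'a"
  proof (rule prod.reindex_bij_witness[where i = ?T and j = ?T])
    fix i assume "i \<in> {1..?n} - {k}"
    then show "?T i \<in> {1..N}" "g (v (?T i)) = g (u i)"
      using k by (auto simp: transpose_def v_def)
  next
    fix i assume "i \<in> {1..N}"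
    then show "?T i \<in> {1..?n} - {k}" using k by (auto simp: transpose_def)
  qed auto
  have diff_prod: "diff_prod ?n u = e * diff_prod N v * (\<Prod>i=1..N. sh (v i / u k))"
  proof -
    have "diff_prod ?n v = e * diff_prod ?n u" unfolding v_def e_def by (rule diff_prod_transpose) (use k in auto)
    then have "diff_prod ?n u = e * diff_prod ?n v" using e2 by (simp add: mult.assoc[symmetric])
    then show ?thesis by (simp add: diff_prod_Suc vn mult.assoc)
  qed
  have npr: "pair_wt_prod ?n u = pair_wt_prod N v * (\<Prod>i=1..N. pair_wt (v i) (u k))"
    using pair_wt_prod_transpose[of k N u] k by (simp add: pair_wt_prod_Suc vn flip: v_def)
  have key: "sh (w / u k) * sh (w / x) * (p (w * u k) * p (w * x)) = pair_wt w (u k) * pair_wt w x"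
    if "w \<noteq> 0" for w
  proof (cases "u k * x = q\<^sup>2")
    case True
    have "w / u k = inverse (q\<^sup>2 * inverse (w * x))" "w / x = inverse (q\<^sup>2 * inverse (w * u k))"
      using True nz that q_nz by (auto simp: field_simps)
    then have "sh (w / u k) = - wb (w * x)" "sh (w / x) = - wb (w * u k)"
      by (simp_all add: wb_def sigma_hat_def sigma_def minus_divide_left)
    then show ?thesis using True by (simp add: p_def pair_wt_def)
  next
    case False
    then have "u k * x = inverse (q\<^sup>2)" using x by auto
    then have "w / u k = q\<^sup>2 * (w * x)" "w / x = q\<^sup>2 * (w * u k)"
      using nz q_nz by (auto simp: field_simps)
    then have "sh (w / u k) = wa (w * x)" "sh (w / x) = wa (w * u k)"
      by (simp_all add: wa_def)
    then show ?thesis using False by (simp add: p_def pair_wt_def)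
  qed
  have keyp: "(\<Prod>i=1..N. sh (v i / u k)) * (\<Prod>i=1..N. sh (v i / x)) * (\<Prod>i=1..N. p (v i * u k) * p (v i * x))
      = (\<Prod>i=1..N. pair_wt (v i) (u k)) * (\<Prod>i=1..N. pair_wt (v i) x)"
    unfolding prod.distrib[symmetric] by (rule prod.cong[OF refl], rule key, rule vnz)
  \<comment> \<open>Two lines fewer: the induction hypothesis applies to \<open>v\<close> without \<open>u k\<close>.\<close>
  have IHv: "diff_prod N v * zfun N v = pair_wt_prod N v * pf_block a m (pf_entry v)"
    by (rule IH) (rule generic_mono[OF gv], simp)
  have L: "cleared_Z ?n u x = e * (sh (u k / x) * Z2 (u k) x) * (diff_prod N v * zfun N v) *
     ((\<Prod>i=1..N. sh (v i / u k)) * (\<Prod>i=1..N. sh (v i / x)) * (\<Prod>i=1..N. p (v i * u k) * p (v i * x)))"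
  proof -
    have regroup: "e' * V * P1 * (s * P2) * (z * P3 * y) = e' * (s * z) * (V * y) * (P1 * P2 * P3)"
      for e' V P1 s P2 z P3 y :: 'a by (simp only: mult_ac)
    have "cleared_Z ?n u x = (e * diff_prod N v * (\<Prod>i=1..N. sh (v i / u k))) *
        (sh (u k / x) * (\<Prod>i=1..N. sh (v i / x))) *
        (Z2 (u k) x * (\<Prod>i=1..N. p (v i * u k) * p (v i * x)) * zfun N v)"
    proof -
      have pp: "(\<Prod>i=1..?n. sh (u i / x)) = sh (u k / x) * (\<Prod>i=1..N. sh (v i / x))"
        by (rule perm_prod)
      have "cleared_Z ?n u x = diff_prod ?n u * (\<Prod>i=1..?n. sh (u i / x)) * Zl (x # rev (map u [1..<Suc ?n]))"
        by (rule cleared_Z_def)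
      also have "\<dots> = (e * diff_prod N v * (\<Prod>i=1..N. sh (v i / u k))) * (sh (u k / x) * (\<Prod>i=1..N. sh (v i / x))) * Zl (x # rev (map u [1..<Suc ?n]))"
        by (simp only: diff_prod pp)
      also note Z
      finally show ?thesis .
    qed
    then show ?thesis by (rule trans) (rule regroup)
  qed
  have T0: "?T i = 0 \<longleftrightarrow> i = 0" for i using k by (auto simp: transpose_def)
  have "(\<Sum>i\<in>{a..?n}. of_int (sign (transpose ?n i)) *
        pf_block a m (\<lambda>j l. pf_entry u (transpose ?n i j) (transpose ?n i l)) *
        ((if i = 0 then amp x else sh (u i / x) * Z2 (u i) x) * (\<Prod>j\<in>{1..?n} - {i}. pair_wt (u j) x))) =
     (\<Sum>i\<in>{k}. of_int (sign (transpose ?n i)) *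
        pf_block a m (\<lambda>j l. pf_entry u (transpose ?n i j) (transpose ?n i l)) *
        ((if i = 0 then amp x else sh (u i / x) * Z2 (u i) x) * (\<Prod>j\<in>{1..?n} - {i}. pair_wt (u j) x)))"
  proof (rule sum.mono_neutral_right)
    show "\<forall>i\<in>{a..?n} - {k}. of_int (sign (transpose ?n i)) *
        pf_block a m (\<lambda>j l. pf_entry u (transpose ?n i j) (transpose ?n i l)) *
        ((if i = 0 then amp x else sh (u i / x) * Z2 (u i) x) * (\<Prod>j\<in>{1..?n} - {i}. pair_wt (u j) x)) = 0"
    proof
      fix i assume "i \<in> {a..?n} - {k}"
      then have "(\<Prod>j\<in>{1..?n} - {i}. pair_wt (u j) x) = 0"
        using k numk by (intro prod_zero) auto
      then show "of_int (sign (transpose ?n i)) *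
        pf_block a m (\<lambda>j l. pf_entry u (transpose ?n i j) (transpose ?n i l)) *
        ((if i = 0 then amp x else sh (u i / x) * Z2 (u i) x) * (\<Prod>j\<in>{1..?n} - {i}. pair_wt (u j) x)) = 0"
        by (simp only: mult_zero_right)
    qed
  qed (use k a in auto)
  also have "\<dots> = e * pf_block a m (\<lambda>j l. pf_entry u (?T j) (?T l)) *
      ((sh (u k / x) * Z2 (u k) x) * (\<Prod>i=1..N. pair_wt (v i) x))"
    using k rest_prod[of "\<lambda>w. pair_wt w x"] by (simp add: e_def)
  also have "(\<lambda>j l. pf_entry u (?T j) (?T l)) = pf_entry v"
    by (intro ext) (simp add: pf_entry_def v_def T0)
  finally have R: "cleared_Pf a m u x = e * (sh (u k / x) * Z2 (u k) x) * (pair_wt_prod N v * pf_block a m (pf_entry v)) *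
     ((\<Prod>i=1..N. pair_wt (v i) (u k)) * (\<Prod>i=1..N. pair_wt (v i) x))"
    unfolding cleared_Pf_def Let_def aN[symmetric] npr by (simp only: mult_ac)
  show ?thesis by (simp only: L R IHv keyp)
qed

text \<open>The squares of the points are \<open>u\<^sub>k\<^sup>2\<close> and \<open>q\<^sup>\<plusminus>\<^sup>4 / u\<^sub>k\<^sup>2\<close>. The last two differ for the same \<open>k\<close> because
\<open>sigma (q ^ 4) \<noteq> 0\<close> means \<open>q\<^sup>8 \<noteq> 1\<close>.\<close>

lemma special_points_card:
  assumes gen: "generic N u"
  defines "X \<equiv> (\<Union>k\<in>{1..N}. {u k, q\<^sup>2 / u k, inverse (q\<^sup>2) / u k})"
  shows "card ((\<lambda>x. x\<^sup>2) ` X) = 3 * N"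
proof -
  define A B C where "A k = (u k)\<^sup>2" and "B k = q ^ 4 / (u k)\<^sup>2" and "C k = 1 / (q ^ 4 * (u k)\<^sup>2)" for k
  let ?S = "{1..N}"
  have nz: "u i \<noteq> 0" if "i \<in> ?S" for i using gen that by (simp add: generic_def)
  have ne: "(u i)\<^sup>2 \<noteq> (u j)\<^sup>2" if "i \<in> ?S" "j \<in> ?S" "i \<noteq> j" for i j
    using gen that by (simp add: generic_def)
  have nw: "q ^ 4 * ((u i)\<^sup>2 * (u j)\<^sup>2) \<noteq> 1" "(u i)\<^sup>2 * (u j)\<^sup>2 \<noteq> q ^ 4" if "i \<in> ?S" "j \<in> ?S" for i j
  proof -
    have "wa (u i * u j) \<noteq> 0" "wb (u i * u j) \<noteq> 0"
      using gen that by (auto simp: generic_def pair_wt_def)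
    then show "q ^ 4 * ((u i)\<^sup>2 * (u j)\<^sup>2) \<noteq> 1" "(u i)\<^sup>2 * (u j)\<^sup>2 \<noteq> q ^ 4"
      using wa_wb_zero_iff[of "u i * u j"] nz that by (auto simp: power_mult_distrib)
  qed
  have ns: "q ^ 8 * (u i)\<^sup>2 \<noteq> (u j)\<^sup>2" if "i \<in> ?S" "j \<in> ?S" for i j
  proof -
    have "sh (q ^ 4 * (u i / u j)) \<noteq> 0" using gen that unfolding generic_def by blast
    moreover have "q ^ 4 * (u i / u j) \<noteq> 0" using nz that q_nz by simp
    ultimately have "(q ^ 4 * (u i / u j))\<^sup>2 \<noteq> 1" using sh_zero_iff by blast
    then show ?thesis using nz[OF that(2)]
      by (auto simp: power_mult_distrib power_divide field_simps simp flip: power_mult)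
  qed
  have eq: "(\<lambda>x. x\<^sup>2) ` X = A ` ?S \<union> (B ` ?S \<union> C ` ?S)"
    unfolding X_def A_def B_def C_def
    by (auto simp: image_Un image_UN power_divide power_mult_distrib power_inverse divide_inverse simp flip: power_mult)
  have iA: "inj_on A ?S" and iB: "inj_on B ?S" and iC: "inj_on C ?S"
    using ne nz q_nz by (auto simp: inj_on_def A_def B_def C_def field_simps) (metis One_nat_def atLeastAtMost_iff)+
  have "A i \<noteq> B j" "A i \<noteq> C j" "B i \<noteq> C j" if "i \<in> ?S" "j \<in> ?S" for i j
    using nw[OF that] ns[OF that(2) that(1)] nz[OF that(1)] nz[OF that(2)] q_nz
    by (auto simp: A_def B_def C_def field_simps simp flip: power_add)
  then have dis: "A ` ?S \<inter> (B ` ?S \<union> C ` ?S) = {}" "B ` ?S \<inter> C ` ?S = {}" by blast+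
  have "card (B ` ?S \<union> C ` ?S) = N + N"
    by (subst card_Un_disjoint) (use dis card_image[OF iB] card_image[OF iC] in auto)
  then show ?thesis unfolding eq
    by (subst card_Un_disjoint) (use dis card_image[OF iA] in auto)
qed

text \<open>With \<open>Suc N\<close> variables besides \<open>x\<close> the degree is \<open>2 * Suc N + 1\<close>, and the \<open>3 * Suc N\<close> points exceed it
as soon as \<open>N \<ge> 1\<close>.\<close>

lemma generic_step:
  assumes gen: "generic (Suc N) u" and aN: "Suc N = a + 2 * m" and a: "a \<le> 1" and N: "N \<ge> 1"
    and IH: "\<And>v. generic N v \<Longrightarrow> diff_prod N v * zfun N v = pair_wt_prod N v * pf_block a m (pf_entry v)"
    and x: "x \<noteq> 0"
  shows "cleared_Z (Suc N) u x = cleared_Pf a m u x"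
proof -
  define X where "X = (\<Union>k\<in>{1..Suc N}. {u k, q\<^sup>2 / u k, inverse (q\<^sup>2) / u k})"
  have nz: "u i \<noteq> 0" if "i \<in> {1..Suc N}" for i using gen that by (simp add: generic_def)
  show ?thesis
  proof (rule laurent_deg_eqI[where d = "2 * Suc N + 1" and X = X and f = "cleared_Z (Suc N) u" and g = "cleared_Pf a m u"])
    show "laurent_deg (2 * Suc N + 1) (cleared_Z (Suc N) u)" by (rule laurent_cleared_Z)
    show "laurent_deg (2 * Suc N + 1) (cleared_Pf a m u)" unfolding aN by (rule laurent_cleared_Pf[OF a])
    show "finite X" by (simp add: X_def)
    show "0 \<notin> X" using nz q_nz by (auto simp: X_def)
    show "card ((\<lambda>x. x\<^sup>2) ` X) > 2 * Suc N + 1"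
      using special_points_card[OF gen] N by (simp add: X_def)
    fix y assume "y \<in> X"
    then obtain k where k: "k \<in> {1..Suc N}" and "y = u k \<or> y = q\<^sup>2 / u k \<or> y = inverse (q\<^sup>2) / u k"
      by (auto simp: X_def)
    then consider "y = u k" | "u k * y = q\<^sup>2 \<or> u k * y = inverse (q\<^sup>2)"
      using nz[OF k] by auto
    then show "cleared_Z (Suc N) u y = cleared_Pf a m u y"
    proof cases
      case 1
      then show ?thesis using agree_at_equal_variables[of a m u k] gen a k by (simp add: aN)
    next
      case 2
      then show ?thesis using agree_at_frozen_points[OF gen aN a k _ IH] by blast
    qed
  qed (rule x)
qed

theorem pfaffian_generic:
  assumes "n \<ge> 1" "generic n u" "Suc n = a + 2 * m" "a \<le> 1"
  shows "diff_prod n u * zfun n u = pair_wt_prod n u * pf_block a m (pf_entry u)"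
  using assms
proof (induction n arbitrary: u m rule: less_induct)
  case (less n)
  show ?case
  proof (cases "n \<ge> 3")
    case True
    then obtain N where n: "n = Suc (Suc N)" "N \<ge> 1" by (metis Suc_le_D Suc_le_mono numeral_3_eq_3 One_nat_def)
    obtain m' where m: "m = Suc m'" using less.prems n by (cases m) auto
    have aN: "Suc N = a + 2 * m'" using less.prems n m by simp
    have "diff_prod N v * zfun N v = pair_wt_prod N v * pf_block a m' (pf_entry v)" if "generic N v" for v
      by (rule less.IH) (use n that aN less.prems in auto)
    moreover have g: "generic (Suc N) u" by (rule generic_mono[OF less.prems(2)]) (simp add: n)
    moreover have "u n \<noteq> 0" using less.prems(2) n by (simp add: generic_def)
    ultimately have "cleared_Z (Suc N) u (u n) = cleared_Pf a m' u (u n)"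
      using generic_step[OF _ aN less.prems(4) n(2)] by blast
    moreover have "cleared_Z (Suc N) u (u n) = diff_prod n u * zfun n u"
      unfolding cleared_Z_eval n(1)[symmetric] by simp
    moreover have "cleared_Pf a m' u (u n) = pair_wt_prod n u * pf_block a m (pf_entry u)"
    proof -
      have nn: "Suc (a + 2 * m') = n" using aN n by simp
      have "pair_wt (u j) (u n) \<noteq> 0" if "j \<in> {1..a + 2 * m'}" for j
        using less.prems(2) that nn unfolding generic_def by auto
      from cleared_Pf_eval[of a m' u "u n", OF less.prems(4) this]
      show ?thesis unfolding nn m by (simp only: fun_upd_triv)
    qed
    ultimately show ?thesis by simp
  next
    case False
    then consider "n = 1" | "n = 2" using less.prems(1) by linarith
    then show ?thesis
    proof cases
      case 1
      then have [simp]: "a = 0" "m = Suc 0" using less.prems(3,4) by presburger+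
      have "pf_block 0 (Suc 0) (pf_entry u) = pf_entry u 0 1"
        using pf_block_expand[of "pf_entry u" 0 0, OF pf_entry_skew]
        by (simp add: pf_block_0)
      moreover have "pf_entry u 0 1 = amp (u 1)" by (simp add: pf_entry_def)
      ultimately show ?thesis using 1
        by (simp add: zfun_def Zl_one diff_prod_def pair_wt_prod_def)
    next
      case 2
      then have [simp]: "a = 1" "m = Suc 0" using less.prems(3,4) by presburger+
      have "pair_wt (u 1) (u 2) \<noteq> 0" using less.prems(2) 2 by (simp add: generic_def)
      moreover have "[Suc 0..<3] = [1, 2]" by (simp add: upt_rec)
      moreover have "pf_block 1 (Suc 0) (pf_entry u) = sh (u 1 / u 2) * Z2 (u 1) (u 2) / pair_wt (u 1) (u 2)"
        using pf_block_expand[of "pf_entry u" 1 0, OF pf_entry_skew]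
        by (simp add: pf_block_0 numeral_2_eq_2) (simp add: pf_entry_def)
      moreover have "diff_prod 2 u = sh (u 1 / u 2)" "pair_wt_prod 2 u = pair_wt (u 1) (u 2)"
        using diff_prod_Suc[of 1 u] pair_wt_prod_Suc[of 1 u] by (simp_all add: diff_prod_def pair_wt_prod_def numeral_2_eq_2)
      ultimately show ?thesis using 2
        by (simp add: zfun_def Zl_two)
    qed
  qed
qed
end

section \<open>Removing the genericity assumption\<close>

text \<open>Rational functions of \<open>s\<close> that are regular at \<open>s = 1\<close>, given by an equation with denominator \<open>r\<close>
that holds wherever \<open>r\<close> does not vanish.\<close>

definition regular1 :: "('a::field_char_0 \<Rightarrow> 'a) \<Rightarrow> bool" where
  "regular1 f \<longleftrightarrow> (\<exists>p r. poly r 1 \<noteq> 0 \<and> (\<forall>s. poly r s \<noteq> 0 \<longrightarrow> f s * poly r s = poly p s))"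

lemma regular1_poly: "regular1 (poly p)"
  unfolding regular1_def by (intro exI[of _ p] exI[of _ 1]) simp

lemma regular1_const: "regular1 (\<lambda>_. c)"
proof -
  have "(\<lambda>_. c) = poly [:c:]" by auto
  then show ?thesis by (metis regular1_poly)
qed

lemma regular1_monomial: "regular1 (\<lambda>s. c * s ^ k)"
proof -
  have "(\<lambda>s. c * s ^ k) = poly (monom c k)" by (auto simp: poly_monom)
  then show ?thesis by (metis regular1_poly)
qed

lemma regular1_add:
  assumes "regular1 f" "regular1 g" shows "regular1 (\<lambda>s. f s + g s)"
proof -
  obtain p r where p: "poly r 1 \<noteq> 0" "\<And>s. poly r s \<noteq> 0 \<Longrightarrow> f s * poly r s = poly p s"
    using assms(1) unfolding regular1_def by blast
  obtain p' r' where p': "poly r' 1 \<noteq> 0" "\<And>s. poly r' s \<noteq> 0 \<Longrightarrow> g s * poly r' s = poly p' s"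
    using assms(2) unfolding regular1_def by blast
  have "(f s + g s) * poly (r * r') s = poly (p * r' + p' * r) s" if "poly (r * r') s \<noteq> 0" for s
  proof -
    have "f s * poly r s = poly p s" "g s * poly r' s = poly p' s" using p p' that by auto
    then show ?thesis by (simp add: algebra_simps flip: \<open>f s * poly r s = poly p s\<close> \<open>g s * poly r' s = poly p' s\<close>)
  qed
  moreover have "poly (r * r') 1 \<noteq> 0" using p p' by simp
  ultimately show ?thesis unfolding regular1_def by blast
qed

lemma regular1_mult:
  assumes "regular1 f" "regular1 g" shows "regular1 (\<lambda>s. f s * g s)"
proof -
  obtain p r where p: "poly r 1 \<noteq> 0" "\<And>s. poly r s \<noteq> 0 \<Longrightarrow> f s * poly r s = poly p s"
    using assms(1) unfolding regular1_def by blast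
  obtain p' r' where p': "poly r' 1 \<noteq> 0" "\<And>s. poly r' s \<noteq> 0 \<Longrightarrow> g s * poly r' s = poly p' s"
    using assms(2) unfolding regular1_def by blast
  have "(f s * g s) * poly (r * r') s = poly (p * p') s" if "poly (r * r') s \<noteq> 0" for s
  proof -
    have "f s * poly r s = poly p s" "g s * poly r' s = poly p' s" using p p' that by auto
    then show ?thesis by (simp add: algebra_simps flip: \<open>f s * poly r s = poly p s\<close> \<open>g s * poly r' s = poly p' s\<close>)
  qed
  moreover have "poly (r * r') 1 \<noteq> 0" using p p' by simp
  ultimately show ?thesis unfolding regular1_def by blast
qed

lemma regular1_inverse:
  assumes "regular1 f" "f 1 \<noteq> 0" shows "regular1 (\<lambda>s. inverse (f s))"
proof -
  obtain p r where r: "poly r 1 \<noteq> 0" "\<And>s. poly r s \<noteq> 0 \<Longrightarrow> f s * poly r s = poly p s"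
    using assms unfolding regular1_def by metis
  have "poly p 1 \<noteq> 0" using r assms(2) by (metis mult_eq_0_iff)
  moreover have "inverse (f s) * (poly p s * poly r s) = poly r s * poly r s"
    if "poly p s \<noteq> 0" "poly r s \<noteq> 0" for s
  proof -
    have "f s * poly r s = poly p s" using r(2) that(2) .
    moreover from this have "f s \<noteq> 0" using that(1) by auto
    ultimately show ?thesis by (simp add: field_simps flip: \<open>f s * poly r s = poly p s\<close>)
  qed
  ultimately show ?thesis unfolding regular1_def using r(1)
    by (intro exI[of _ "r * r"] exI[of _ "p * r"]) auto
qed

lemma regular1_divide:
  "regular1 f \<Longrightarrow> regular1 g \<Longrightarrow> g 1 \<noteq> 0 \<Longrightarrow> regular1 (\<lambda>s. f s / g s)"
  unfolding divide_inverse by (intro regular1_mult regular1_inverse)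

lemma regular1_minus: "regular1 f \<Longrightarrow> regular1 (\<lambda>s. - f s)"
  using regular1_mult[OF regular1_const[of "-1"]] by simp

lemma regular1_diff: "regular1 f \<Longrightarrow> regular1 g \<Longrightarrow> regular1 (\<lambda>s. f s - g s)"
  using regular1_add[OF _ regular1_minus] by simp

lemma regular1_sum: "(\<And>i. i \<in> S \<Longrightarrow> regular1 (f i)) \<Longrightarrow> regular1 (\<lambda>s. \<Sum>i\<in>S. f i s)"
  by (induction S rule: infinite_finite_induct) (auto simp: regular1_const regular1_add)

lemma regular1_prod: "(\<And>i. i \<in> S \<Longrightarrow> regular1 (f i)) \<Longrightarrow> regular1 (\<lambda>s. \<Prod>i\<in>S. f i s)"
  by (induction S rule: infinite_finite_induct) (auto simp: regular1_const regular1_mult)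

lemma regular1_power: "regular1 f \<Longrightarrow> regular1 (\<lambda>s. f s ^ k)"
  by (induction k) (auto simp: regular1_const regular1_mult)

text \<open>A field of characteristic \<open>0\<close> is infinite, so the numerator has infinitely many zeros and is zero.\<close>

lemma regular1_zero:
  assumes "regular1 f" "finite B" "\<And>s. s \<notin> B \<Longrightarrow> f s = 0"
  shows "f 1 = 0"
proof -
  obtain p r where r: "poly r 1 \<noteq> 0" "\<And>s. poly r s \<noteq> 0 \<Longrightarrow> f s * poly r s = poly p s"
    using assms unfolding regular1_def by metis
  have "r \<noteq> 0" using r(1) by auto
  have "p = 0"
  proof (rule ccontr)
    assume "p \<noteq> 0"
    have "UNIV \<subseteq> B \<union> {s. poly r s = 0} \<union> {s. poly p s = 0}"
    proof
      fix s
      show "s \<in> B \<union> {s. poly r s = 0} \<union> {s. poly p s = 0}"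
        using r(2)[of s] assms(3)[of s] by (cases "s \<in> B"; cases "poly r s = 0") auto
    qed
    moreover have "finite (B \<union> {s. poly r s = 0} \<union> {s. poly p s = 0})"
      using assms(2) poly_roots_finite \<open>p \<noteq> 0\<close> \<open>r \<noteq> 0\<close> by blast
    ultimately show False using infinite_UNIV_char_0 finite_subset by blast
  qed
  then show ?thesis using r by (metis mult_eq_0_iff poly_0)
qed

lemma finite_monomial_eq:
  assumes "k \<noteq> l" "c \<noteq> 0"
  shows "finite {s::'a::field_char_0. c * s ^ k = d * s ^ l}"
proof -
  have "coeff (monom c k - monom d l) k \<noteq> 0" using assms by simp
  then have "monom c k - monom d l \<noteq> 0" by (metis coeff_0)
  from poly_roots_finite[OF this] show ?thesis by (simp add: poly_monom)
qed

lemma regular1_pf_block: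
  assumes "\<And>i j. i \<in> {a..<a + 2 * m} \<Longrightarrow> j \<in> {a..<a + 2 * m} \<Longrightarrow> i \<noteq> j \<Longrightarrow> regular1 (\<lambda>s. A s i j)"
  shows "regular1 (\<lambda>s. pf_block a m (A s))"
  unfolding pf_block_def
proof (intro regular1_divide regular1_sum regular1_mult regular1_const regular1_prod)
  fix p k assume "p \<in> {p. p permutes {a..<a + 2 * m}}" "k \<in> {..<m}"
  then have p: "p permutes {a..<a + 2 * m}" and k: "k < m" by auto
  have "p (a + 2 * k) \<noteq> p (a + 2 * k + 1)"
    using permutes_inj[OF p] by (metis Suc_eq_plus1 injD n_not_Suc_n)
  then show "regular1 (\<lambda>s. A s (p (a + 2 * k)) (p (a + 2 * k + 1)))"
    using assms block_pair_mem[OF p k] by simp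
qed simp

context dsasm_weights begin

lemma regular1_sigma: "regular1 f \<Longrightarrow> f 1 \<noteq> 0 \<Longrightarrow> regular1 (\<lambda>s. sigma (f s))"
  unfolding sigma_def by (intro regular1_diff regular1_inverse)

lemma regular1_sh: "regular1 f \<Longrightarrow> f 1 \<noteq> 0 \<Longrightarrow> regular1 (\<lambda>s. sh (f s))"
  unfolding sigma_hat_def by (intro regular1_divide regular1_sigma regular1_const sigma_q4_nz)

lemma regular1_weights:
  assumes "regular1 f" "f 1 \<noteq> 0"
  shows "regular1 (\<lambda>s. wa (f s))" "regular1 (\<lambda>s. wb (f s))" "regular1 (\<lambda>s. amp (f s))"
    "regular1 (\<lambda>s. sigma (q\<^sup>2 * (f s)\<^sup>2))" "regular1 (\<lambda>s. corner (f s) x y)"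
proof -
  show w: "regular1 (\<lambda>s. wa (f s))" "regular1 (\<lambda>s. wb (f s))"
    unfolding wa_def wb_def using assms q_nz
    by (auto intro!: regular1_sh regular1_mult regular1_const regular1_inverse)
  show s: "regular1 (\<lambda>s. sigma (q\<^sup>2 * (f s)\<^sup>2))"
    using assms q_nz by (intro regular1_sigma regular1_mult regular1_const regular1_power) auto
  show "regular1 (\<lambda>s. amp (f s))" unfolding amp_def
    by (intro regular1_add regular1_mult regular1_const regular1_inverse assms)
  show "regular1 (\<lambda>s. corner (f s) x y)"
    by (cases x; cases y; simp; intro regular1_add regular1_mult regular1_const regular1_inverse assms s)
qed

lemma regular1_cross_op:
  assumes "\<And>t. regular1 (\<lambda>s. G s t)" "regular1 f" "f 1 \<noteq> 0"
  shows "regular1 (\<lambda>s. cross_op k (f s) (G s) t)"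
proof (cases "t k = t (Suc k)")
  case True
  then have "cross_op k (f s) (G s) t = wb (f s) * G s t" for s by (simp add: cross_op_def)
  then show ?thesis by (simp only:) (intro regular1_mult regular1_weights assms)
next
  case False
  then have "cross_op k (f s) (G s) t = G s t + wa (f s) * G s (t(k := t (Suc k), Suc k := t k))" for s
    by (simp add: cross_op_def)
  then show ?thesis by (simp only:) (intro regular1_add regular1_mult regular1_weights assms)
qed

lemma regular1_line_op:
  assumes "\<And>t. regular1 (\<lambda>s. G s t)" "regular1 f" "f 1 \<noteq> 0" "\<And>w. w \<in> set ws \<Longrightarrow> regular1 w \<and> w 1 \<noteq> 0"
  shows "regular1 (\<lambda>s. line_op k (map (\<lambda>w. w s) ws) (f s) (G s) t)"
  using assms(4)
proof (induction ws arbitrary: k t)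
  case (Cons w ws)
  show ?case unfolding list.map line_op.simps
    by (rule regular1_cross_op) (use Cons assms in \<open>auto intro: regular1_mult\<close>)
qed (use assms in simp)

lemma regular1_state_vec:
  assumes "\<And>w. w \<in> set ws \<Longrightarrow> regular1 w \<and> w 1 \<noteq> 0"
  shows "regular1 (\<lambda>s. state_vec (map (\<lambda>w. w s) ws) t)"
  using assms
proof (induction ws arbitrary: t)
  case (Cons x ws)
  have "regular1 (\<lambda>s. line_op 0 (map (\<lambda>w. w s) ws) (x s) (state_vec (map (\<lambda>w. w s) ws)) t)" for t
    by (rule regular1_line_op) (use Cons in auto)
  then show ?case unfolding list.map state_vec.simps reflect_op_def
    by (intro regular1_add regular1_mult regular1_weights) (use Cons.prems in auto)
qed (simp add: regular1_const)

text \<open>Distinct variables get distinct powers of \<open>s\<close>, so each condition excludes the zeros of a nonzero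
polynomial in \<open>s\<close>.\<close>

lemma finite_not_generic:
  assumes u: "\<And>i. i \<in> {1..n} \<Longrightarrow> u i \<noteq> 0"
  shows "finite {s. \<not> generic n (\<lambda>i. u i * s ^ i)}"
proof -
  define B where "B i j = {s. (q ^ 4 * (u i * u j)\<^sup>2) * s ^ (2 * (i + j)) = 1 * s ^ 0} \<union>
      {s. (u i * u j)\<^sup>2 * s ^ (2 * (i + j)) = q ^ 4 * s ^ 0} \<union>
      (if i = j then {} else {s. (q ^ 8 * (u i)\<^sup>2) * s ^ (2 * i) = (u j)\<^sup>2 * s ^ (2 * j)} \<union>
        {s. (u i)\<^sup>2 * s ^ (2 * i) = (u j)\<^sup>2 * s ^ (2 * j)})" for i j
  have "finite (B i j)" if "i \<in> {1..n}" "j \<in> {1..n}" for i j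
    unfolding B_def using u[OF that(1)] u[OF that(2)] q_nz that
    by (simp only: finite_Un if_split, intro conjI finite_monomial_eq impI)
       (auto intro!: finite_monomial_eq)
  then have fin: "finite ({0} \<union> (\<Union>i\<in>{1..n}. \<Union>j\<in>{1..n}. B i j))" by auto
  have "generic n (\<lambda>i. u i * s ^ i)"
    if s: "s \<notin> {0} \<union> (\<Union>i\<in>{1..n}. \<Union>j\<in>{1..n}. B i j)" for s
    unfolding generic_def
  proof (intro conjI ballI impI)
    fix i assume i: "i \<in> {1..n}"
    then show nz: "u i * s ^ i \<noteq> 0" using s u by auto
    fix j assume j: "j \<in> {1..n}"
    have B: "s \<notin> B i j" using s i j by blast
    have nz': "s \<noteq> 0" "u i \<noteq> 0" "u j \<noteq> 0" using s u i j by auto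
    have "(u i * s ^ i * (u j * s ^ j))\<^sup>2 = (u i * u j)\<^sup>2 * s ^ (2 * (i + j))"
      by (simp add: power_mult_distrib power_add power_mult[symmetric] mult_ac)
    then show "pair_wt (u i * s ^ i) (u j * s ^ j) \<noteq> 0"
      using B nz' wa_wb_zero_iff[of "u i * s ^ i * (u j * s ^ j)"]
      by (simp add: pair_wt_def B_def mult.assoc[of "q ^ 4"])
    have sq: "(u k * s ^ k)\<^sup>2 = (u k)\<^sup>2 * s ^ (2 * k)" for k
      by (simp add: power_mult_distrib power_mult[symmetric] mult.commute)
    show "(u i * s ^ i)\<^sup>2 \<noteq> (u j * s ^ j)\<^sup>2" if "i \<noteq> j"
      unfolding sq using B that by (simp add: B_def)
    show "sh (q ^ 4 * (u i * s ^ i / (u j * s ^ j))) \<noteq> 0"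
    proof (cases "i = j")
      case True
      then show ?thesis using nz' by (simp add: sh_one)
    next
      case False
      have "(q ^ 4 * (u i * s ^ i / (u j * s ^ j)))\<^sup>2 = q ^ 8 * (u i)\<^sup>2 * s ^ (2 * i) / ((u j)\<^sup>2 * s ^ (2 * j))"
        by (simp add: power_mult_distrib power_divide power_mult[symmetric] mult.commute)
      then have "(q ^ 4 * (u i * s ^ i / (u j * s ^ j)))\<^sup>2 \<noteq> 1"
        using B False nz' by (simp add: B_def)
      then show ?thesis using nz' q_nz by (subst sh_zero_iff) auto
    qed
  qed
  then have "{s. \<not> generic n (\<lambda>i. u i * s ^ i)} \<subseteq> {0} \<union> (\<Union>i\<in>{1..n}. \<Union>j\<in>{1..n}. B i j)" by blast
  then show ?thesis using fin by (rule finite_subset)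
qed

theorem pfaffian_formula:
  assumes n: "n \<ge> 1" "Suc n = a + 2 * m" "a \<le> 1"
    and u: "\<And>i. i \<in> {1..n} \<Longrightarrow> u i \<noteq> 0"
    and pair_wt: "\<And>i j. (i, j) \<in> bulk n \<Longrightarrow> pair_wt (u i) (u j) \<noteq> 0"
  shows "diff_prod n u * zfun n u = pair_wt_prod n u * pf_block a m (pf_entry u)"
proof -
  define U where "U s i = u i * s ^ i" for s i
  have U1: "U 1 = u" by (simp add: U_def fun_eq_iff)
  have rU: "regular1 (\<lambda>s. U s i)" for i unfolding U_def by (rule regular1_monomial)
  have rnum: "regular1 (\<lambda>s. pair_wt (U s i) (U s j))" if "i \<in> {1..n}" "j \<in> {1..n}" for i j
    unfolding pair_wt_def by (intro regular1_mult regular1_weights rU) (use u that in \<open>auto simp: U1\<close>)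
  have rsh: "regular1 (\<lambda>s. sh (U s i / U s j))" if "i \<in> {1..n}" "j \<in> {1..n}" for i j
    by (intro regular1_sh regular1_divide rU) (use u that in \<open>auto simp: U1\<close>)
  have "regular1 (\<lambda>s. diff_prod n (U s))"
    unfolding diff_prod_def case_prod_beta by (intro regular1_prod rsh) (auto simp: bulk_def)
  moreover have "regular1 (\<lambda>s. pair_wt_prod n (U s))"
    unfolding pair_wt_prod_def case_prod_beta by (intro regular1_prod rnum) (auto simp: bulk_def)
  moreover have "regular1 (\<lambda>s. zfun n (U s))"
  proof -
    have "rev (map (U s) [1..<Suc n]) = map (\<lambda>w. w s) (map (\<lambda>i s. U s i) (rev [1..<Suc n]))" for s
      by (simp add: rev_map del: upt_Suc)
    then show ?thesis unfolding zfun_def Zl_def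
      by (simp only:) (rule regular1_state_vec, use rU u in \<open>auto simp: U1 simp del: upt_Suc\<close>)
  qed
  moreover have "regular1 (\<lambda>s. pf_block a m (pf_entry (U s)))"
  proof (rule regular1_pf_block)
    fix i j assume ij: "i \<in> {a..<a + 2 * m}" "j \<in> {a..<a + 2 * m}" "i \<noteq> j"
    then have ij': "i \<noteq> 0 \<Longrightarrow> i \<in> {1..n}" "j \<noteq> 0 \<Longrightarrow> j \<in> {1..n}" using n by auto
    have nn: "pair_wt (u i) (u j) \<noteq> 0" if "i \<noteq> 0" "j \<noteq> 0"
      using pair_wt[of i j] pair_wt[of j i] ij(3) ij' that by (cases "i < j") (auto simp: bulk_def pair_wt_commute)
    show "regular1 (\<lambda>s. pf_entry (U s) i j)"
    proof (cases "i = 0 \<or> j = 0")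
      case True
      have amp: "regular1 (\<lambda>s. amp (U s k))" if "k \<in> {1..n}" for k
        by (rule regular1_weights(3)[OF rU]) (use u that in \<open>auto simp: U1\<close>)
      show ?thesis
      proof (cases "i = 0")
        case True
        then have "(\<lambda>s. pf_entry (U s) i j) = (\<lambda>s. amp (U s j))" "j \<noteq> 0"
          using ij(3) by (auto simp: pf_entry_def)
        then show ?thesis using amp ij' by simp
      next
        case False
        then have "(\<lambda>s. pf_entry (U s) i j) = (\<lambda>s. - amp (U s i))"
          using True by (auto simp: pf_entry_def)
        then show ?thesis using regular1_minus[OF amp[OF ij'(1)]] False by simp
      qed
    next
      case False
      then have [simp]: "i \<noteq> 0" "j \<noteq> 0" by auto
      have "regular1 (\<lambda>s. sh (U s i / U s j) * Z2 (U s i) (U s j) / pair_wt (U s i) (U s j))"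
        unfolding Z2_def
        by (intro regular1_divide regular1_mult regular1_add regular1_const regular1_weights rU rsh rnum)
           (use ij' u nn in \<open>auto simp: U1\<close>)
      then show ?thesis by (simp add: pf_entry_def)
    qed
  qed
  ultimately have reg: "regular1 (\<lambda>s. diff_prod n (U s) * zfun n (U s) - pair_wt_prod n (U s) * pf_block a m (pf_entry (U s)))"
    by (intro regular1_diff regular1_mult)
  have zero: "diff_prod n (U s) * zfun n (U s) - pair_wt_prod n (U s) * pf_block a m (pf_entry (U s)) = 0"
    if "s \<notin> {s. \<not> generic n (U s)}" for s
    using pfaffian_generic[of n "U s" a m] n that by auto
  have fin: "finite {s. \<not> generic n (U s)}"
    using finite_not_generic[of n u, OF u] unfolding U_def .
  have "diff_prod n (U 1) * zfun n (U 1) - pair_wt_prod n (U 1) * pf_block a m (pf_entry (U 1)) = 0"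
    using regular1_zero[OF reg fin zero] .
  then show ?thesis by (simp add: U1)
qed
end

section \<open>The sum over orientations as a product of vertex operators\<close>

text \<open>\<open>Vert i j\<close> is the edge above vertex \<open>(i, j)\<close> and \<open>Horiz i j\<close> the edge to its right. A configuration
is a map to \<open>bool\<close>, with \<open>True\<close> for up and left.\<close>

datatype edge = Vert nat nat | Horiz nat nat

text \<open>Undecided edges carry \<open>True\<close>; this makes configurations on a finite edge set unique as functions and
gives the top edges of columns that are not yet reached their prescribed direction.\<close>

definition confs :: "edge set \<Rightarrow> (edge \<Rightarrow> bool) set" where
  "confs E = {c. \<forall>e. e \<notin> E \<longrightarrow> c e}"

lemma finite_confs: "finite E \<Longrightarrow> finite (confs E)"
proof -
  assume "finite E"
  have "confs E \<subseteq> (\<lambda>A e. e \<notin> A) ` Pow E"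
  proof
    fix c assume "c \<in> confs E"
    then have "c = (\<lambda>e. e \<notin> {e \<in> E. \<not> c e})" "{e \<in> E. \<not> c e} \<in> Pow E" by (auto simp: confs_def)
    then show "c \<in> (\<lambda>A e. e \<notin> A) ` Pow E" by (rule image_eqI)
  qed
  then show ?thesis using \<open>finite E\<close> finite_subset by blast
qed

text \<open>The partition function of a part of the lattice with edges \<open>E\<close>, whose open edges \<open>fr p\<close> carry the
arrows \<open>s p\<close>.\<close>

definition frontier_sum :: "edge set \<Rightarrow> (nat \<Rightarrow> edge) \<Rightarrow> ((edge \<Rightarrow> bool) \<Rightarrow> 'a::field) \<Rightarrow> (nat \<Rightarrow> bool) \<Rightarrow> 'a" where
  "frontier_sum E fr W s = (\<Sum>c | c \<in> confs E \<and> (\<forall>p. c (fr p) = s p). W c)"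

text \<open>Adding a vertex: its incoming edges, at positions \<open>k\<close> and \<open>Suc k\<close>, become internal and are summed
over, while the new edges \<open>f1\<close> (right) and \<open>f2\<close> (below) take their places with values fixed by \<open>s\<close>.
So configurations of the larger part correspond to configurations of the smaller part whose arrows
at these two positions are unconstrained.\<close>

lemma frontier_sum_cross:
  assumes E: "finite E" and f: "f1 \<noteq> f2" "f1 \<notin> E" "f2 \<notin> E" "f1 \<notin> range fr" "f2 \<notin> range fr"
    and W: "\<And>c x y. W (c(f1 := x, f2 := y)) = W c"
  shows "frontier_sum (insert f1 (insert f2 E)) (fr(Suc k := f1, k := f2))
      (\<lambda>c. W c * w (c (fr (Suc k))) (c f2) (c (fr k)) (c f1)) s =
    (\<Sum>t\<in>UNIV. \<Sum>l\<in>UNIV. w t (s k) l (s (Suc k)) * frontier_sum E fr W (s(k := l, Suc k := t)))"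
proof -
  define D where "D = {c \<in> confs E. \<forall>p. p \<noteq> k \<and> p \<noteq> Suc k \<longrightarrow> c (fr p) = s p}"
  define h where "h c = w (c (fr (Suc k))) (s k) (c (fr k)) (s (Suc k)) * W c" for c
  have finD: "finite D" unfolding D_def using finite_confs[OF E] by simp
  have fr: "fr p \<noteq> f1" "fr p \<noteq> f2" for p using f by auto
  have "frontier_sum (insert f1 (insert f2 E)) (fr(Suc k := f1, k := f2))
      (\<lambda>c. W c * w (c (fr (Suc k))) (c f2) (c (fr k)) (c f1)) s = (\<Sum>c\<in>D. h c)"
    unfolding frontier_sum_def
  proof (rule sum.reindex_bij_witness[where i = "\<lambda>c. c(f1 := s (Suc k), f2 := s k)"
        and j = "\<lambda>c. c(f1 := True, f2 := True)"])
    fix c assume "c \<in> {c \<in> confs (insert f1 (insert f2 E)). \<forall>p. c ((fr(Suc k := f1, k := f2)) p) = s p}"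
    then have c: "c \<in> confs (insert f1 (insert f2 E))" and cs: "c ((fr(Suc k := f1, k := f2)) p) = s p" for p by auto
    have c12: "c f1 = s (Suc k)" "c f2 = s k" using cs[of "Suc k"] cs[of k] by auto
    show "(c(f1 := True, f2 := True))(f1 := s (Suc k), f2 := s k) = c"
      using c12 f(1) by (auto simp: fun_eq_iff)
    have "c (fr p) = s p" if "p \<noteq> k" "p \<noteq> Suc k" for p using cs[of p] that by simp
    then show "c(f1 := True, f2 := True) \<in> D" using c fr by (auto simp: D_def confs_def)
    show "h (c(f1 := True, f2 := True)) = W c * w (c (fr (Suc k))) (c f2) (c (fr k)) (c f1)"
      using fr by (simp add: h_def W c12)
  next
    fix c assume c: "c \<in> D"
    then show "(c(f1 := s (Suc k), f2 := s k))(f1 := True, f2 := True) = c"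
      using f by (auto simp: fun_eq_iff D_def confs_def)
    show "c(f1 := s (Suc k), f2 := s k) \<in>
        {c \<in> confs (insert f1 (insert f2 E)). \<forall>p. c ((fr(Suc k := f1, k := f2)) p) = s p}"
      using c fr f(1) by (auto simp: D_def confs_def)
  qed
  moreover have "(\<Sum>c\<in>D. h c) = (\<Sum>y\<in>UNIV. \<Sum>c\<in>{c \<in> D. (c (fr (Suc k)), c (fr k)) = y}. h c)"
    using sum.group[of D UNIV "\<lambda>c. (c (fr (Suc k)), c (fr k))" h] finD by simp
  moreover have "(\<Sum>c\<in>{c \<in> D. (c (fr (Suc k)), c (fr k)) = y}. h c) =
      w (fst y) (s k) (snd y) (s (Suc k)) * frontier_sum E fr W (s(k := snd y, Suc k := fst y))" for y
  proof -
    have "{c \<in> D. (c (fr (Suc k)), c (fr k)) = y} =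
        {c. c \<in> confs E \<and> (\<forall>p. c (fr p) = (s(k := snd y, Suc k := fst y)) p)}" (is "?A = ?B")
    proof (intro set_eqI iffI)
      fix c assume "c \<in> ?A"
      then show "c \<in> ?B" by (auto simp: D_def)
    next
      fix c assume "c \<in> ?B"
      then have c: "c \<in> confs E" "\<And>p. c (fr p) = (s(k := snd y, Suc k := fst y)) p" by auto
      show "c \<in> ?A" using c(1) c(2)[of k] c(2)[of "Suc k"] c(2) by (auto simp: D_def)
    qed
    moreover have "h c = w (fst y) (s k) (snd y) (s (Suc k)) * W c"
      if "c \<in> {c \<in> D. (c (fr (Suc k)), c (fr k)) = y}" for c
      using that by (auto simp: h_def)
    ultimately show ?thesis unfolding frontier_sum_def sum_distrib_left by (intro sum.cong) auto
  qed
  ultimately have "frontier_sum (insert f1 (insert f2 E)) (fr(Suc k := f1, k := f2))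
      (\<lambda>c. W c * w (c (fr (Suc k))) (c f2) (c (fr k)) (c f1)) s =
     (\<Sum>y\<in>UNIV. w (fst y) (s k) (snd y) (s (Suc k)) * frontier_sum E fr W (s(k := snd y, Suc k := fst y)))"
    by (simp only:)
  then show ?thesis
    by (simp only: sum.cartesian_product UNIV_Times_UNIV case_prod_unfold)
qed

text \<open>The same for a left boundary vertex, which replaces the single frontier edge at position \<open>0\<close>.\<close>

lemma frontier_sum_reflect:
  assumes E: "finite E" and f: "f \<notin> E" "f \<notin> range fr"
    and W: "\<And>c x. W (c(f := x)) = W c"
  shows "frontier_sum (insert f E) (fr(0 := f)) (\<lambda>c. W c * w (c (fr 0)) (c f)) s =
    (\<Sum>t\<in>UNIV. w t (s 0) * frontier_sum E fr W (s(0 := t)))"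
proof -
  define D where "D = {c \<in> confs E. \<forall>p. p \<noteq> 0 \<longrightarrow> c (fr p) = s p}"
  define h where "h c = w (c (fr 0)) (s 0) * W c" for c
  have finD: "finite D" unfolding D_def using finite_confs[OF E] by simp
  have fr: "fr p \<noteq> f" for p using f by auto
  have "frontier_sum (insert f E) (fr(0 := f)) (\<lambda>c. W c * w (c (fr 0)) (c f)) s = (\<Sum>c\<in>D. h c)"
    unfolding frontier_sum_def
  proof (rule sum.reindex_bij_witness[where i = "\<lambda>c. c(f := s 0)" and j = "\<lambda>c. c(f := True)"])
    fix c assume "c \<in> {c \<in> confs (insert f E). \<forall>p. c ((fr(0 := f)) p) = s p}"
    then have c: "c \<in> confs (insert f E)" and cs: "c ((fr(0 := f)) p) = s p" for p by auto
    have c0: "c f = s 0" using cs[of 0] by auto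
    show "(c(f := True))(f := s 0) = c" 
      by (rule ext) (use c0 in \<open>auto simp: fun_upd_apply\<close>)
    have "c (fr p) = s p" if "p \<noteq> 0" for p using cs[of p] that by simp
    then show "c(f := True) \<in> D" using c fr by (auto simp: D_def confs_def)
    show "h (c(f := True)) = W c * w (c (fr 0)) (c f)"
      using fr by (simp add: h_def W c0)
  next
    fix c assume c: "c \<in> D"
    then show "(c(f := s 0))(f := True) = c"
      using f by (auto simp: fun_eq_iff D_def confs_def)
    show "c(f := s 0) \<in> {c \<in> confs (insert f E). \<forall>p. c ((fr(0 := f)) p) = s p}"
      using c fr by (auto simp: D_def confs_def)
  qed
  moreover have "(\<Sum>c\<in>D. h c) = (\<Sum>t\<in>UNIV. \<Sum>c\<in>{c \<in> D. c (fr 0) = t}. h c)"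
    using sum.group[of D UNIV "\<lambda>c. c (fr 0)" h] finD by simp
  moreover have "(\<Sum>c\<in>{c \<in> D. c (fr 0) = t}. h c) = w t (s 0) * frontier_sum E fr W (s(0 := t))" for t
  proof -
    have "{c \<in> D. c (fr 0) = t} = {c. c \<in> confs E \<and> (\<forall>p. c (fr p) = (s(0 := t)) p)}"
      by (auto simp: D_def)
    moreover have "h c = w t (s 0) * W c" if "c \<in> {c \<in> D. c (fr 0) = t}" for c
      using that by (auto simp: h_def)
    ultimately show ?thesis unfolding frontier_sum_def sum_distrib_left by (intro sum.cong) auto
  qed
  ultimately show ?thesis by (simp only:)
qed

definition vdir_of :: "bool \<Rightarrow> vdir" where "vdir_of b = (if b then Upward else Downward)"
definition hdir_of :: "bool \<Rightarrow> hdir" where "hdir_of b = (if b then Leftward else Rightward)"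

text \<open>\<open>region n\<close> contains the edges of the first \<open>n\<close> lines apart from the fixed top edges, and \<open>front n\<close> is its
frontier: rows from the bottom up, then the tops of the later columns. The primed versions describe the stage at
which column \<open>Suc n\<close> has been added down to row \<open>m\<close>.\<close>

definition region :: "nat \<Rightarrow> edge set" where
  "region n = {Vert i j | i j. 2 \<le> i \<and> i \<le> j \<and> j \<le> n} \<union> {Horiz i j | i j. 1 \<le> i \<and> i \<le> j \<and> j \<le> n}"

definition region' :: "nat \<Rightarrow> nat \<Rightarrow> edge set" where
  "region' n m = region n \<union> {Vert i (Suc n) | i. 2 \<le> i \<and> i \<le> Suc m} \<union> {Horiz i (Suc n) | i. 1 \<le> i \<and> i \<le> m}"

definition front :: "nat \<Rightarrow> nat \<Rightarrow> edge" where
  "front n p = (if p < n then Horiz (n - p) n else Vert 1 (Suc p))"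

definition front' :: "nat \<Rightarrow> nat \<Rightarrow> nat \<Rightarrow> edge" where
  "front' n m p = (if p > n then Vert 1 (Suc p) else if p > n - m then Horiz (Suc n - p) (Suc n)
     else if p = n - m then Vert (Suc m) (Suc n) else Horiz (n - p) n)"

lemma finite_region': "finite (region' n m)"
proof -
  have "region' n m \<subseteq> (\<lambda>(i, j). Vert i j) ` ({0..Suc (n + m)} \<times> {0..Suc n}) \<union>
      (\<lambda>(i, j). Horiz i j) ` ({0..Suc (n + m)} \<times> {0..Suc n})"
    by (auto simp: region'_def region_def)
  then show ?thesis by (rule finite_subset) auto
qed

context dsasm_weights begin

definition bulkw :: "'a \<Rightarrow> bool \<Rightarrow> bool \<Rightarrow> bool \<Rightarrow> bool \<Rightarrow> 'a" where
  "bulkw x t b l r = bulk_weight q (vdir_of t, vdir_of b, hdir_of l, hdir_of r) x"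

lemma cross_op_eq_sum:
  "cross_op k x F s = (\<Sum>t\<in>UNIV. \<Sum>l\<in>UNIV. bulkw x t (s k) l (s (Suc k)) * F (s(k := l, Suc k := t)))"
  by (cases "s k"; cases "s (Suc k)")
     (simp_all add: cross_op_def UNIV_bool bulkw_def vdir_of_def hdir_of_def wa_def wb_def fun_upd_idem)

lemma reflect_op_eq_sum:
  "reflect_op x F s = (\<Sum>t\<in>UNIV. corner x t (s 0) * F (s(0 := t)))"
  by (simp add: reflect_op_def UNIV_bool add.commute)

definition wbulk :: "(nat \<Rightarrow> 'a) \<Rightarrow> (edge \<Rightarrow> bool) \<Rightarrow> nat \<Rightarrow> nat \<Rightarrow> 'a" where
  "wbulk u c i j = bulkw (u i * u j) (c (Vert i j)) (c (Vert (Suc i) j)) (c (Horiz i (j - 1))) (c (Horiz i j))"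

definition weight :: "(nat \<Rightarrow> 'a) \<Rightarrow> nat \<Rightarrow> (edge \<Rightarrow> bool) \<Rightarrow> 'a" where
  "weight u n c = (\<Prod>i=1..n. corner (u i) (c (Vert i i)) (c (Horiz i i))) * (\<Prod>(i, j)\<in>bulk n. wbulk u c i j)"

definition weight' :: "(nat \<Rightarrow> 'a) \<Rightarrow> nat \<Rightarrow> nat \<Rightarrow> (edge \<Rightarrow> bool) \<Rightarrow> 'a" where
  "weight' u n m c = weight u n c * (\<Prod>i=1..m. wbulk u c i (Suc n))"

lemma weight'_cong:
  assumes "m \<le> n" "\<And>e. e \<in> region' n m \<Longrightarrow> c e = c' e" "\<And>j. c (Vert 1 j) = c' (Vert 1 j)"
  shows "weight' u n m c = weight' u n m c'"
proof -
  have V: "c (Vert i j) = c' (Vert i j)" if "1 \<le> i" "i \<le> j" "j \<le> n \<or> j = Suc n \<and> i \<le> Suc m" for i j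
    using that assms by (cases "i = 1") (auto simp: region'_def region_def)
  have H: "c (Horiz i j) = c' (Horiz i j)" if "1 \<le> i" "i \<le> j" "j \<le> n \<or> j = Suc n \<and> i \<le> m" for i j
    using that assms by (auto simp: region'_def region_def)
  have "corner (u i) (c (Vert i i)) (c (Horiz i i)) = corner (u i) (c' (Vert i i)) (c' (Horiz i i))"
    if "i \<in> {1..n}" for i using V[of i i] H[of i i] that by simp
  moreover have "wbulk u c i j = wbulk u c' i j" if "1 \<le> i" "i < j" "j \<le> n \<or> j = Suc n \<and> i \<le> m" for i j
  proof -
    have "c (Vert i j) = c' (Vert i j)" "c (Vert (Suc i) j) = c' (Vert (Suc i) j)"
      "c (Horiz i (j - 1)) = c' (Horiz i (j - 1))" "c (Horiz i j) = c' (Horiz i j)"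
      by (rule V H, use that assms(1) in linarith, use that assms(1) in linarith, use that assms(1) in linarith)+
    then show ?thesis by (simp only: wbulk_def)
  qed
  ultimately show ?thesis using assms(1) unfolding weight'_def weight_def
    by (auto simp: bulk_def intro!: arg_cong2[where f = "(*)"] prod.cong)
qed

text \<open>Induction over the rows that column \<open>Suc n\<close> has passed.\<close>

lemma line_op_eq_frontier_sum:
  assumes F: "F = frontier_sum (region n) (front n) (weight u n)" and "m \<le> n"
  shows "line_op (n - m) (rev (map u [1..<Suc m])) (u (Suc n)) F s =
    frontier_sum (region' n m) (front' n m) (weight' u n m) s"
  using assms(2)
proof (induction m arbitrary: s)
  case 0
  have "region' n 0 = region n" by (auto simp: region'_def)
  moreover have "front' n 0 = front n" by (auto simp: front'_def front_def)
  moreover have "weight' u n 0 = weight u n" by (auto simp: weight'_def)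
  ultimately show ?case by (simp add: F)
next
  case (Suc m)
  let ?k = "n - Suc m" and ?f1 = "Horiz (Suc m) (Suc n)" and ?f2 = "Vert (Suc (Suc m)) (Suc n)"
  have k: "n - m = Suc ?k" using Suc.prems by simp
  have IH: "line_op (Suc ?k) (rev (map u [1..<Suc m])) (u (Suc n)) F =
      frontier_sum (region' n m) (front' n m) (weight' u n m)"
    using Suc.IH Suc.prems k by (intro ext) (simp del: upt_Suc)
  have "line_op ?k (rev (map u [1..<Suc (Suc m)])) (u (Suc n)) F s =
      cross_op ?k (u (Suc m) * u (Suc n)) (line_op (Suc ?k) (rev (map u [1..<Suc m])) (u (Suc n)) F) s"
    by simp
  also have "\<dots> = frontier_sum (insert ?f1 (insert ?f2 (region' n m)))
     ((front' n m)(Suc ?k := ?f1, ?k := ?f2))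
     (\<lambda>c. weight' u n m c * bulkw (u (Suc m) * u (Suc n))
        (c (front' n m (Suc ?k))) (c ?f2) (c (front' n m ?k)) (c ?f1)) s"
    unfolding IH cross_op_eq_sum
  proof (rule frontier_sum_cross[symmetric])
    show "weight' u n m (c(?f1 := x, ?f2 := y)) = weight' u n m c" for c x y
      by (rule weight'_cong) (use Suc.prems in \<open>auto simp: region'_def region_def\<close>)
    show "finite (region' n m)" by (rule finite_region')
  qed (use Suc.prems in \<open>auto simp: region'_def region_def front'_def split: if_splits\<close>)
  also have "insert ?f1 (insert ?f2 (region' n m)) = region' n (Suc m)"
    by (auto simp: region'_def le_Suc_eq)
  also have "(front' n m)(Suc ?k := ?f1, ?k := ?f2) = front' n (Suc m)"
    using Suc.prems by (auto simp: front'_def fun_eq_iff)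
  also have "(\<lambda>c. weight' u n m c * bulkw (u (Suc m) * u (Suc n))
        (c (front' n m (Suc ?k))) (c ?f2) (c (front' n m ?k)) (c ?f1)) = weight' u n (Suc m)"
    using Suc.prems by (auto simp: weight'_def wbulk_def front'_def fun_eq_iff Suc_diff_Suc)
  finally show ?case .
qed

lemma state_vec_eq_frontier_sum:
  "state_vec (rev (map u [1..<Suc n])) s = frontier_sum (region n) (front n) (weight u n) s"
proof (induction n arbitrary: s)
  case 0
  have "{c \<in> confs (region 0). \<forall>p. c (front 0 p) = s p} = (if \<forall>k. s k then {\<lambda>_. True} else {})"
    by (auto simp: confs_def region_def front_def fun_eq_iff)
  then show ?case by (simp add: frontier_sum_def weight_def)
next
  case (Suc n)
  let ?F = "state_vec (rev (map u [1..<Suc n]))" and ?f = "Horiz (Suc n) (Suc n)"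
  have F: "?F = frontier_sum (region n) (front n) (weight u n)" using Suc.IH by blast
  have L: "line_op 0 (rev (map u [1..<Suc n])) (u (Suc n)) ?F =
      frontier_sum (region' n n) (front' n n) (weight' u n n)"
    using line_op_eq_frontier_sum[OF F, of n] by (intro ext) (simp del: upt_Suc)
  have "state_vec (rev (map u [1..<Suc (Suc n)])) s =
      reflect_op (u (Suc n)) (line_op 0 (rev (map u [1..<Suc n])) (u (Suc n)) ?F) s"
    by simp
  also have "\<dots> = frontier_sum (insert ?f (region' n n)) ((front' n n)(0 := ?f))
      (\<lambda>c. weight' u n n c * corner (u (Suc n)) (c (front' n n 0)) (c ?f)) s"
    unfolding L reflect_op_eq_sum
  proof (rule frontier_sum_reflect[symmetric])
    show "weight' u n n (c(?f := x)) = weight' u n n c" for c x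
      by (rule weight'_cong) (auto simp: region'_def region_def)
    show "finite (region' n n)" by (rule finite_region')
  qed (auto simp: region'_def region_def front'_def split: if_splits)
  also have "insert ?f (region' n n) = region (Suc n)"
    by (auto simp: region'_def region_def le_Suc_eq)
  also have "(front' n n)(0 := ?f) = front (Suc n)"
    by (auto simp: front'_def front_def fun_eq_iff)
  also have "(\<lambda>c. weight' u n n c * corner (u (Suc n)) (c (front' n n 0)) (c ?f)) = weight u (Suc n)"
    by (auto simp: weight'_def weight_def prod_bulk_Suc front'_def fun_eq_iff mult_ac)
  finally show ?case .
qed

lemma zfun_eq_sum:
  "zfun n u = (\<Sum>c | c \<in> confs (region n) \<and> (\<forall>p. c (front n p)). weight u n c)"
  unfolding zfun_def Zl_def state_vec_eq_frontier_sum frontier_sum_def by simp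
end

text \<open>The arc of an edge that is directed up or left.\<close>

fun ends :: "edge \<Rightarrow> vertex \<times> vertex" where
  "ends (Vert i j) = ((i, j), (i - 1, j))"
| "ends (Horiz i j) = ((i, j + 1), (i, j))"

definition graph_edges :: "nat \<Rightarrow> edge set" where
  "graph_edges n = {Vert i j | i j. 1 \<le> i \<and> i \<le> j \<and> j \<le> n} \<union> {Horiz i j | i j. 1 \<le> i \<and> i \<le> j \<and> j \<le> n}"

definition arc :: "(edge \<Rightarrow> bool) \<Rightarrow> edge \<Rightarrow> vertex \<times> vertex" where
  "arc c e = (if c e then ends e else prod.swap (ends e))"

definition arcs :: "nat \<Rightarrow> (edge \<Rightarrow> bool) \<Rightarrow> (vertex \<times> vertex) set" where
  "arcs n c = arc c ` graph_edges n"

definition dirs :: "nat \<Rightarrow> (vertex \<times> vertex) set \<Rightarrow> edge \<Rightarrow> bool" where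
  "dirs n C e \<longleftrightarrow> (e \<in> graph_edges n \<longrightarrow> ends e \<in> C)"

definition boundary :: "nat \<Rightarrow> (vertex \<times> vertex) set \<Rightarrow> bool" where
  "boundary n C \<longleftrightarrow> (\<forall>j\<in>{1..n}. ((1, j), (0, j)) \<in> C) \<and> (\<forall>i\<in>{1..n}. ((i, n + 1), (i, n)) \<in> C)"

lemma edges_eq: "edges n = (\<lambda>e. {fst (ends e), snd (ends e)}) ` graph_edges n"
proof -
  let ?U = "\<lambda>e. {fst (ends e), snd (ends e)}"
  have "?U (Vert i j) = {(i - 1, j), (i, j)}" "?U (Horiz i j) = {(i, j), (i, j + 1)}" for i j
    by (simp_all add: insert_commute)
  moreover have "?U ` graph_edges n = {?U (Vert i j) | i j. 1 \<le> i \<and> i \<le> j \<and> j \<le> n} \<union>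
      {?U (Horiz i j) | i j. 1 \<le> i \<and> i \<le> j \<and> j \<le> n}"
    unfolding graph_edges_def by blast
  ultimately show ?thesis by (simp only: edges_def)
qed

lemma ends_distinct: "e \<in> graph_edges n \<Longrightarrow> fst (ends e) \<noteq> snd (ends e)"
  by (auto simp: graph_edges_def)

lemma ends_inj:
  "e \<in> graph_edges n \<Longrightarrow> e' \<in> graph_edges n \<Longrightarrow>
    ends e = ends e' \<or> ends e = prod.swap (ends e') \<Longrightarrow> e = e'"
  by (auto simp: graph_edges_def)

lemma arc_mem_arcs_iff:
  assumes "e \<in> graph_edges n"
  shows "ends e \<in> arcs n c \<longleftrightarrow> c e" "prod.swap (ends e) \<in> arcs n c \<longleftrightarrow> \<not> c e"
proof -
  have d: "ends e \<noteq> prod.swap (ends e)" using ends_distinct[OF assms] by (cases "ends e") auto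
  have *: "x \<in> arcs n c \<longleftrightarrow> x = arc c e" if x: "x = ends e \<or> x = prod.swap (ends e)" for x
  proof
    assume "x \<in> arcs n c"
    then obtain e' where e': "e' \<in> graph_edges n" "x = arc c e'" by (auto simp: arcs_def)
    then have "ends e = ends e' \<or> ends e = prod.swap (ends e')"
      using x by (auto simp: arc_def split: if_splits) (metis swap_swap)+
    then show "x = arc c e" using ends_inj[OF assms e'(1)] e'(2) by simp
  qed (use assms in \<open>auto simp: arcs_def\<close>)
  show "ends e \<in> arcs n c \<longleftrightarrow> c e" "prod.swap (ends e) \<in> arcs n c \<longleftrightarrow> \<not> c e"
    using *[of "ends e"] *[of "prod.swap (ends e)"] d by (auto simp: arc_def)
qed

lemma orientation_arcs: "orientation n (arcs n c)"
  unfolding orientation_def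
proof (intro conjI allI impI)
  fix x y assume "(x, y) \<in> arcs n c"
  then obtain e where e: "e \<in> graph_edges n" "(x, y) = ends e \<or> (x, y) = prod.swap (ends e)"
    by (auto simp: arcs_def arc_def split: if_splits)
  then have "{x, y} = {fst (ends e), snd (ends e)}" by (cases "ends e") auto
  then show "{x, y} \<in> edges n" using e by (auto simp: edges_eq)
next
  fix x y assume "{x, y} \<in> edges n"
  then obtain e where e: "e \<in> graph_edges n" "{x, y} = {fst (ends e), snd (ends e)}" by (auto simp: edges_eq)
  then have "(x, y) = ends e \<and> (y, x) = prod.swap (ends e) \<or> (y, x) = ends e \<and> (x, y) = prod.swap (ends e)"
    by (cases "ends e") (auto simp: doubleton_eq_iff)
  then show "(x, y) \<in> arcs n c \<longleftrightarrow> (y, x) \<notin> arcs n c"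
    using arc_mem_arcs_iff[OF e(1), of c] by auto
qed

lemma arcs_dirs:
  assumes "orientation n C"
  shows "arcs n (dirs n C) = C"
proof -
  have swap: "prod.swap (ends e) \<in> C \<longleftrightarrow> ends e \<notin> C" if "e \<in> graph_edges n" for e
  proof -
    obtain x y where xy: "ends e = (x, y)" by (cases "ends e")
    have "{x, y} \<in> edges n" using that xy by (force simp: edges_eq)
    then show ?thesis using assms xy unfolding orientation_def by (metis swap_simp)
  qed
  have "arc (dirs n C) e \<in> C" if "e \<in> graph_edges n" for e
    using swap[OF that] that by (auto simp: arc_def dirs_def)
  moreover have "p \<in> arcs n (dirs n C)" if p: "p \<in> C" for p
  proof -
    obtain x y where xy: "p = (x, y)" by (cases p)
    then have "{x, y} \<in> edges n" using assms p unfolding orientation_def by blast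
    then obtain e where e: "e \<in> graph_edges n" "{x, y} = {fst (ends e), snd (ends e)}" by (auto simp: edges_eq)
    then have "p = ends e \<or> p = prod.swap (ends e)"
      using xy by (cases "ends e") (auto simp: doubleton_eq_iff)
    then have "p = arc (dirs n C) e"
      using p e(1) swap[OF e(1)] by (auto simp: arc_def dirs_def)
    then show ?thesis using e(1) by (simp add: arcs_def)
  qed
  ultimately show ?thesis by (auto simp: arcs_def)
qed

lemma dirs_arcs: "(\<And>e. e \<notin> graph_edges n \<Longrightarrow> c e) \<Longrightarrow> dirs n (arcs n c) = c"
  using arc_mem_arcs_iff by (fastforce simp: dirs_def fun_eq_iff)

lemma boundary_arcs_iff:
  "boundary n (arcs n c) \<longleftrightarrow> (\<forall>j\<in>{1..n}. c (Vert 1 j)) \<and> (\<forall>i\<in>{1..n}. c (Horiz i n))"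
proof -
  have "((1, j), (0, j)) \<in> arcs n c \<longleftrightarrow> c (Vert 1 j)" if "j \<in> {1..n}" for j
    using arc_mem_arcs_iff(1)[of "Vert 1 j" n c] that by (simp add: graph_edges_def)
  moreover have "((i, n + 1), (i, n)) \<in> arcs n c \<longleftrightarrow> c (Horiz i n)" if "i \<in> {1..n}" for i
    using arc_mem_arcs_iff(1)[of "Horiz i n" n c] that by (simp add: graph_edges_def)
  ultimately show ?thesis by (simp add: boundary_def)
qed

definition bconfs :: "nat \<Rightarrow> (edge \<Rightarrow> bool) set" where
  "bconfs n = {c. (\<forall>e. e \<notin> graph_edges n \<longrightarrow> c e) \<and>
     (\<forall>j\<in>{1..n}. c (Vert 1 j)) \<and> (\<forall>i\<in>{1..n}. c (Horiz i n))}"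

lemma bconfs_eq: "bconfs n = {c. c \<in> confs (region n) \<and> (\<forall>p. c (front n p))}"
proof (intro set_eqI iffI)
  fix c assume c: "c \<in> bconfs n"
  have "c e" if e: "e \<notin> region n" for e
  proof (cases "e \<in> graph_edges n")
    case True
    then obtain j where "e = Vert 1 j" "j \<in> {1..n}"
      using e by (auto simp: region_def graph_edges_def) (metis One_nat_def Suc_1 le_antisym not_less_eq_eq)
    then show ?thesis using c by (simp add: bconfs_def)
  qed (use c in \<open>auto simp: bconfs_def\<close>)
  moreover have "c (front n p)" for p
  proof (cases "p < n")
    case True
    then show ?thesis using c by (simp add: bconfs_def front_def)
  next
    case False
    then have "Vert 1 (Suc p) \<notin> graph_edges n" by (auto simp: graph_edges_def)
    then show ?thesis using False c by (simp add: bconfs_def front_def)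
  qed
  ultimately show "c \<in> {c. c \<in> confs (region n) \<and> (\<forall>p. c (front n p))}" by (simp add: confs_def)
next
  fix c assume c: "c \<in> {c. c \<in> confs (region n) \<and> (\<forall>p. c (front n p))}"
  have "region n \<subseteq> graph_edges n" by (auto simp: region_def graph_edges_def)
  moreover have "c (Vert 1 j)" for j using c by (auto simp: confs_def region_def)
  moreover have "c (Horiz i n)" if "i \<in> {1..n}" for i
  proof -
    have "front n (n - i) = Horiz i n" using that by (auto simp: front_def)
    then show ?thesis using c by (metis (mono_tags, lifting) mem_Collect_eq)
  qed
  ultimately show "c \<in> bconfs n" using c by (auto simp: bconfs_def confs_def)
qed

text \<open>Orientations with the prescribed boundary arrows correspond to configurations; the ice rule
is not imposed on either side.\<close>

lemma bij_arcs: "bij_betw (arcs n) (bconfs n) {C. orientation n C \<and> boundary n C}"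
proof (rule bij_betwI[where g = "dirs n"])
  show "arcs n \<in> bconfs n \<rightarrow> {C. orientation n C \<and> boundary n C}"
    by (auto simp: orientation_arcs boundary_arcs_iff bconfs_def)
  show "dirs n \<in> {C. orientation n C \<and> boundary n C} \<rightarrow> bconfs n"
  proof
    fix C assume C: "C \<in> {C. orientation n C \<and> boundary n C}"
    then have "boundary n (arcs n (dirs n C))" by (simp add: arcs_dirs)
    then show "dirs n C \<in> bconfs n" unfolding boundary_arcs_iff by (simp add: bconfs_def dirs_def)
  qed
  show "dirs n (arcs n c) = c" if "c \<in> bconfs n" for c
    using that by (intro dirs_arcs) (simp add: bconfs_def)
qed (simp add: arcs_dirs)

lemma bulk_config_arcs:
  assumes "1 \<le> i" "i < j" "j \<le> n"
  shows "bulk_config (arcs n c) i j =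
    (vdir_of (c (Vert i j)), vdir_of (c (Vert (Suc i) j)), hdir_of (c (Horiz i (j - 1))), hdir_of (c (Horiz i j)))"
proof -
  have mem: "Vert i j \<in> graph_edges n" "Vert (Suc i) j \<in> graph_edges n"
    "Horiz i (j - 1) \<in> graph_edges n" "Horiz i j \<in> graph_edges n"
    using assms by (auto simp: graph_edges_def)
  show ?thesis
    using assms mem[THEN arc_mem_arcs_iff(1), of c] mem[THEN arc_mem_arcs_iff(2), of c]
    by (simp add: bulk_config_def vert_def horiz_def vdir_of_def hdir_of_def)
qed

lemma left_config_arcs:
  assumes "1 \<le> i" "i \<le> n"
  shows "left_config (arcs n c) i = (vdir_of (c (Vert i i)), hdir_of (c (Horiz i i)))"
  using assms arc_mem_arcs_iff(1)[of "Vert i i" n c] arc_mem_arcs_iff(2)[of "Horiz i i" n c]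
  by (auto simp: left_config_def vert_def horiz_def vdir_of_def hdir_of_def graph_edges_def)

lemma neighbours_arcs:
  assumes "1 \<le> i" "i < j" "j \<le> n"
  shows "{w. (w, (i, j)) \<in> arcs n c} =
      (if c (Vert i j) then {} else {(i - 1, j)}) \<union> (if c (Vert (Suc i) j) then {(Suc i, j)} else {}) \<union>
      (if c (Horiz i (j - 1)) then {} else {(i, j - 1)}) \<union> (if c (Horiz i j) then {(i, Suc j)} else {})"
    and "{w. ((i, j), w) \<in> arcs n c} =
      (if c (Vert i j) then {(i - 1, j)} else {}) \<union> (if c (Vert (Suc i) j) then {} else {(Suc i, j)}) \<union>
      (if c (Horiz i (j - 1)) then {(i, j - 1)} else {}) \<union> (if c (Horiz i j) then {} else {(i, Suc j)})"
proof -
  have mem: "Vert i j \<in> graph_edges n" "Vert (Suc i) j \<in> graph_edges n"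
    "Horiz i (j - 1) \<in> graph_edges n" "Horiz i j \<in> graph_edges n"
    using assms by (auto simp: graph_edges_def)
  note iff = mem[THEN arc_mem_arcs_iff(1), of c] mem[THEN arc_mem_arcs_iff(2), of c]
  have nb: "w \<in> {(i - 1, j), (Suc i, j), (i, j - 1), (i, Suc j)}"
    if "(w, (i, j)) \<in> arcs n c \<or> ((i, j), w) \<in> arcs n c" for w
  proof -
    from that obtain p where p: "p \<in> arcs n c" "p = (w, (i, j)) \<or> p = ((i, j), w)" by blast
    from p(1) obtain e where e: "e \<in> graph_edges n" "p = arc c e" by (auto simp: arcs_def)
    show ?thesis using p(2) e by (cases e) (auto simp: arc_def graph_edges_def split: if_splits)
  qed
  have j: "Suc (j - 1) = j" using assms by simp
  have dir: "((i, j), (i - 1, j)) \<in> arcs n c \<longleftrightarrow> c (Vert i j)"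
    "((i - 1, j), (i, j)) \<in> arcs n c \<longleftrightarrow> \<not> c (Vert i j)"
    "((Suc i, j), (i, j)) \<in> arcs n c \<longleftrightarrow> c (Vert (Suc i) j)"
    "((i, j), (Suc i, j)) \<in> arcs n c \<longleftrightarrow> \<not> c (Vert (Suc i) j)"
    "((i, j), (i, j - 1)) \<in> arcs n c \<longleftrightarrow> c (Horiz i (j - 1))"
    "((i, j - 1), (i, j)) \<in> arcs n c \<longleftrightarrow> \<not> c (Horiz i (j - 1))"
    "((i, Suc j), (i, j)) \<in> arcs n c \<longleftrightarrow> c (Horiz i j)"
    "((i, j), (i, Suc j)) \<in> arcs n c \<longleftrightarrow> \<not> c (Horiz i j)"
    using iff by (simp_all only: ends.simps swap_simp diff_Suc_1 Suc_eq_plus1[symmetric] j)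
  have if_neg: "(if \<not> b then x else y) = (if b then y else x)" for b and x y :: "vertex set" by simp
  have split: "{w. P w} = {w \<in> {a}. P w} \<union> {w \<in> {b}. P w} \<union> {w \<in> {d}. P w} \<union> {w \<in> {e}. P w}"
    if "\<And>w. P w \<Longrightarrow> w \<in> {a, b, d, e}" for P and a b d e :: vertex
    using that by auto
  have single: "{w \<in> {a}. P w} = (if P a then {a} else {})" for P and a :: vertex by auto
  show "{w. (w, (i, j)) \<in> arcs n c} =
      (if c (Vert i j) then {} else {(i - 1, j)}) \<union> (if c (Vert (Suc i) j) then {(Suc i, j)} else {}) \<union>
      (if c (Horiz i (j - 1)) then {} else {(i, j - 1)}) \<union> (if c (Horiz i j) then {(i, Suc j)} else {})"
    by (subst split[OF nb]) (simp_all only: single dir if_neg simp_thms)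
  show "{w. ((i, j), w) \<in> arcs n c} =
      (if c (Vert i j) then {(i - 1, j)} else {}) \<union> (if c (Vert (Suc i) j) then {} else {(Suc i, j)}) \<union>
      (if c (Horiz i (j - 1)) then {(i, j - 1)} else {}) \<union> (if c (Horiz i j) then {} else {(i, Suc j)})"
    by (subst split[OF nb]) (simp_all only: single dir if_neg simp_thms)
qed

context dsasm_weights begin

text \<open>Only the six vertex types with two incoming and two outgoing edges can have a nonzero weight; hence
orientations that violate the ice rule contribute \<open>0\<close> to the unrestricted sum.\<close>

lemma ice_rule:
  assumes ij: "1 \<le> i" "i < j" "j \<le> n"
    and nz: "bulk_weight q (bulk_config (arcs n c) i j) x \<noteq> 0"
  shows "card {w. (w, (i, j)) \<in> arcs n c} = 2" "card {w. ((i, j), w) \<in> arcs n c} = 2"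
  unfolding neighbours_arcs[OF ij] using nz ij unfolding bulk_config_arcs[OF ij]
  by (cases "c (Vert i j)"; cases "c (Vert (Suc i) j)"; cases "c (Horiz i (j - 1))"; cases "c (Horiz i j)";
      simp add: vdir_of_def hdir_of_def)+

lemma left_weight_eq:
  "left_weight q \<alpha> \<beta> \<gamma> \<delta> \<phi> (vdir_of t, hdir_of l) x = corner x t l * \<phi> x"
  by (cases t; cases l) (simp_all add: vdir_of_def hdir_of_def)

text \<open>The sum is extended to all orientations with the prescribed boundary and then evaluated vertex by vertex. The
factors \<open>\<phi> (u i)\<close> come out of the left boundary weights.\<close>

theorem dsasm_Z_eq: "dsasm_Z q \<alpha> \<beta> \<gamma> \<delta> \<phi> n u = (\<Prod>i=1..n. \<phi> (u i)) * zfun n u"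
proof -
  let ?O = "{C. orientation n C \<and> boundary n C}"
  define h where "h C = (\<Prod>i=1..n. left_weight q \<alpha> \<beta> \<gamma> \<delta> \<phi> (left_config C i) (u i)) *
        (\<Prod>(i, j)\<in>bulk n. bulk_weight q (bulk_config C i j) (u i * u j))" for C
  have "finite (region n)" using finite_region'[of n 0] by (simp add: region'_def)
  then have "finite (bconfs n)" unfolding bconfs_eq using finite_confs by simp
  then have fin: "finite ?O" using bij_betw_finite[OF bij_arcs] by blast
  have "dsasm_Z q \<alpha> \<beta> \<gamma> \<delta> \<phi> n u = (\<Sum>C\<in>six_vertex n. h C)" by (simp add: dsasm_Z_def h_def)
  also have "\<dots> = (\<Sum>C\<in>?O. h C)"
  proof (rule sum.mono_neutral_left[OF fin])
    show "six_vertex n \<subseteq> ?O" by (auto simp: six_vertex_def boundary_def)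
    show "\<forall>C\<in>?O - six_vertex n. h C = 0"
    proof
      fix C assume C: "C \<in> ?O - six_vertex n"
      then have O: "arcs n (dirs n C) = C" by (simp add: arcs_dirs)
      from C obtain v where "v \<in> bulk n" "\<not> (card {w. (w, v) \<in> C} = 2 \<and> card {w. (v, w) \<in> C} = 2)"
        unfolding six_vertex_def boundary_def by blast
      then obtain i j where ij: "(i, j) \<in> bulk n" "\<not> (card {w. (w, (i, j)) \<in> C} = 2 \<and> card {w. ((i, j), w) \<in> C} = 2)"
        by (cases v) auto
      then have "bulk_weight q (bulk_config C i j) (u i * u j) = 0"
        using ice_rule[of i j n "dirs n C"] unfolding O by (auto simp: bulk_def)
      then have "(\<Prod>(i, j)\<in>bulk n. bulk_weight q (bulk_config C i j) (u i * u j)) = 0"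
        using ij(1) by (intro prod_zero bexI[of _ "(i, j)"]) auto
      then show "h C = 0" by (simp add: h_def)
    qed
  qed
  also have "\<dots> = (\<Sum>c\<in>bconfs n. h (arcs n c))"
    by (rule sum.reindex_bij_betw[OF bij_arcs, symmetric])
  also have "\<dots> = (\<Sum>c\<in>bconfs n. (\<Prod>i=1..n. \<phi> (u i)) * weight u n c)"
  proof (rule sum.cong[OF refl])
    fix c
    have "(\<Prod>i=1..n. left_weight q \<alpha> \<beta> \<gamma> \<delta> \<phi> (left_config (arcs n c) i) (u i)) =
        (\<Prod>i=1..n. corner (u i) (c (Vert i i)) (c (Horiz i i)) * \<phi> (u i))"
      by (rule prod.cong) (auto simp: left_config_arcs left_weight_eq)
    moreover have "(\<Prod>(i, j)\<in>bulk n. bulk_weight q (bulk_config (arcs n c) i j) (u i * u j)) =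
        (\<Prod>(i, j)\<in>bulk n. wbulk u c i j)"
      by (rule prod.cong) (auto simp: bulk_def bulk_config_arcs wbulk_def bulkw_def)
    ultimately show "h (arcs n c) = (\<Prod>i=1..n. \<phi> (u i)) * weight u n c"
      by (simp add: h_def weight_def prod.distrib mult_ac)
  qed
  also have "\<dots> = (\<Prod>i=1..n. \<phi> (u i)) * zfun n u"
    by (simp add: zfun_eq_sum bconfs_eq sum_distrib_left)
  finally show ?thesis .
qed
end

context dsasm_weights begin

section \<open>The Pfaffian formula\<close>

lemma pair_wt_eq: "pair_wt x y = sh (q\<^sup>2 * x * y) * sh (q\<^sup>2 * inverse x * inverse y)"
  by (simp add: pair_wt_def wa_def wb_def mult.assoc)

lemma Z2_eq: "Z2 x y = (\<alpha> * q * x + \<beta> * inverse q * inverse x) * (\<alpha> * q * y + \<beta> * inverse q * inverse y) *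
    sh (q\<^sup>2 * inverse x * inverse y) + \<gamma> * \<delta> * sigma (q\<^sup>2 * x\<^sup>2) * sigma (q\<^sup>2 * y\<^sup>2)"
  by (simp add: Z2_def amp_def wb_def mult.assoc)

lemma dsasm_Z_small:
  "dsasm_Z q \<alpha> \<beta> \<gamma> \<delta> \<phi> 1 (\<lambda>_. x) = \<phi> x * amp x"
  "dsasm_Z q \<alpha> \<beta> \<gamma> \<delta> \<phi> 2 (\<lambda>k. if k = 1 then x else y) = \<phi> x * \<phi> y * Z2 x y"
proof -
  have "[1..<Suc 1] = [1]" "[1..<Suc 2] = [1, 2]" by (simp_all add: upt_rec)
  then show "dsasm_Z q \<alpha> \<beta> \<gamma> \<delta> \<phi> 1 (\<lambda>_. x) = \<phi> x * amp x"
    "dsasm_Z q \<alpha> \<beta> \<gamma> \<delta> \<phi> 2 (\<lambda>k. if k = 1 then x else y) = \<phi> x * \<phi> y * Z2 x y"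
    by (simp_all add: dsasm_Z_eq zfun_def Zl_one Zl_two numeral_2_eq_2 del: upt_Suc)
qed

text \<open>The scaling \<open>d\<close> allows for the factors \<open>\<phi> (u i)\<close> in entries that are themselves partition functions;
index \<open>0\<close> gets the factor \<open>1\<close>.\<close>

lemma Pf_eq_pf_block:
  assumes "Suc n = a + 2 * m"
    and "\<And>i j. i \<in> {a..n} \<Longrightarrow> j \<in> {a..n} \<Longrightarrow> i < j \<Longrightarrow> B i j = d i * d j * pf_entry u i j"
  shows "Pf a n B = (\<Prod>i\<in>{a..<a + 2 * m}. d i) * pf_block a m (pf_entry u)"
proof -
  have "pf_entry u i i = 0" for i by (simp add: pf_entry_def sigma_hat_def sigma_def)
  then have "skew_completion B i j = d i * d j * pf_entry u i j"
    if "i \<in> {a..<a + 2 * m}" "j \<in> {a..<a + 2 * m}" for i j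
    using assms(2)[of i j] assms(2)[of j i] that assms(1) pf_entry_skew[of u j i]
    by (cases i j rule: linorder_cases) (auto simp: skew_completion_def)
  then have "pf_block a m (skew_completion B) = pf_block a m (\<lambda>i j. d i * d j * pf_entry u i j)"
    by (rule pf_block_cong)
  then show ?thesis
    by (simp only: Pf_def pfaffian_eq_pf_block[OF assms(1)] pf_block_scale)
qed
end

theorem theorem5p7:
  fixes q \<alpha> \<beta> \<gamma> \<delta> :: "'a::field_char_0"
    and \<phi> :: "'a \<Rightarrow> 'a" and u :: "nat \<Rightarrow> 'a" and n :: nat
  assumes "n \<ge> 1"
    and "\<exists>x. \<phi> x \<noteq> 0"
    and "q \<noteq> 0" and "sigma (q ^ 4) \<noteq> 0"
    and "\<And>i. i \<in> {1..n} \<Longrightarrow> u i \<noteq> 0"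
    and "\<And>i j. (i, j) \<in> bulk n \<Longrightarrow> sigma (u i * inverse (u j)) \<noteq> 0"
    and "\<And>i j. (i, j) \<in> bulk n \<Longrightarrow> sigma (q\<^sup>2 * u i * u j) \<noteq> 0"
    and "\<And>i j. (i, j) \<in> bulk n \<Longrightarrow> sigma (q\<^sup>2 * inverse (u i) * inverse (u j)) \<noteq> 0"
  shows
    "dsasm_Z q \<alpha> \<beta> \<gamma> \<delta> \<phi> n u =
       (\<Prod>(i, j)\<in>bulk n.
          sigma_hat q (q\<^sup>2 * u i * u j) * sigma_hat q (q\<^sup>2 * inverse (u i) * inverse (u j)) /
          sigma_hat q (u i * inverse (u j))) *
       Pf (chi_even n) n (\<lambda>i j.
         if i = 0 then dsasm_Z q \<alpha> \<beta> \<gamma> \<delta> \<phi> 1 (\<lambda>_. u j)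
         else sigma_hat q (u i * inverse (u j)) *
              dsasm_Z q \<alpha> \<beta> \<gamma> \<delta> \<phi> 2 (\<lambda>k. if k = 1 then u i else u j) /
              (sigma_hat q (q\<^sup>2 * u i * u j) *
               sigma_hat q (q\<^sup>2 * inverse (u i) * inverse (u j))))
     \<and>
     dsasm_Z q \<alpha> \<beta> \<gamma> \<delta> \<phi> n u =
       (\<Prod>i=1..n. \<phi> (u i)) *
       (\<Prod>(i, j)\<in>bulk n.
          sigma_hat q (q\<^sup>2 * u i * u j) * sigma_hat q (q\<^sup>2 * inverse (u i) * inverse (u j)) /
          sigma_hat q (u i * inverse (u j))) *
       Pf (chi_even n) n (\<lambda>i j.
         if i = 0 then \<alpha> * q * u j + \<beta> * inverse q * inverse (u j)
         else sigma_hat q (u i * inverse (u j)) *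
              ((\<alpha> * q * u i + \<beta> * inverse q * inverse (u i)) *
               (\<alpha> * q * u j + \<beta> * inverse q * inverse (u j)) *
               sigma_hat q (q\<^sup>2 * inverse (u i) * inverse (u j)) +
               \<gamma> * \<delta> * sigma (q\<^sup>2 * (u i)\<^sup>2) * sigma (q\<^sup>2 * (u j)\<^sup>2)) /
              (sigma_hat q (q\<^sup>2 * u i * u j) *
               sigma_hat q (q\<^sup>2 * inverse (u i) * inverse (u j))))"
proof -
  interpret dsasm_weights q \<alpha> \<beta> \<gamma> \<delta>
    by unfold_locales (use assms in auto)
  define a where "a = chi_even n"
  define m where "m = (Suc n - a) div 2"
  have a: "a \<le> 1" "Suc n = a + 2 * m"
    by (auto simp: a_def m_def chi_even_def elim!: evenE oddE)
  have num_nz: "pair_wt (u i) (u j) \<noteq> 0" if "(i, j) \<in> bulk n" for i j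
    using assms(7,8)[OF that] assms(4) by (simp add: pair_wt_eq sigma_hat_def)
  have "sh (u i / u j) \<noteq> 0" if "(i, j) \<in> bulk n" for i j
    using assms(6)[OF that] assms(4) by (simp add: sigma_hat_def divide_inverse)
  then have "diff_prod n u \<noteq> 0" unfolding diff_prod_def by (auto simp: prod_zero_iff)
  moreover have "diff_prod n u * zfun n u = pair_wt_prod n u * pf_block a m (pf_entry u)"
    by (rule pfaffian_formula[OF assms(1) a(2,1) assms(5) num_nz])
  ultimately have zfun: "zfun n u = pair_wt_prod n u / diff_prod n u * pf_block a m (pf_entry u)"
    by (simp add: field_simps)
  have ratio: "(\<Prod>(i, j)\<in>bulk n.
          sigma_hat q (q\<^sup>2 * u i * u j) * sigma_hat q (q\<^sup>2 * inverse (u i) * inverse (u j)) /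
          sigma_hat q (u i * inverse (u j))) = pair_wt_prod n u / diff_prod n u"
  proof -
    have inv: "x * inverse y = x / y" for x y :: 'a by (simp add: divide_inverse)
    show ?thesis
      unfolding pair_wt_prod_def diff_prod_def pair_wt_eq case_prod_unfold prod_dividef[symmetric] inv ..
  qed
  \<comment> \<open>The row of index \<open>0\<close>, present for odd \<open>n\<close>, carries no variable.\<close>
  define d where "d i = (if i = 0 then 1 else \<phi> (u i))" for i
  have "{a..<a + 2 * m} = (if a = 0 then insert 0 {1..n} else {1..n})" using a by auto
  then have d: "(\<Prod>i\<in>{a..<a + 2 * m}. d i) = (\<Prod>i=1..n. \<phi> (u i))"
    by (auto simp: d_def intro!: prod.cong)
  have "Pf a n (\<lambda>i j.
         if i = 0 then dsasm_Z q \<alpha> \<beta> \<gamma> \<delta> \<phi> 1 (\<lambda>_. u j)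
         else sigma_hat q (u i * inverse (u j)) *
              dsasm_Z q \<alpha> \<beta> \<gamma> \<delta> \<phi> 2 (\<lambda>k. if k = 1 then u i else u j) /
              (sigma_hat q (q\<^sup>2 * u i * u j) *
               sigma_hat q (q\<^sup>2 * inverse (u i) * inverse (u j))))
      = (\<Prod>i=1..n. \<phi> (u i)) * pf_block a m (pf_entry u)"
    unfolding d[symmetric]
    by (rule Pf_eq_pf_block[OF a(2)]) (simp add: dsasm_Z_small[unfolded One_nat_def] d_def pf_entry_def pair_wt_eq divide_inverse)
  moreover have "Pf a n (\<lambda>i j.
         if i = 0 then \<alpha> * q * u j + \<beta> * inverse q * inverse (u j)
         else sigma_hat q (u i * inverse (u j)) *
              ((\<alpha> * q * u i + \<beta> * inverse q * inverse (u i)) *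
               (\<alpha> * q * u j + \<beta> * inverse q * inverse (u j)) *
               sigma_hat q (q\<^sup>2 * inverse (u i) * inverse (u j)) +
               \<gamma> * \<delta> * sigma (q\<^sup>2 * (u i)\<^sup>2) * sigma (q\<^sup>2 * (u j)\<^sup>2)) /
              (sigma_hat q (q\<^sup>2 * u i * u j) *
               sigma_hat q (q\<^sup>2 * inverse (u i) * inverse (u j))))
      = (\<Prod>i\<in>{a..<a + 2 * m}. 1) * pf_block a m (pf_entry u)"
    by (rule Pf_eq_pf_block[OF a(2)]) (simp add: pf_entry_def pair_wt_eq Z2_eq amp_def divide_inverse)
  ultimately show ?thesis
    unfolding dsasm_Z_eq[of \<phi> n u] ratio zfun a_def[symmetric] by (simp add: mult_ac)
qed

end
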